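(* Let $\omega\subset\mathbb{R}^d$ be open, let $f=[(f_\varepsilon)_\varepsilon]\in\mathcal{G}(\omega)$ be $g$-microanalytic at $(x_0,\xi_0)\in\omega\times(\mathbb{R}^d\setminus\{0\})$, and let $T\in\mathcal{D}'(V)$ be strongly associated to $f|_V$, where $V\subset\omega$ is an open neighborhood of $x_0$. Then $T$ is microanalytic at $(x_0,\xi_0)$.
   Context: For $\omega\subset\mathbb{R}^d$ open, $\mathcal{E}_M(\omega)$ is the set of nets $(f_\varepsilon)_{\varepsilon\in(0,1)}$ of smooth functions on $\omega$ such that for every compact $K\subset\omega$ and $\alpha\in\mathbb{N}_0^d$ there is $a\in\mathbb{R}$ with $\sup_{x\in K}|f_\varepsilon^{(\alpha)}(x)|=O(\varepsilon^a)$ as $\varepsilon\to0$; $\mathcal{N}(\omega)$ is the ideal of nets for which this holds for every $a\in\mathbb{R}$, every $K$ and every $\alpha$. The Colombeau algebra is $\mathcal{G}(\omega)=\mathcal{E}_M(\omega)/\mathcal{N}(\omega)$. Fourier transform: $\hat\phi(\xi)=\int_{\mathbb{R}^d}e^{-ix\xi}\phi(x)\,dx$. Cut-off sequences: for $x_0\in\omega$ there exist open sets $W,U$ with $x_0\in W\subset\subset U\subset\subset\omega$ and sequences $(\kappa_n)_n$ in $\mathcal{D}(U)$ with $\kappa_n\equiv1$ on $W$ for all $n\in\mathbb{N}$, such that for every $\alpha\in\mathbb{N}_0^d$ there is $C_\alpha>0$ with $|\kappa_n^{(\alpha+\beta)}(x)|\le C_\alpha(C_\alpha n)^{|\beta|}$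 for $|\beta|\le n$, $n\in\mathbb{N}$. Call such $(W,U,(\kappa_n)_n)$ an admissible cut-off at $x_0$. $f\in\mathcal{G}(\omega)$ is $g$-microanalytic at $(x_0,\xi_0)\in\omega\times(\mathbb{R}^d\setminus\{0\})$ if there exist an admissible cut-off $(W,U,(\kappa_n)_n)$ at $x_0$, an open cone $\Gamma$ around $\xi_0$, a representative $(f_\varepsilon)_\varepsilon$ of $f$, and $a>0$, $C>0$, $\varepsilon_0\in(0,1)$ such that $$|\widehat{\kappa_nf_\varepsilon}(\xi)|\le C\varepsilon^{-a}\Big(\frac{Cn}{1+|\xi|}\Big)^n,\quad n\in\mathbb{N},\ \xi\in\Gamma,\ \varepsilon\in(0,\varepsilon_0).$$ A distribution $T$ on an open set is microanalytic at $(x_0,\xi_0)$ if there are an admissible cut-off $(W,U,(\kappa_n)_n)$ at $x_0$ in that open set, an open cone $\Gamma$ around $\xi_0$ and $C>0$ with $|\widehat{\kappa_nT}(\xi)|\le C\big(\frac{Cn}{1+|\xi|}\big)^n$ for $n\in\mathbb{N}$, $\xi\in\Gamma$. $T\in\mathcal{D}'(V)$ and $f=[(f_\varepsilon)_\varepsilon]\in\mathcal{G}(V)$ are strongly associated if for every compact $K\subset V$ there exists $a>0$ such that $|\langle T-f_\varepsilon,\theta\rangle|=O(\varepsilon^a)$ as $\varepsilon\to0$ for every $\theta\in\mathcal{D}(V)$ with $\mathrm{supp}\,\theta\subset K$. *)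

theory Defs
  imports "HOL-Analysis.Analysis" "HOL-Library.Landau_Symbols"
begin

text \<open>
  Functions on an open set \<open>S\<close> of \<open>\<real>\<^sup>d\<close> are total functions on \<open>real ^ 'd\<close> whose values outside
  \<open>S\<close> are irrelevant. Multi-indices are vectors of type \<open>nat ^ 'd\<close>. The index set \<open>\<nat>\<close> of cut-off
  sequences is \<open>{1, 2, \<dots>}\<close>.
\<close>

subsection \<open>Smooth functions and multi-index derivatives\<close>

definition partial :: "'d \<Rightarrow> (real ^ 'd \<Rightarrow> complex) \<Rightarrow> real ^ 'd \<Rightarrow> complex" where
  "partial i f x = frechet_derivative f (at x) (axis i 1)"

definition partials :: "'d list \<Rightarrow> (real ^ 'd \<Rightarrow> complex) \<Rightarrow> real ^ 'd \<Rightarrow> complex" where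
  "partials is f = foldr partial is f"

text \<open>For open \<open>S\<close>, differentiability of every iterated partial derivative is \<open>C\<^sup>\<infinity>\<close>.\<close>

definition smooth_on :: "(real ^ 'd) set \<Rightarrow> (real ^ 'd \<Rightarrow> complex) \<Rightarrow> bool" where
  "smooth_on S f \<longleftrightarrow> (\<forall>is. \<forall>x\<in>S. partials is f differentiable (at x))"

definition mi_order :: "nat ^ 'd \<Rightarrow> nat" where
  "mi_order \<alpha> = (\<Sum>i\<in>UNIV. \<alpha> $ i)"

text \<open>
  The derivative \<open>f\<^sup>(\<^sup>\<alpha>\<^sup>)\<close> differentiates \<open>\<alpha> $ i\<close> times in direction \<open>i\<close>. The order of
  differentiation, which the choice operator leaves open, is immaterial wherever \<open>f\<close> is smooth.
\<close>

definition mderiv :: "nat ^ 'd \<Rightarrow> (real ^ 'd \<Rightarrow> complex) \<Rightarrow> real ^ 'd \<Rightarrow> complex" where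
  "mderiv \<alpha> f = partials (SOME is. \<forall>i. count_list is i = \<alpha> $ i) f"


subsection \<open>Test functions and distributions\<close>

definition supp :: "(real ^ 'd \<Rightarrow> complex) \<Rightarrow> (real ^ 'd) set" where
  "supp \<phi> = closure {x. \<phi> x \<noteq> 0}"

definition test_functions :: "(real ^ 'd) set \<Rightarrow> (real ^ 'd \<Rightarrow> complex) set" where
  "test_functions S = {\<phi>. smooth_on UNIV \<phi> \<and> compact (supp \<phi>) \<and> supp \<phi> \<subseteq> S}"

text \<open>
  A distribution is a linear functional on the test functions that satisfies a seminorm estimate
  on every compact set; its values on other functions are irrelevant.
\<close>

definition distribution :: "(real ^ 'd) set \<Rightarrow> ((real ^ 'd \<Rightarrow> complex) \<Rightarrow> complex) \<Rightarrow> bool" where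
  "distribution S T \<longleftrightarrow>
     (\<forall>\<phi>\<in>test_functions S. \<forall>\<psi>\<in>test_functions S. T (\<lambda>x. \<phi> x + \<psi> x) = T \<phi> + T \<psi>) \<and>
     (\<forall>\<phi>\<in>test_functions S. \<forall>c. T (\<lambda>x. c * \<phi> x) = c * T \<phi>) \<and>
     (\<forall>K. compact K \<and> K \<subseteq> S \<longrightarrow>
        (\<exists>C m. \<forall>\<phi>\<in>test_functions S. supp \<phi> \<subseteq> K \<longrightarrow>
           cmod (T \<phi>) \<le> C * (\<Sum>\<alpha> | mi_order \<alpha> \<le> m. SUP x. cmod (mderiv \<alpha> \<phi> x))))"

definition dist_mult ::
    "(real ^ 'd \<Rightarrow> complex) \<Rightarrow> ((real ^ 'd \<Rightarrow> complex) \<Rightarrow> complex) \<Rightarrow> (real ^ 'd \<Rightarrow> complex) \<Rightarrow> complex"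
  where "dist_mult \<kappa> T \<phi> = T (\<lambda>x. \<kappa> x * \<phi> x)"


subsection \<open>Fourier transforms\<close>

definition fourier :: "(real ^ 'd \<Rightarrow> complex) \<Rightarrow> real ^ 'd \<Rightarrow> complex" where
  "fourier \<phi> \<xi> = (LINT x|lborel. exp (- (\<i> * of_real (x \<bullet> \<xi>))) * \<phi> x)"

text \<open>
  The Fourier transform of a compactly supported distribution. For a test function \<open>\<kappa>\<close>, the
  distribution \<open>dist_mult \<kappa> T\<close> is compactly supported and hence acts on every smooth function, in
  particular on the exponentials.
\<close>

definition dist_fourier :: "((real ^ 'd \<Rightarrow> complex) \<Rightarrow> complex) \<Rightarrow> real ^ 'd \<Rightarrow> complex" where
  "dist_fourier T \<xi> = T (\<lambda>x. exp (- (\<i> * of_real (x \<bullet> \<xi>))))"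


subsection \<open>The Colombeau algebra\<close>

type_synonym 'd net = "real \<Rightarrow> real ^ 'd \<Rightarrow> complex"

definition smooth_nets :: "(real ^ 'd) set \<Rightarrow> 'd net set" where
  "smooth_nets S = {f. \<forall>\<epsilon>\<in>{0<..<1}. smooth_on S (f \<epsilon>)}"

text \<open>
  The supremum over \<open>K\<close> is \<open>O(\<epsilon>\<^sup>a)\<close>, written as a bound uniform on \<open>K\<close> because the supremum
  of the empty set of reals is unspecified.
\<close>

definition sup_bigo :: "(real ^ 'd) set \<Rightarrow> 'd net \<Rightarrow> real \<Rightarrow> bool" where
  "sup_bigo K f a \<longleftrightarrow>
     (\<exists>C. \<forall>\<^sub>F \<epsilon> in at_right 0. \<forall>x\<in>K. cmod (f \<epsilon> x) \<le> C * \<epsilon> powr a)"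

definition moderate_nets :: "(real ^ 'd) set \<Rightarrow> 'd net set" where
  "moderate_nets S =
     {f \<in> smooth_nets S. \<forall>K \<alpha>. compact K \<and> K \<subseteq> S \<longrightarrow> (\<exists>a. sup_bigo K (\<lambda>\<epsilon>. mderiv \<alpha> (f \<epsilon>)) a)}"

definition null_nets :: "(real ^ 'd) set \<Rightarrow> 'd net set" where
  "null_nets S =
     {f \<in> smooth_nets S. \<forall>K \<alpha>. compact K \<and> K \<subseteq> S \<longrightarrow> (\<forall>a. sup_bigo K (\<lambda>\<epsilon>. mderiv \<alpha> (f \<epsilon>)) a)}"

definition colombeau_rel :: "(real ^ 'd) set \<Rightarrow> ('d net \<times> 'd net) set" where
  "colombeau_rel S = {(f, g). f \<in> moderate_nets S \<and> g \<in> moderate_nets S \<and>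
                              (\<lambda>\<epsilon> x. f \<epsilon> x - g \<epsilon> x) \<in> null_nets S}"

definition colombeau :: "(real ^ 'd) set \<Rightarrow> 'd net set set" where
  "colombeau S = moderate_nets S // colombeau_rel S"

text \<open>
  For open \<open>V \<subseteq> S\<close> the restriction to \<open>V\<close> of a class over \<open>S\<close> is the class over \<open>V\<close> of any of
  its representatives.
\<close>

definition colombeau_restrict :: "(real ^ 'd) set \<Rightarrow> 'd net set \<Rightarrow> 'd net set" where
  "colombeau_restrict V F = colombeau_rel V `` F"


subsection \<open>Microanalyticity\<close>

definition compactly_inside :: "(real ^ 'd) set \<Rightarrow> (real ^ 'd) set \<Rightarrow> bool" where
  "compactly_inside A B \<longleftrightarrow> compact (closure A) \<and> closure A \<subseteq> B"

definition admissible_cutoff ::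
    "(real ^ 'd) set \<Rightarrow> real ^ 'd \<Rightarrow> (real ^ 'd) set \<Rightarrow> (real ^ 'd) set \<Rightarrow>
     (nat \<Rightarrow> real ^ 'd \<Rightarrow> complex) \<Rightarrow> bool"
  where
  "admissible_cutoff S x0 W U \<kappa> \<longleftrightarrow>
     open W \<and> open U \<and> x0 \<in> W \<and> compactly_inside W U \<and> compactly_inside U S \<and>
     (\<forall>n\<ge>1. \<kappa> n \<in> test_functions U \<and> (\<forall>x\<in>W. \<kappa> n x = 1)) \<and>
     (\<forall>\<alpha>. \<exists>C>0. \<forall>n\<ge>1. \<forall>\<beta> x. mi_order \<beta> \<le> n \<longrightarrow>
        cmod (mderiv (\<alpha> + \<beta>) (\<kappa> n) x) \<le> C * (C * real n) ^ mi_order \<beta>)"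

text \<open>
  The library predicate \<^const>\<open>cone\<close> is closed under multiplication by \<open>0\<close>, which for a nonempty
  open set would force the whole space.
\<close>

definition open_cone_around :: "real ^ 'd \<Rightarrow> (real ^ 'd) set \<Rightarrow> bool" where
  "open_cone_around \<xi>0 \<Gamma> \<longleftrightarrow> open \<Gamma> \<and> \<xi>0 \<in> \<Gamma> \<and> (\<forall>t>0. \<forall>\<xi>\<in>\<Gamma>. t *\<^sub>R \<xi> \<in> \<Gamma>)"

definition g_microanalytic ::
    "(real ^ 'd) set \<Rightarrow> 'd net set \<Rightarrow> real ^ 'd \<Rightarrow> real ^ 'd \<Rightarrow> bool"
  where
  "g_microanalytic S F x0 \<xi>0 \<longleftrightarrow>
     (\<exists>W U \<kappa> \<Gamma> f a C \<epsilon>0.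
        admissible_cutoff S x0 W U \<kappa> \<and> open_cone_around \<xi>0 \<Gamma> \<and> f \<in> F \<and>
        a > 0 \<and> C > 0 \<and> \<epsilon>0 \<in> {0<..<1} \<and>
        (\<forall>n\<ge>1. \<forall>\<xi>\<in>\<Gamma>. \<forall>\<epsilon>\<in>{0<..<\<epsilon>0}.
           cmod (fourier (\<lambda>x. \<kappa> n x * f \<epsilon> x) \<xi>)
             \<le> C * \<epsilon> powr (- a) * (C * real n / (1 + norm \<xi>)) ^ n))"

definition microanalytic ::
    "(real ^ 'd) set \<Rightarrow> ((real ^ 'd \<Rightarrow> complex) \<Rightarrow> complex) \<Rightarrow> real ^ 'd \<Rightarrow> real ^ 'd \<Rightarrow> bool"
  where
  "microanalytic S T x0 \<xi>0 \<longleftrightarrow>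
     (\<exists>W U \<kappa> \<Gamma> C.
        admissible_cutoff S x0 W U \<kappa> \<and> open_cone_around \<xi>0 \<Gamma> \<and> C > 0 \<and>
        (\<forall>n\<ge>1. \<forall>\<xi>\<in>\<Gamma>.
           cmod (dist_fourier (dist_mult (\<kappa> n) T) \<xi>)
             \<le> C * (C * real n / (1 + norm \<xi>)) ^ n))"


subsection \<open>Strong association\<close>

text \<open>The condition does not depend on the representative \<open>f\<close>.\<close>

definition strongly_associated ::
    "(real ^ 'd) set \<Rightarrow> ((real ^ 'd \<Rightarrow> complex) \<Rightarrow> complex) \<Rightarrow> 'd net set \<Rightarrow> bool"
  where
  "strongly_associated V T F \<longleftrightarrow>
     (\<exists>f\<in>F. \<forall>K. compact K \<and> K \<subseteq> V \<longrightarrow>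
        (\<exists>a>0. \<forall>\<theta>\<in>test_functions V. supp \<theta> \<subseteq> K \<longrightarrow>
           (\<lambda>\<epsilon>. T \<theta> - (LINT x|lborel. f \<epsilon> x * \<theta> x)) \<in> O[at_right 0](\<lambda>\<epsilon>. of_real (\<epsilon> powr a))))"

end

theory Submission
  imports Defs "HOL-Probability.Characteristic_Functions" "HOL-Probability.Sinc_Integral"
begin

text \<open>
  Rescaling the given cut-offs around \<open>x0\<close> yields cut-offs \<open>\<rho>\<^sub>n\<close> supported in \<open>W \<inter> V\<close>, where
  \<open>\<kappa>\<^sub>n = 1\<close>. By Fourier inversion the transform of \<open>\<rho>\<^sub>n f\<^sub>\<epsilon> = \<rho>\<^sub>n \<kappa>\<^sub>n f\<^sub>\<epsilon>\<close> is the convolution of the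
  transforms of \<open>\<rho>\<^sub>n\<close> and \<open>\<kappa>\<^sub>n f\<^sub>\<epsilon>\<close>, so the \<open>g\<close>-microanalytic estimate survives for \<open>\<rho>\<^sub>n f\<^sub>\<epsilon>\<close> on a
  smaller cone. By uniform boundedness, strong association on the support of the cut-offs improves
  to \<open>\<bar>\<langle>T - f\<^sub>\<epsilon>, \<theta>\<rangle>\<bar> \<le> C \<epsilon>\<^sup>b p(\<theta>)\<close> with a \<open>C\<^sup>m\<close>-seminorm \<open>p\<close>; applied to the product of \<open>\<rho>\<^sub>n\<close> and an
  exponential of frequency \<open>\<xi>\<close> it costs a factor \<open>(1 + \<bar>\<xi>\<bar>)\<^sup>m\<close>. Choosing \<open>\<epsilon>\<close> as a power of
  \<open>k n / (1 + \<bar>\<xi>\<bar>)\<close> with exponent proportional to \<open>n\<close> balances both errors, and passing to the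
  subsequence \<open>\<rho>\<^sub>k\<^sub>n\<close> compensates for the loss in the exponent.
\<close>

section \<open>Smooth functions and test functions\<close>

text \<open>The cut-offs have to be replaced because \<open>U\<close> may stick out of
  \<open>V\<close>, where \<open>T\<close> is undefined. The homothety costs only chain-rule
  factors, which disappear in the constants. Strong association gives, for each fixed test function,
  an error \<open>O(\<epsilon>^b)\<close> whose constant depends on that function, whereas the
  functions to be tested, \<open>\<rho> n\<close> times an exponential, change with \<open>n\<close>
  and \<open>\<xi>\<close>; this is the obstacle that uniform boundedness removes. The order
  \<open>m\<close> it produces belongs to the compact set only, so the cost stays polynomial in
  \<open>\<xi>\<close> with a constant independent of \<open>n\<close>, although the wanted decay
  has order \<open>n\<close>. The two errors pull \<epsilon> in opposite directions:
  \<open>\<epsilon>^b\<close> must beat this polynomial and still leave \<open>n\<close> powers of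
  decay, so \<epsilon> has to be as small as a power of order \<open>n\<close>, and then
  \<open>\<epsilon>^(-a)\<close> destroys a number of decay powers proportional to \<open>n\<close>.
  Estimating with \<open>k * n\<close> in place of \<open>n\<close> creates the reserve from which
  this loss is paid.\<close>

lemma partials_simps [simp]:
  "partials [] f = f" "partials (i # is) f = partial i (partials is f)"
  by (simp_all add: partials_def)

lemma partials_append: "partials (is @ js) f = partials is (partials js f)"
  by (simp add: partials_def)

lemma smooth_on_partials: "smooth_on S f \<Longrightarrow> smooth_on S (partials is f)"
  unfolding smooth_on_def by (metis partials_append)

lemma smooth_on_partial: "smooth_on S f \<Longrightarrow> smooth_on S (partial i f)"
  using smooth_on_partials[of S f "[i]"] by simp

lemma smooth_on_differentiable: "smooth_on S f \<Longrightarrow> x \<in> S \<Longrightarrow> f differentiable (at x)"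
  unfolding smooth_on_def by (metis partials_simps(1))

lemma smooth_on_continuous_on: "smooth_on S f \<Longrightarrow> continuous_on S f"
  by (meson continuous_at_imp_continuous_on differentiable_imp_continuous_within smooth_on_differentiable)

text \<open>A class of differentiable functions that is stable under every \<open>partial i\<close>
  contains all iterated partials of its members, so these never have to be computed. Smoothness of
  constants, exponentials and products follows by naming such a class.\<close>

lemma smooth_on_coinduct:
  assumes "P f"
    and "\<And>f x. P f \<Longrightarrow> f differentiable (at x)"
    and "\<And>f i. P f \<Longrightarrow> P (partial i f)"
  shows "smooth_on UNIV f"
proof -
  have "P (partials is f)" for "is"
    by (induction "is") (use assms in auto)
  with assms(2) show ?thesis
    by (simp add: smooth_on_def)
qed

lemma partial_eqI: "(f has_derivative f') (at x) \<Longrightarrow> partial i f x = f' (axis i 1)"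
  by (simp add: partial_def frechet_derivative_at[symmetric])

lemma has_derivative_partial:
  assumes "f differentiable (at x)"
  shows "(f has_derivative (\<lambda>h. \<Sum>i\<in>UNIV. (h $ i) *\<^sub>R partial i f x)) (at x)"
proof -
  let ?f' = "frechet_derivative f (at x)"
  have d: "(f has_derivative ?f') (at x)"
    using assms frechet_derivative_works by blast
  have l: "linear ?f'"
    using d has_derivative_linear by blast
  have "?f' h = (\<Sum>i\<in>UNIV. (h $ i) *\<^sub>R partial i f x)" for h
  proof -
    have "?f' h = ?f' (\<Sum>i\<in>UNIV. (h $ i) *\<^sub>R axis i 1)"
      using basis_expansion[of h] by (simp add: scalar_mult_eq_scaleR)
    also have "\<dots> = (\<Sum>i\<in>UNIV. (h $ i) *\<^sub>R partial i f x)"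
      by (simp add: linear_sum[OF l] linear_cmul[OF l] partial_def)
    finally show ?thesis .
  qed
  then show ?thesis
    using d by presburger
qed

lemma partial_add:
  assumes "f differentiable (at x)" "g differentiable (at x)"
  shows "partial i (\<lambda>x. f x + g x) x = partial i f x + partial i g x"
  using partial_eqI[OF has_derivative_add[OF assms[unfolded frechet_derivative_works]], of i]
  by (simp add: partial_def)

lemma partial_mult:
  assumes "f differentiable (at x)" "g differentiable (at x)"
  shows "partial i (\<lambda>x. f x * g x) x = partial i f x * g x + f x * partial i g x"
  using partial_eqI[OF has_derivative_mult[OF assms[unfolded frechet_derivative_works]], of i]
  by (simp add: partial_def)

lemma partial_const [simp]: "partial i (\<lambda>x. c) = (\<lambda>x. 0)"
  by (rule ext, rule partial_eqI[OF has_derivative_eq_rhs, OF has_derivative_const]) simp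

lemma partial_cmult:
  assumes "f differentiable (at x)"
  shows "partial i (\<lambda>x. c * f x) x = c * partial i f x"
  using partial_mult[of "\<lambda>x. c" x f i] assms by simp

lemma smooth_on_const [simp]: "smooth_on UNIV (\<lambda>x. c)"
  by (rule smooth_on_coinduct[where P="\<lambda>f. \<exists>c. f = (\<lambda>x. c)"]) auto

lemma partials_cmult:
  assumes "smooth_on UNIV f"
  shows "partials is (\<lambda>x. c * f x) = (\<lambda>x. c * partials is f x)"
proof (induction "is")
  case (Cons i "is")
  then show ?case
    using smooth_on_partials[of UNIV _ "is", THEN smooth_on_differentiable] assms
    by (auto simp: partial_cmult)
qed auto

text \<open>Products alone are not stable under \<open>partial\<close>, since the Leibniz rule turns
  one product into two. Finite sums of products form the closure to which coinduction
  applies.\<close>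

inductive sum_of_products :: "(real ^ 'd \<Rightarrow> complex) \<Rightarrow> bool" where
  mult: "smooth_on UNIV f \<Longrightarrow> smooth_on UNIV g \<Longrightarrow> sum_of_products (\<lambda>x. f x * g x)"
| add: "sum_of_products f \<Longrightarrow> sum_of_products g \<Longrightarrow> sum_of_products (\<lambda>x. f x + g x)"

lemma smooth_on_sum_of_products:
  assumes "sum_of_products f"
  shows "smooth_on UNIV f"
proof (rule smooth_on_coinduct[of sum_of_products, OF assms])
  show d: "f differentiable at x" if "sum_of_products f" for f :: "real ^ 'd \<Rightarrow> complex" and x
    using that by induction (auto intro!: derivative_intros dest: smooth_on_differentiable)
  show "sum_of_products (partial i f)" if "sum_of_products f" for f :: "real ^ 'd \<Rightarrow> complex" and i
    using that
  proof induction
    case (mult f g)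
    then have "partial i (\<lambda>x. f x * g x) = (\<lambda>x. partial i f x * g x + f x * partial i g x)"
      by (auto intro!: ext partial_mult dest: smooth_on_differentiable)
    with mult show ?case
      by (auto intro!: sum_of_products.intros smooth_on_partial)
  next
    case (add f g)
    then have "partial i (\<lambda>x. f x + g x) = (\<lambda>x. partial i f x + partial i g x)"
      by (auto intro!: ext partial_add d)
    with add show ?case
      by (auto intro!: sum_of_products.intros)
  qed
qed

lemma smooth_on_mult: "smooth_on UNIV f \<Longrightarrow> smooth_on UNIV g \<Longrightarrow> smooth_on UNIV (\<lambda>x. f x * g x)"
  by (rule smooth_on_sum_of_products) (rule sum_of_products.mult)

lemma has_derivative_exponential:
  "((\<lambda>x. c * exp (- (\<i> * of_real (x \<bullet> \<xi>)))) has_derivative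
     (\<lambda>h. - (c * \<i> * of_real (h \<bullet> \<xi>)) * exp (- (\<i> * of_real (x \<bullet> \<xi>))))) (at x)"
proof -
  have "((\<lambda>x. - (\<i> * complex_of_real (x \<bullet> \<xi>))) has_derivative (\<lambda>h. - (\<i> * of_real (h \<bullet> \<xi>)))) (at x)"
    by (auto intro!: derivative_eq_intros)
  from has_derivative_compose[OF this DERIV_exp[THEN has_field_derivative_imp_has_derivative]]
  show ?thesis
    by (rule has_derivative_eq_rhs[OF has_derivative_mult_right]) (simp add: algebra_simps)
qed

lemma smooth_on_exponential: "smooth_on UNIV (\<lambda>x. exp (- (\<i> * of_real (x \<bullet> \<xi>))))"
\<comment> \<open>The scalar \<open>c\<close> collects the factors \<open>- \<i> * \<xi> $ i\<close>
  that differentiation produces.\<close>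
proof (rule smooth_on_coinduct[where P="\<lambda>f. \<exists>c. f = (\<lambda>x. c * exp (- (\<i> * of_real (x \<bullet> \<xi>))))"])
  show "\<exists>c. (\<lambda>x. exp (- (\<i> * of_real (x \<bullet> \<xi>)))) = (\<lambda>x. c * exp (- (\<i> * of_real (x \<bullet> \<xi>))))"
    by (intro exI[of _ 1]) simp
  show "f differentiable at x" if "\<exists>c. f = (\<lambda>x. c * exp (- (\<i> * of_real (x \<bullet> \<xi>))))" for f x
    using that has_derivative_exponential differentiable_def by blast
  show "\<exists>c. partial i f = (\<lambda>x. c * exp (- (\<i> * of_real (x \<bullet> \<xi>))))"
    if "\<exists>c. f = (\<lambda>x. c * exp (- (\<i> * of_real (x \<bullet> \<xi>))))" for f i
    using that partial_eqI[OF has_derivative_exponential] by fast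
qed

text \<open>Under a homothety centred at \<open>x0\<close> an iterated partial only acquires one
  factor \<open>c\<close> per differentiation. This is the computation behind shrinking the supports
  of cut-offs.\<close>

lemma partials_rescale:
  assumes "smooth_on UNIV f"
  shows "partials is (\<lambda>x. f (x0 + c *\<^sub>R (x - x0))) = (\<lambda>x. of_real c ^ length is * partials is f (x0 + c *\<^sub>R (x - x0)))"
proof (induction "is")
  case (Cons i "is")
  let ?g = "partials is f"
  have "((\<lambda>x. of_real c ^ length is * ?g (x0 + c *\<^sub>R (x - x0))) has_derivative
      (\<lambda>h. of_real c ^ length is * (\<Sum>j\<in>UNIV. ((c *\<^sub>R h) $ j) *\<^sub>R partial j ?g (x0 + c *\<^sub>R (x - x0))))) (at x)" for x
  proof -
    have "(?g has_derivative (\<lambda>h. \<Sum>j\<in>UNIV. (h $ j) *\<^sub>R partial j ?g (x0 + c *\<^sub>R (x - x0)))) (at (x0 + c *\<^sub>R (x - x0)))"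
      using assms by (intro has_derivative_partial) (meson UNIV_I smooth_on_differentiable smooth_on_partials)
    moreover have "((\<lambda>x. x0 + c *\<^sub>R (x - x0)) has_derivative (\<lambda>h. c *\<^sub>R h)) (at x)"
      by (auto intro!: derivative_eq_intros)
    ultimately show ?thesis
      by (intro has_derivative_mult_right) (rule has_derivative_compose[of "\<lambda>x. x0 + c *\<^sub>R (x - x0)"])
  qed
  from partial_eqI[OF this] show ?case
    by (simp add: Cons mult.assoc mult.left_commute axis_def if_distrib if_distribR sum.delta' scaleR_conv_of_real[where 'a=complex] cong: if_cong)
qed simp

lemma smooth_on_rescale:
  assumes "smooth_on UNIV f"
  shows "smooth_on UNIV (\<lambda>x. f (x0 + c *\<^sub>R (x - x0)))"
  unfolding smooth_on_def partials_rescale[OF assms]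
proof safe
  fix "is" x
  have "partials is f differentiable (at (x0 + c *\<^sub>R (x - x0)))"
    using assms smooth_on_def by blast
  then obtain D where "(partials is f has_derivative D) (at (x0 + c *\<^sub>R (x - x0)))"
    using differentiable_def by blast
  moreover have "((\<lambda>x. x0 + c *\<^sub>R (x - x0)) has_derivative (\<lambda>h. c *\<^sub>R h)) (at x)"
    by (auto intro!: derivative_eq_intros)
  ultimately have "(\<lambda>x. partials is f (x0 + c *\<^sub>R (x - x0))) differentiable (at x)"
    unfolding differentiable_def by (blast intro: has_derivative_compose[of "\<lambda>x. x0 + c *\<^sub>R (x - x0)"])
  then show "(\<lambda>x. of_real c ^ length is * partials is f (x0 + c *\<^sub>R (x - x0))) differentiable (at x)"
    by simp
qed

section \<open>Multi-index derivatives as iterated partials along lists\<close>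

text \<open>The list picked by the choice operator depends on \<open>\<alpha>\<close> and not on
  \<open>f\<close>, so one list serves a function and its rescaled version at the same time. It
  exists because a multiset with prescribed multiplicities can be enumerated.\<close>

lemma mderiv_partials:
  obtains "is" where "length is = mi_order \<alpha>" "\<And>f. mderiv \<alpha> f = partials is f" "\<And>i. count_list is i = \<alpha> $ i"
proof -
  have "\<exists>is. \<forall>i. count_list is i = \<alpha> $ i"
  proof -
    obtain xs where xs: "mset xs = (\<Sum>i\<in>UNIV. replicate_mset (\<alpha> $ i) i)"
      using ex_mset by blast
    have "count_list xs i = \<alpha> $ i" for i
      unfolding count_mset[symmetric] xs by (simp add: count_sum sum.delta)
    then show ?thesis by blast
  qed
  define js where "js = (SOME is. \<forall>i. count_list is i = \<alpha> $ i)"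
  have js: "\<forall>i. count_list js i = \<alpha> $ i"
    unfolding js_def by (rule someI_ex) fact
  have "length js = (\<Sum>i\<in>set js. count_list js i)"
    by (simp add: sum_count_set)
  also have "\<dots> = mi_order \<alpha>"
    unfolding mi_order_def using js by (intro sum.mono_neutral_cong_left) (auto simp flip: js[rule_format] simp: count_list_0_iff)
  finally show thesis
    using that js by (auto simp: mderiv_def js_def)
qed

lemma mderiv_0 [simp]: "mderiv 0 f = f"
proof -
  obtain "is" where "length is = mi_order (0 :: nat ^ 'a)" "mderiv 0 f = partials is f"
    using mderiv_partials by metis
  then show ?thesis by (simp add: mi_order_def)
qed

text \<open>A multi-index living on one axis admits exactly one list, so the choice in
  \<open>mderiv\<close> is pinned down. Pure derivatives of this kind are the ones that enter the
  decay of Fourier transforms.\<close>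

lemma mderiv_axis: "mderiv (axis i k) f = partials (replicate k i) f"
proof -
  obtain "is" where *: "length is = mi_order (axis i k)" "mderiv (axis i k) f = partials is f"
    "\<And>j. count_list is j = axis i k $ j"
    using mderiv_partials by metis
  have "j = i" if "j \<in> set is" for j
    using *(3)[of j] that by (auto simp: axis_def count_list_0_iff split: if_splits)
  then have "is = replicate (length is) i"
    by (simp add: replicate_eqI)
  moreover have "length is = k"
    using *(1) by (simp add: mi_order_def axis_def if_distrib cong: if_cong)
  ultimately show ?thesis using *(2) by simp
qed

section \<open>Termwise differentiation of function series\<close>

text \<open>Weierstrass majorants for each iterated partial separately: \<open>M\<close> may grow
  with the list, so this is convergence in the Frechet topology of smooth functions and not in one
  fixed \<open>C^m\<close> norm.\<close>

lemma partials_series: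
  fixes \<theta> :: "nat \<Rightarrow> real ^ 'd \<Rightarrow> complex"
  assumes smooth: "\<And>j. smooth_on UNIV (\<theta> j)"
    and M: "\<And>is. summable (M is)" "\<And>is j x. cmod (partials is (\<theta> j) x) \<le> M is j"
  shows "partials is (\<lambda>x. \<Sum>j. \<theta> j x) = (\<lambda>x. \<Sum>j. partials is (\<theta> j) x)"
    and "smooth_on UNIV (\<lambda>x. \<Sum>j. \<theta> j x)"
proof -
  have sm: "summable (\<lambda>j. partials is (\<theta> j) x)" for "is" x
    by (rule summable_comparison_test'[OF M(1)]) (rule M(2))
  have der: "((\<lambda>x. \<Sum>j. partials is (\<theta> j) x) has_derivative
      (\<lambda>h. \<Sum>i\<in>UNIV. (h $ i) *\<^sub>R (\<Sum>j. partials (i # is) (\<theta> j) x))) (at x)" for "is" x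
  proof -
    define f' where "f' = (\<lambda>j x h. \<Sum>i\<in>UNIV. (h $ i) *\<^sub>R partials (i # is) (\<theta> j) x)"
    define g' where "g' = (\<lambda>x h. \<Sum>i\<in>UNIV. (h $ i) *\<^sub>R (\<Sum>j. partials (i # is) (\<theta> j) x))"
    have "\<exists>g. \<forall>x\<in>UNIV. (\<lambda>j. partials is (\<theta> j) x) sums (g x) \<and> (g has_derivative g' x) (at x within UNIV)"
    proof (rule has_derivative_series)
      show "(partials is (\<theta> j) has_derivative f' j x) (at x within UNIV)" for j x
        using has_derivative_partial[of "partials is (\<theta> j)" x] smooth[of j]
        by (simp add: f'_def smooth_on_def)
      show "(\<lambda>j. partials is (\<theta> j) 0) sums (\<Sum>j. partials is (\<theta> j) 0)"
        using sm by blast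
      fix e :: real assume "e > 0"
      \<comment> \<open>The difference between \<open>g'\<close> and a partial sum of the
        \<open>f'\<close> splits along the axes, and each part is bounded by a tail of majorants
        uniformly in \<open>x\<close>; finitely many tails become small together.\<close>
      have "(\<lambda>n. \<Sum>i\<in>UNIV. \<Sum>j. M (i # is) (j + n)) \<longlonglongrightarrow> (\<Sum>i\<in>(UNIV::'d set). 0)"
        using M(1) by (intro tendsto_sum suminf_exist_split2)
      then have "\<forall>\<^sub>F n in sequentially. (\<Sum>i\<in>UNIV. \<Sum>j. M (i # is) (j + n)) < e"
        using \<open>e > 0\<close> by (intro order_tendstoD) auto
      then show "\<forall>\<^sub>F n in sequentially. \<forall>x\<in>UNIV. \<forall>h. norm (sum (\<lambda>i. f' i x h) {..<n} - g' x h) \<le> e * norm h"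
      proof (rule eventually_mono, safe)
        fix n x h assume n: "(\<Sum>i\<in>UNIV. \<Sum>j. M (i # is) (j + n)) < e"
        have tail: "cmod ((\<Sum>j. partials (i # is) (\<theta> j) x) - (\<Sum>j<n. partials (i # is) (\<theta> j) x)) \<le> (\<Sum>j. M (i # is) (j + n))" for i
        proof -
          have "(\<Sum>j. partials (i # is) (\<theta> j) x) - (\<Sum>j<n. partials (i # is) (\<theta> j) x) = (\<Sum>j. partials (i # is) (\<theta> (j + n)) x)"
            by (rule suminf_minus_initial_segment[symmetric]) (rule sm)
          also have "cmod \<dots> \<le> (\<Sum>j. M (i # is) (j + n))"
            by (rule norm_suminf_le) (use M in \<open>auto intro: summable_ignore_initial_segment simp del: partials_simps\<close>)
          finally show ?thesis .
        qed
        have "norm (sum (\<lambda>i. f' i x h) {..<n} - g' x h) = norm (g' x h - sum (\<lambda>i. f' i x h) {..<n})"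
          by (rule norm_minus_commute)
        also have "g' x h - sum (\<lambda>i. f' i x h) {..<n} =
            (\<Sum>i\<in>UNIV. (h $ i) *\<^sub>R ((\<Sum>j. partials (i # is) (\<theta> j) x) - (\<Sum>j<n. partials (i # is) (\<theta> j) x)))"
          unfolding f'_def g'_def
          by (subst sum.swap) (simp add: scaleR_diff_right sum_subtractf scaleR_sum_right del: partials_simps)
        also have "norm \<dots> \<le> (\<Sum>i\<in>UNIV. norm h * (\<Sum>j. M (i # is) (j + n)))"
          by (intro sum_norm_le) (auto simp del: partials_simps intro!: mult_mono tail component_le_norm_cart)
        also have "\<dots> \<le> e * norm h"
          using mult_right_mono[OF less_imp_le[OF n], of "norm h"] by (simp add: sum_distrib_left[symmetric] mult.commute)
        finally show "norm (sum (\<lambda>i. f' i x h) {..<n} - g' x h) \<le> e * norm h" .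
      qed
    qed auto
    then obtain g where g: "\<And>x. (\<lambda>j. partials is (\<theta> j) x) sums (g x)" "\<And>x. (g has_derivative g' x) (at x)"
      by auto
    then have "g = (\<lambda>x. \<Sum>j. partials is (\<theta> j) x)"
      using sums_unique by blast
    with g(2) show ?thesis unfolding g'_def by blast
  qed
  show eq: "partials is (\<lambda>x. \<Sum>j. \<theta> j x) = (\<lambda>x. \<Sum>j. partials is (\<theta> j) x)" for "is"
  proof (induction "is")
    case (Cons i "is")
    show ?case
      unfolding partials_simps(2)[of i "is" "\<lambda>x. \<Sum>j. \<theta> j x"] Cons
      by (rule ext, subst partial_eqI[OF der])
         (simp add: axis_def if_distrib if_distribR sum.delta' cong: if_cong)
  qed simp
  show "smooth_on UNIV (\<lambda>x. \<Sum>j. \<theta> j x)"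
    unfolding smooth_on_def eq using der differentiable_def by blast
qed

section \<open>Test functions and their supports\<close>

lemma test_functionsD:
  assumes "\<theta> \<in> test_functions S"
  shows "smooth_on UNIV \<theta>" "compact (supp \<theta>)" "supp \<theta> \<subseteq> S" "continuous_on UNIV \<theta>"
  using assms smooth_on_continuous_on by (auto simp: test_functions_def)

lemma not_in_supp: "x \<notin> supp f \<Longrightarrow> f x = 0"
  unfolding supp_def using closure_subset[of "{x. f x \<noteq> 0}"] by blast

lemma supp_subset: "closed K \<Longrightarrow> (\<And>x. x \<notin> K \<Longrightarrow> f x = 0) \<Longrightarrow> supp f \<subseteq> K"
  unfolding supp_def by (rule closure_minimal) auto

lemma test_functionsI:
  assumes "smooth_on UNIV \<theta>" "compact K" "K \<subseteq> S" "\<And>x. x \<notin> K \<Longrightarrow> \<theta> x = 0"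
  shows "\<theta> \<in> test_functions S"
proof -
  have "supp \<theta> \<subseteq> K"
    using assms by (intro supp_subset) (auto simp: compact_imp_closed)
  moreover have "closed (supp \<theta>)"
    by (simp add: supp_def)
  ultimately show ?thesis
    using assms compact_Int_closed[of K "supp \<theta>"] by (auto simp: test_functions_def Int_absorb1)
qed

lemma test_functions_mono: "S \<subseteq> S' \<Longrightarrow> test_functions S \<subseteq> test_functions S'"
  by (auto simp: test_functions_def)

lemma supp_partial: "supp (partial i f) \<subseteq> supp f"
proof (rule supp_subset)
  fix x assume x: "x \<notin> supp f"
  have "(f has_derivative (\<lambda>h. 0)) (at x)"
  proof (rule has_derivative_transform_within_open[of "\<lambda>x. 0"])
    show "open (- supp f)" "x \<in> - supp f"
      using x by (auto simp: supp_def)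
  qed (auto simp: not_in_supp)
  from partial_eqI[OF this] show "partial i f x = 0" .
qed (simp add: supp_def)

lemma supp_partials: "supp (partials is f) \<subseteq> supp f"
  by (induction "is") (use supp_partial in \<open>fastforce+\<close>)

lemma test_functions_partials: "\<theta> \<in> test_functions S \<Longrightarrow> partials is \<theta> \<in> test_functions S"
  by (rule test_functionsI[of _ "supp \<theta>"])
     (use supp_partials[of "is" \<theta>] in \<open>auto intro!: not_in_supp smooth_on_partials dest: test_functionsD\<close>)

lemma test_functions_cmult: "\<theta> \<in> test_functions S \<Longrightarrow> (\<lambda>x. c * \<theta> x) \<in> test_functions S"
  by (rule test_functionsI[of _ "supp \<theta>"])
     (auto intro!: not_in_supp smooth_on_mult dest: test_functionsD)

lemma test_functions_mult:
  "\<theta> \<in> test_functions S \<Longrightarrow> smooth_on UNIV g \<Longrightarrow> (\<lambda>x. \<theta> x * g x) \<in> test_functions S"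
  by (rule test_functionsI[of _ "supp \<theta>"])
     (auto intro!: not_in_supp smooth_on_mult dest: test_functionsD)

text \<open>Here and below \<open>test_functions\<close> is also applied to a compact
  \<open>K\<close>; it then denotes the Frechet space of smooth functions supported in
  \<open>K\<close>. Closure under series with majorants is the form of completeness on which uniform
  boundedness rests.\<close>

lemma test_functions_series:
  fixes \<theta> :: "nat \<Rightarrow> real ^ 'd \<Rightarrow> complex"
  assumes K: "compact K" and \<theta>: "\<And>j. \<theta> j \<in> test_functions K"
    and M: "\<And>is. summable (M is)" "\<And>is j x. cmod (partials is (\<theta> j) x) \<le> M is j"
  shows "(\<lambda>x. \<Sum>j. \<theta> j x) \<in> test_functions K"
proof (rule test_functionsI[of _ K])
  show "smooth_on UNIV (\<lambda>x. \<Sum>j. \<theta> j x)"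
    by (rule partials_series(2)[of \<theta> M, OF test_functionsD(1)[OF \<theta>] M])
  fix x assume "x \<notin> K"
  then have "\<theta> j x = 0" for j
    using \<theta>[of j] not_in_supp test_functionsD(3) by blast
  then show "(\<Sum>j. \<theta> j x) = 0" by simp
qed (use K in auto)

lemma compact_supp_bounded:
  fixes f :: "real ^ 'd \<Rightarrow> complex"
  assumes "continuous_on UNIV f" "compact (supp f)"
  obtains B where "B > 0" "\<And>x. cmod (f x) \<le> B"
proof -
  have "compact (f ` supp f)"
    using assms by (meson compact_continuous_image continuous_on_subset top_greatest)
  then obtain B where B: "\<And>x. x \<in> supp f \<Longrightarrow> cmod (f x) \<le> B"
    using bounded_iff compact_imp_bounded by (metis imageI)
  have "cmod (f x) \<le> max B 1" for x
    using B[of x] not_in_supp[of x f] by (cases "x \<in> supp f") auto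
  then show thesis
    using that[of "max B 1"] by auto
qed

lemma test_functions_bounded:
  assumes "\<theta> \<in> test_functions S"
  obtains B where "B > 0" "\<And>x. cmod (partials is \<theta> x) \<le> B"
  using compact_supp_bounded[of "partials is \<theta>"] test_functionsD[OF test_functions_partials[OF assms]]
  by metis

lemma compact_supp_integrable:
  fixes f :: "real ^ 'd \<Rightarrow> complex"
  assumes "continuous_on UNIV f" "compact (supp f)"
  shows "integrable lborel f"
proof -
  have "integrable lborel (\<lambda>x. indicator (supp f) x *\<^sub>R f x)"
    using assms continuous_on_subset by (blast intro: borel_integrable_compact)
  moreover have "indicator (supp f) x *\<^sub>R f x = f x" for x
    using not_in_supp[of x f] by (auto simp: indicator_def)
  ultimately show ?thesis by simp
qed

lemma test_functions_integrable: "\<theta> \<in> test_functions S \<Longrightarrow> integrable lborel \<theta>"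
  by (rule compact_supp_integrable) (auto dest: test_functionsD)

lemma integral_bound_compact:
  fixes f :: "real ^ 'd \<Rightarrow> complex"
  assumes K: "compact K" and B: "\<And>x. x \<in> K \<Longrightarrow> cmod (f x) \<le> B" and z: "\<And>x. x \<notin> K \<Longrightarrow> f x = 0"
  shows "cmod (LINT x|lborel. f x) \<le> B * measure lborel K"
\<comment> \<open>For nonempty \<open>K\<close> the hypothesis forces \<open>B \<ge> 0\<close>, so
  that the majorant is nonnegative; an empty \<open>K\<close> makes both sides vanish.\<close>
proof (cases "K = {}")
  case False
  then have "B \<ge> 0"
    using B norm_ge_zero order_trans by blast
  have i: "integrable lborel (\<lambda>x. B * indicator K x)"
    using K using emeasure_compact_finite[OF K] K
    by (intro integrable_mult_right) (simp add: compact_imp_closed integrable_indicator_iff)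
  have "cmod (LINT x|lborel. f x) \<le> (LINT x|lborel. cmod (f x))"
    by (rule integral_norm_bound)
  also have "\<dots> \<le> (LINT x|lborel. B * indicator K x)"
    using i by (rule integral_mono') (use B z \<open>B \<ge> 0\<close> in \<open>auto simp: indicator_def\<close>)
  finally show ?thesis
    using K by (simp add: compact_imp_closed)
qed (use z in auto)

section \<open>Fourier transforms of test functions\<close>

lemma integral_affine:
  fixes f :: "'a::euclidean_space \<Rightarrow> complex"
  assumes [measurable]: "f \<in> borel_measurable borel" and "c \<noteq> 0"
  shows "(LINT x|lborel. f x) = \<bar>c\<bar> ^ DIM('a) *\<^sub>R (LINT x|lborel. f (t + c *\<^sub>R x))"
  by (subst lborel_affine[OF assms(2), of t])
     (simp add: integral_density integral_distr)

lemma integral_translate: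
  fixes f :: "'a::euclidean_space \<Rightarrow> complex"
  assumes "f \<in> borel_measurable borel"
  shows "(LINT x|lborel. f (x + t)) = (LINT x|lborel. f x)"
  using integral_affine[OF assms, of 1 t] by (simp add: add.commute)

lemma integrable_translate:
  fixes f :: "'a::euclidean_space \<Rightarrow> 'b::{banach, second_countable_topology}"
  assumes "integrable lborel f"
  shows "integrable lborel (\<lambda>x. f (x + t))"
proof -
  have "integrable (distr lborel borel ((+) t)) f"
    using assms by (simp add: lborel_distr_plus)
  then have "integrable lborel (\<lambda>x. f (t + x))"
    by (intro integrable_distr[of "(+) t" lborel borel]) auto
  then show ?thesis by (simp add: add.commute)
qed

lemma test_functions_lipschitz:
  fixes \<theta> :: "real ^ 'd \<Rightarrow> complex"
  assumes "\<theta> \<in> test_functions S"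
  obtains B where "B > 0" "\<And>x y. cmod (\<theta> x - \<theta> y) \<le> B * norm (x - y)"
proof -
  have "\<forall>i. \<exists>B>0. \<forall>x. cmod (partial i \<theta> x) \<le> B"
  proof
    fix i
    show "\<exists>B>0. \<forall>x. cmod (partial i \<theta> x) \<le> B"
      using test_functions_bounded[OF assms, of "[i]"] by auto
  qed
  then obtain b where b: "\<And>i. b i > 0" "\<And>i x. cmod (partial i \<theta> x) \<le> b i"
    by metis
  define B where "B = (\<Sum>i\<in>UNIV. b i)"
  have "B > 0"
    unfolding B_def using b by (intro sum_pos) auto
  moreover have "cmod (\<theta> x - \<theta> y) \<le> B * norm (x - y)" for x y
  proof (rule differentiable_bound[of UNIV])
    fix x
    show "(\<theta> has_derivative (\<lambda>h. \<Sum>i\<in>UNIV. (h $ i) *\<^sub>R partial i \<theta> x)) (at x within UNIV)"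
      using has_derivative_partial[OF smooth_on_differentiable[OF test_functionsD(1)[OF assms] UNIV_I]] by simp
    show "onorm (\<lambda>h. \<Sum>i\<in>UNIV. (h $ i) *\<^sub>R partial i \<theta> x) \<le> B"
    proof (rule onorm_le)
      fix h :: "real ^ 'd"
      have "norm (\<Sum>i\<in>UNIV. (h $ i) *\<^sub>R partial i \<theta> x) \<le> (\<Sum>i\<in>UNIV. norm h * b i)"
        by (intro sum_norm_le) (auto intro!: mult_mono component_le_norm_cart b)
      then show "norm (\<Sum>i\<in>UNIV. (h $ i) *\<^sub>R partial i \<theta> x) \<le> B * norm h"
        by (simp add: B_def sum_distrib_left sum_distrib_right mult.commute)
    qed
  qed auto
  ultimately show thesis using that by blast
qed

text \<open>By translation invariance every difference quotient has integral zero, and the quotients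
  converge to the partial. The Lipschitz constant on a ball dominates them. This is the integration
  by parts behind the transform of a derivative.\<close>

lemma integral_partial:
  fixes \<theta> :: "real ^ 'd \<Rightarrow> complex"
  assumes \<theta>: "\<theta> \<in> test_functions S"
  shows "(LINT x|lborel. partial i \<theta> x) = 0"
proof -
  obtain B where B: "B > 0" "\<And>x y. cmod (\<theta> x - \<theta> y) \<le> B * norm (x - y)"
    using test_functions_lipschitz[OF \<theta>] by blast
  obtain R where R: "\<And>x. x \<in> supp \<theta> \<Longrightarrow> norm x \<le> R"
    using test_functionsD(2)[OF \<theta>] bounded_iff compact_imp_bounded by metis
  have [measurable]: "\<theta> \<in> borel_measurable borel" "partial i \<theta> \<in> borel_measurable borel"
    using test_functionsD(4)[OF \<theta>] test_functionsD(4)[OF test_functions_partials[OF \<theta>, of "[i]"]]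
    by (auto intro: borel_measurable_continuous_onI)
  define e :: "real ^ 'd" where "e = axis i 1"
  define s where "s = (\<lambda>n x. real (Suc n) *\<^sub>R (\<theta> (x + (1 / Suc n) *\<^sub>R e) - \<theta> x))"
  have s0: "(LINT x|lborel. s n x) = 0" for n
    using integrable_translate[OF test_functions_integrable[OF \<theta>]] test_functions_integrable[OF \<theta>]
    by (simp add: s_def integral_translate)
  have "(\<lambda>n. LINT x|lborel. s n x) \<longlonglongrightarrow> (LINT x|lborel. partial i \<theta> x)"
  proof (rule integral_dominated_convergence)
    show "partial i \<theta> \<in> borel_measurable lborel" "\<And>n. s n \<in> borel_measurable lborel"
      unfolding s_def by simp_all
    \<comment> \<open>The step length \<open>1 / Suc n\<close> is at most \<open>1\<close>, so all
      quotients vanish outside the ball of radius \<open>R + 1\<close>.\<close>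
    show "integrable lborel (\<lambda>x. B * indicator (cball (0 :: real ^ 'd) (R + 1)) x)"
      using emeasure_compact_finite[OF compact_cball, of "0 :: real ^ 'd" "R + 1"]
      by (intro integrable_mult_right) (simp add: integrable_indicator_iff)
    show "AE x in lborel. (\<lambda>n. s n x) \<longlonglongrightarrow> partial i \<theta> x"
    proof (rule AE_I2)
      fix x
      let ?D = "\<lambda>h. \<Sum>i\<in>UNIV. (h $ i) *\<^sub>R partial i \<theta> x"
      have d: "(\<theta> has_derivative ?D) (at x)"
        by (rule has_derivative_partial[OF smooth_on_differentiable[OF test_functionsD(1)[OF \<theta>] UNIV_I]])
      have De: "?D ((1 / real (Suc n)) *\<^sub>R e) = (1 / real (Suc n)) *\<^sub>R partial i \<theta> x" for n
        by (simp add: e_def axis_def if_distrib if_distribR sum.delta' cong: if_cong)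
      have "(\<lambda>h. norm (\<theta> (x + h) - \<theta> x - ?D h) / norm h) \<midarrow>0\<rightarrow> 0"
        using d unfolding has_derivative_at by blast
      moreover have "filterlim (\<lambda>n. (1 / real (Suc n)) *\<^sub>R e) (at 0) sequentially"
      proof (rule filterlim_atI)
        show "(\<lambda>n. (1 / real (Suc n)) *\<^sub>R e) \<longlonglongrightarrow> 0"
          using tendsto_scaleR[OF LIMSEQ_Suc[OF lim_1_over_n] tendsto_const[of e]] by simp
      qed (simp add: e_def axis_eq_0_iff)
      ultimately have "(\<lambda>n. norm (\<theta> (x + (1 / real (Suc n)) *\<^sub>R e) - \<theta> x - ?D ((1 / real (Suc n)) *\<^sub>R e))
          / norm ((1 / real (Suc n)) *\<^sub>R e)) \<longlonglongrightarrow> 0"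
        by (rule filterlim_compose)
      moreover have "norm (\<theta> (x + (1 / real (Suc n)) *\<^sub>R e) - \<theta> x - ?D ((1 / real (Suc n)) *\<^sub>R e))
          / norm ((1 / real (Suc n)) *\<^sub>R e) = norm (s n x - partial i \<theta> x)" for n
      proof -
        have gen: "r *\<^sub>R a - p = r *\<^sub>R (a - (1 / r) *\<^sub>R p)" if "r \<noteq> 0" for r :: real and a p :: complex
          using that by (simp add: scaleR_diff_right)
        have "s n x - partial i \<theta> x = real (Suc n) *\<^sub>R (\<theta> (x + (1 / real (Suc n)) *\<^sub>R e) - \<theta> x - (1 / real (Suc n)) *\<^sub>R partial i \<theta> x)"
          unfolding s_def by (rule gen) simp
        then show ?thesis
          unfolding De by (simp add: e_def del: of_nat_Suc)
      qed
      ultimately have "(\<lambda>n. norm (s n x - partial i \<theta> x)) \<longlonglongrightarrow> 0"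
        by simp
      then show "(\<lambda>n. s n x) \<longlonglongrightarrow> partial i \<theta> x"
        by (rule LIM_zero_cancel[OF tendsto_norm_zero_cancel])
    qed
    show "AE x in lborel. norm (s n x) \<le> B * indicator (cball 0 (R + 1)) x" for n
    proof (rule AE_I2)
      fix x
      have n1: "norm ((1 / real (Suc n)) *\<^sub>R e) = 1 / real (Suc n)"
        by (simp add: e_def)
      have "norm (s n x) \<le> real (Suc n) * (B * (1 / real (Suc n)))"
        unfolding s_def norm_scaleR using B(2)[of "x + (1 / Suc n) *\<^sub>R e" x] n1
        by (intro mult_mono) (auto simp del: of_nat_Suc)
      then have "norm (s n x) \<le> B"
        by (simp add: field_simps del: of_nat_Suc)
      moreover have "s n x = 0" if "norm x > R + 1"
      proof -
        have "norm x \<le> norm (x + (1 / Suc n) *\<^sub>R e) + norm ((1 / Suc n) *\<^sub>R e)"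
          by (metis add_diff_cancel norm_triangle_ineq4)
        then have "norm (x + (1 / Suc n) *\<^sub>R e) > R"
          using n1 that by (smt (verit) divide_le_eq_1_pos of_nat_0_le_iff of_nat_Suc)
        then have "\<theta> (x + (1 / Suc n) *\<^sub>R e) = 0" "\<theta> x = 0"
          using R that not_in_supp by force+
        then show ?thesis by (simp add: s_def)
      qed
      ultimately show "norm (s n x) \<le> B * indicator (cball 0 (R + 1)) x"
        by (cases "norm x > R + 1") (auto simp: indicator_def)
    qed
  qed
  then show ?thesis
    unfolding s0 using LIMSEQ_unique tendsto_const by blast
qed

lemma norm_exponential [simp]: "cmod (exp (- (\<i> * complex_of_real r))) = 1" "cmod (exp (\<i> * complex_of_real r)) = 1"
  by (simp_all add: norm_exp_eq_Re)

lemma exponential_measurable [measurable]: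
  fixes \<xi> :: "real ^ 'd"
  shows "(\<lambda>x. exp (- (\<i> * complex_of_real (x \<bullet> \<xi>)))) \<in> borel_measurable borel"
  by (intro borel_measurable_continuous_onI continuous_intros)

lemma integrable_exponential_mult:
  fixes f :: "real ^ 'd \<Rightarrow> complex"
  assumes "integrable lborel f"
  shows "integrable lborel (\<lambda>x. exp (- (\<i> * of_real (x \<bullet> \<xi>))) * f x)"
  using assms
  by (rule Bochner_Integration.integrable_bound)
     (use assms in \<open>auto simp: norm_mult dest: borel_measurable_integrable\<close>)

section \<open>Derivatives and decay of the Fourier transform\<close>

lemma fourier_partial:
  fixes \<theta> :: "real ^ 'd \<Rightarrow> complex"
  assumes \<theta>: "\<theta> \<in> test_functions S"
  shows "fourier (partial i \<theta>) \<xi> = \<i> * of_real (\<xi> $ i) * fourier \<theta> \<xi>"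
proof -
  let ?e = "\<lambda>x. exp (- (\<i> * complex_of_real (x \<bullet> \<xi>)))"
  have "(\<lambda>x. \<theta> x * ?e x) \<in> test_functions S"
    by (rule test_functions_mult[OF \<theta> smooth_on_exponential])
  from integral_partial[OF this, of i]
  have "0 = (LINT x|lborel. partial i (\<lambda>x. \<theta> x * ?e x) x)" by simp
  also have "partial i (\<lambda>x. \<theta> x * ?e x) = (\<lambda>x. ?e x * partial i \<theta> x - (\<i> * of_real (\<xi> $ i)) * (?e x * \<theta> x))"
  proof
    fix x
    have "partial i (\<lambda>x. \<theta> x * ?e x) x = partial i \<theta> x * ?e x + \<theta> x * partial i ?e x"
      by (rule partial_mult)
         (use smooth_on_exponential \<theta> in \<open>auto intro!: smooth_on_differentiable[of UNIV] dest: test_functionsD\<close>)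
    also have "partial i ?e x = - (\<i> * of_real (\<xi> $ i)) * ?e x"
      using partial_eqI[OF has_derivative_exponential[of 1 \<xi> x], of i] by (simp add: inner_axis')
    finally show "partial i (\<lambda>x. \<theta> x * ?e x) x = ?e x * partial i \<theta> x - (\<i> * of_real (\<xi> $ i)) * (?e x * \<theta> x)"
      by (simp add: algebra_simps)
  qed
  also have "(LINT x|lborel. ?e x * partial i \<theta> x - (\<i> * of_real (\<xi> $ i)) * (?e x * \<theta> x)) =
      fourier (partial i \<theta>) \<xi> - \<i> * of_real (\<xi> $ i) * fourier \<theta> \<xi>"
    unfolding fourier_def
    using test_functions_integrable[OF \<theta>] test_functions_integrable[OF test_functions_partials[OF \<theta>, of "[i]"]]
    by (subst Bochner_Integration.integral_diff)
       (auto intro!: integrable_mult_right integrable_exponential_mult)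
  finally show ?thesis by simp
qed

lemma fourier_partials:
  fixes \<theta> :: "real ^ 'd \<Rightarrow> complex"
  assumes \<theta>: "\<theta> \<in> test_functions S"
  shows "cmod (fourier (partials is \<theta>) \<xi>) = (\<Prod>i\<leftarrow>is. \<bar>\<xi> $ i\<bar>) * cmod (fourier \<theta> \<xi>)"
  by (induction "is")
     (simp_all add: fourier_partial[OF test_functions_partials[OF \<theta>]] norm_mult)

lemma fourier_bound:
  assumes "compact K" "\<And>x. x \<in> K \<Longrightarrow> cmod (f x) \<le> B" "\<And>x. x \<notin> K \<Longrightarrow> f x = 0"
  shows "cmod (fourier f \<xi>) \<le> B * measure lborel K"
  unfolding fourier_def by (rule integral_bound_compact) (use assms in \<open>auto simp: norm_mult\<close>)

text \<open>Along the axis \<open>i\<close> of the largest component, \<open>norm \<eta>\<close> is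
  at most \<open>d\<close> times \<open>\<bar>\<eta> $ i\<bar>\<close>, so \<open>M\<close>
  derivatives along this single axis control the full norm. If that component is at most
  \<open>1\<close>, the bound on \<theta> itself is enough, as then
  \<open>1 + norm \<eta> \<le> d + 1\<close>.\<close>

lemma fourier_decay:
  fixes \<theta> :: "real ^ 'd \<Rightarrow> complex"
  assumes K: "compact K" and \<theta>: "\<theta> \<in> test_functions K"
    and B: "\<And>x. cmod (\<theta> x) \<le> B" "\<And>i x. cmod (partials (replicate M i) \<theta> x) \<le> B"
  shows "(1 + norm \<eta>) ^ M * cmod (fourier \<theta> \<eta>) \<le> (real CARD('d) + 1) ^ M * B * measure lborel K"
proof -
  let ?d = "real CARD('d)"
  have B0: "B \<ge> 0"
    using B(1)[of 0] norm_ge_zero order_trans by blast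
  have z: "\<theta> x = 0" if "x \<notin> K" for x
    using \<theta> that not_in_supp test_functionsD(3) by blast
  have "Max (range (\<lambda>j. \<bar>\<eta> $ j\<bar>)) \<in> range (\<lambda>j. \<bar>\<eta> $ j\<bar>)"
    by (rule Max_in) auto
  then obtain i where "Max (range (\<lambda>j. \<bar>\<eta> $ j\<bar>)) = \<bar>\<eta> $ i\<bar>"
    by blast
  then have i: "\<bar>\<eta> $ j\<bar> \<le> \<bar>\<eta> $ i\<bar>" for j
    using Max_ge[of "range (\<lambda>j. \<bar>\<eta> $ j\<bar>)" "\<bar>\<eta> $ j\<bar>"] by simp
  have n: "norm \<eta> \<le> ?d * \<bar>\<eta> $ i\<bar>"
    using norm_le_l1_cart[of \<eta>] sum_mono[of UNIV "\<lambda>j. \<bar>\<eta> $ j\<bar>" "\<lambda>j. \<bar>\<eta> $ i\<bar>"] i by simp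
  show ?thesis
  proof (cases "\<bar>\<eta> $ i\<bar> \<le> 1")
    case True
    then have "1 + norm \<eta> \<le> ?d + 1"
      using order_trans[OF n mult_left_mono[OF True, of ?d]] by simp
    then have "(1 + norm \<eta>) ^ M * cmod (fourier \<theta> \<eta>) \<le> (?d + 1) ^ M * (B * measure lborel K)"
      using fourier_bound[OF K, of \<theta> B] B z by (intro mult_mono power_mono) auto
    then show ?thesis by (simp add: mult.assoc)
  next
    case False
    then have "1 + norm \<eta> \<le> (?d + 1) * \<bar>\<eta> $ i\<bar>"
      using n by (simp add: algebra_simps)
    then have "(1 + norm \<eta>) ^ M * cmod (fourier \<theta> \<eta>) \<le> ((?d + 1) * \<bar>\<eta> $ i\<bar>) ^ M * cmod (fourier \<theta> \<eta>)"
      by (intro mult_right_mono power_mono) auto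
    also have "\<dots> = (?d + 1) ^ M * cmod (fourier (partials (replicate M i) \<theta>) \<eta>)"
      by (simp add: fourier_partials[OF \<theta>] power_mult_distrib prod_list_replicate)
    also have "\<dots> \<le> (?d + 1) ^ M * (B * measure lborel K)"
    proof (intro mult_left_mono fourier_bound K B)
      show "partials (replicate M i) \<theta> x = 0" if "x \<notin> K" for x
        using test_functionsD(3)[OF test_functions_partials[OF \<theta>]] that not_in_supp by blast
    qed auto
    finally show ?thesis by (simp add: mult.assoc)
  qed
qed

section \<open>Gaussian integrals and an integrable weight\<close>

lemma
  fixes f :: "'a::euclidean_space \<Rightarrow> real \<Rightarrow> complex"
  assumes f: "\<And>b. b \<in> Basis \<Longrightarrow> integrable lborel (f b)"
  shows integrable_lborel_prod: "integrable lborel (\<lambda>x::'a. \<Prod>b\<in>Basis. f b (x \<bullet> b))"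
    and integral_lborel_prod: "(LINT x|lborel. (\<Prod>b\<in>Basis. f b (x \<bullet> b))) = (\<Prod>b\<in>Basis. LINT t|lborel. f b t)"
proof -
  interpret product_sigma_finite "\<lambda>b::'a. lborel :: real measure" ..
  let ?P = "\<Pi>\<^sub>M b\<in>(Basis :: 'a set). (lborel :: real measure)"
  let ?T = "\<lambda>g. \<Sum>b\<in>Basis. g b *\<^sub>R (b :: 'a)"
  have T: "?T \<in> measurable ?P borel"
    by measurable
  have fm: "f b \<in> borel_measurable borel" if "b \<in> Basis" for b
    using borel_measurable_integrable[OF f[OF that]] by simp
  have m: "(\<lambda>x::'a. \<Prod>b\<in>Basis. f b (x \<bullet> b)) \<in> borel_measurable borel"
    by (intro borel_measurable_prod measurable_compose[OF _ fm]) auto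
  have e: "(\<Prod>b\<in>Basis. f b (?T g \<bullet> b)) = (\<Prod>b\<in>Basis. f b (g b))" for g
    by (intro prod.cong) auto
  have "integrable ?P (\<lambda>g. \<Prod>b\<in>Basis. f b (g b))"
    by (rule product_integrable_prod) (use f in auto)
  then have "integrable (distr ?P borel ?T) (\<lambda>x. \<Prod>b\<in>Basis. f b (x \<bullet> b))"
    by (subst integrable_distr_eq[OF T m]) (simp only: e)
  then show "integrable lborel (\<lambda>x::'a. \<Prod>b\<in>Basis. f b (x \<bullet> b))"
    by (subst lborel_eq)
  show "(LINT x|lborel. (\<Prod>b\<in>Basis. f b (x \<bullet> b))) = (\<Prod>b\<in>Basis. LINT t|lborel. f b t)"
    by (subst lborel_eq, subst integral_distr[OF T m], simp only: e, rule product_integral_prod)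
       (use f in auto)
qed

text \<open>Up to normalisation this is the characteristic function of the standard normal
  distribution, taken at \<open>- \<xi>\<close> because \<open>char\<close> uses the exponential
  with positive sign.\<close>

lemma
  fixes \<xi> :: real
  shows integrable_gaussian_1: "integrable lborel (\<lambda>t. exp (- (\<i> * of_real (t * \<xi>))) * of_real (exp (- t\<^sup>2 / 2)))"
    and integral_gaussian_1:
      "(LINT t|lborel. exp (- (\<i> * of_real (t * \<xi>))) * of_real (exp (- t\<^sup>2 / 2))) = of_real (sqrt (2 * pi) * exp (- \<xi>\<^sup>2 / 2))"
proof -
  have dens: "exp (- (\<i> * of_real (t * \<xi>))) * complex_of_real (exp (- t\<^sup>2 / 2)) =
      of_real (sqrt (2 * pi)) * (exp (- (\<i> * of_real (t * \<xi>))) * of_real (std_normal_density t))" for t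
    by (simp add: std_normal_density_def)
  have "integrable lborel (\<lambda>t. exp (- (\<i> * of_real (t * \<xi>))) * complex_of_real (std_normal_density t))"
    by (rule Bochner_Integration.integrable_bound[OF integrable_normal_density[of 1 0]]) (auto simp: norm_mult)
  then have "integrable lborel (\<lambda>t. of_real (sqrt (2 * pi)) * (exp (- (\<i> * of_real (t * \<xi>))) * complex_of_real (std_normal_density t)))"
    by (rule integrable_mult_right)
  then show "integrable lborel (\<lambda>t. exp (- (\<i> * of_real (t * \<xi>))) * of_real (exp (- t\<^sup>2 / 2)))"
    unfolding dens by simp
  have "of_real (exp (- \<xi>\<^sup>2 / 2)) = char std_normal_distribution (- \<xi>)"
    by (simp add: char_std_normal_distribution)
  also have "\<dots> = (LINT t|lborel. exp (- (\<i> * of_real (t * \<xi>))) * complex_of_real (std_normal_density t))"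
    unfolding char_def
    by (subst integral_density) (auto simp: scaleR_conv_of_real mult_ac)
  finally have "(LINT t|lborel. exp (- (\<i> * of_real (t * \<xi>))) * complex_of_real (std_normal_density t)) = of_real (exp (- \<xi>\<^sup>2 / 2))" ..
  then have "(LINT t|lborel. of_real (sqrt (2 * pi)) * (exp (- (\<i> * of_real (t * \<xi>))) * complex_of_real (std_normal_density t)))
     = of_real (sqrt (2 * pi)) * of_real (exp (- \<xi>\<^sup>2 / 2))"
    by simp
  then show "(LINT t|lborel. exp (- (\<i> * of_real (t * \<xi>))) * of_real (exp (- t\<^sup>2 / 2))) = of_real (sqrt (2 * pi) * exp (- \<xi>\<^sup>2 / 2))"
    unfolding dens by simp
qed

lemma exp_neg_sum: "finite A \<Longrightarrow> exp (- (\<i> * complex_of_real (\<Sum>b\<in>A. f b))) = (\<Prod>b\<in>A. exp (- (\<i> * of_real (f b))))"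
  by (simp add: exp_sum[symmetric] sum_distrib_left sum_negf)

lemma exp_norm_square:
  fixes x :: "'a::euclidean_space"
  shows "exp (- (norm x)\<^sup>2 / 2) = (\<Prod>b\<in>Basis. exp (- (x \<bullet> b)\<^sup>2 / 2))"
  unfolding power2_norm_eq_inner euclidean_inner[of x x]
  by (simp add: exp_sum[symmetric] power2_eq_square sum_negf flip: sum_divide_distrib)

lemma gaussian_split:
  fixes x \<xi> :: "'a::euclidean_space"
  shows "exp (- (\<i> * of_real (x \<bullet> \<xi>))) * complex_of_real (exp (- (norm x)\<^sup>2 / 2)) =
    (\<Prod>b\<in>Basis. exp (- (\<i> * of_real ((x \<bullet> b) * (\<xi> \<bullet> b)))) * of_real (exp (- (x \<bullet> b)\<^sup>2 / 2)))"
  unfolding exp_norm_square of_real_prod euclidean_inner[of x \<xi>] exp_neg_sum[OF finite_Basis] prod.distrib ..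

lemma
  fixes \<xi> :: "'a::euclidean_space"
  shows integrable_gaussian:
      "integrable lborel (\<lambda>x::'a. exp (- (\<i> * of_real (x \<bullet> \<xi>))) * complex_of_real (exp (- (norm x)\<^sup>2 / 2)))"
    and integral_gaussian:
      "(LINT x|lborel. exp (- (\<i> * of_real (x \<bullet> \<xi>))) * complex_of_real (exp (- (norm x)\<^sup>2 / 2))) =
        of_real (sqrt (2 * pi) ^ DIM('a) * exp (- (norm \<xi>)\<^sup>2 / 2))"
proof -
  let ?f = "\<lambda>b t. exp (- (\<i> * of_real (t * (\<xi> \<bullet> b)))) * complex_of_real (exp (- t\<^sup>2 / 2))"
  show "integrable lborel (\<lambda>x::'a. exp (- (\<i> * of_real (x \<bullet> \<xi>))) * complex_of_real (exp (- (norm x)\<^sup>2 / 2)))"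
    unfolding gaussian_split by (rule integrable_lborel_prod[of ?f]) (rule integrable_gaussian_1)
  have "(LINT x|lborel. exp (- (\<i> * of_real (x \<bullet> \<xi>))) * complex_of_real (exp (- (norm x)\<^sup>2 / 2))) =
      (\<Prod>b\<in>(Basis::'a set). LINT t|lborel. ?f b t)"
    unfolding gaussian_split by (rule integral_lborel_prod[of ?f]) (rule integrable_gaussian_1)
  also have "\<dots> = (\<Prod>b\<in>(Basis::'a set). of_real (sqrt (2 * pi) * exp (- (\<xi> \<bullet> b)\<^sup>2 / 2)))"
    by (simp only: integral_gaussian_1)
  also have "\<dots> = of_real (sqrt (2 * pi) ^ DIM('a) * (\<Prod>b\<in>Basis. exp (- (\<xi> \<bullet> b)\<^sup>2 / 2)))"
    by (simp add: prod.distrib)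
  also have "(\<Prod>b\<in>Basis. exp (- (\<xi> \<bullet> b)\<^sup>2 / 2)) = exp (- (norm \<xi>)\<^sup>2 / 2)"
    by (rule exp_norm_square[symmetric])
  finally show "(LINT x|lborel. exp (- (\<i> * of_real (x \<bullet> \<xi>))) * complex_of_real (exp (- (norm x)\<^sup>2 / 2))) =
        of_real (sqrt (2 * pi) ^ DIM('a) * exp (- (norm \<xi>)\<^sup>2 / 2))" .
qed

text \<open>Each basis direction contributes
  \<open>1 + (x \<bullet> b)^2 \<le> (1 + norm x)^2\<close>, so the weight lies below a product of
  integrable functions of one variable. This is the origin of the exponent
  \<open>2 * CARD('d)\<close> in the later estimates.\<close>

lemma integrable_lborel_weight:
  "integrable lborel (\<lambda>x::'a::euclidean_space. 1 / (1 + norm x) ^ (2 * DIM('a)))"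
proof (rule Bochner_Integration.integrable_bound)
  have "integrable lborel (\<lambda>t::real. inverse (1 + t\<^sup>2))"
    using integrable_inverse_1_plus_square by (simp add: set_integrable_def)
  then have "integrable lborel (\<lambda>t. complex_of_real (inverse (1 + t\<^sup>2)))"
    by (rule integrable_of_real)
  then show "integrable lborel (\<lambda>x::'a. \<Prod>b\<in>Basis. complex_of_real (inverse (1 + (x \<bullet> b)\<^sup>2)))"
    by (rule integrable_lborel_prod)
  show "AE x::'a in lborel. norm (1 / (1 + norm x) ^ (2 * DIM('a))) \<le> norm (\<Prod>b\<in>Basis. complex_of_real (inverse (1 + (x \<bullet> b)\<^sup>2)))"
  proof (rule AE_I2)
    fix x :: 'a
    have "(\<Prod>b\<in>(Basis :: 'a set). inverse ((1 + norm x)\<^sup>2)) \<le> (\<Prod>b\<in>Basis. inverse (1 + (x \<bullet> b)\<^sup>2))"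
    proof (rule prod_mono, intro conjI)
      fix b :: 'a assume "b \<in> Basis"
      then have "(x \<bullet> b)\<^sup>2 \<le> (norm x)\<^sup>2"
        using power_mono[OF Basis_le_norm[of b x] abs_ge_zero, of 2] by simp
      then have "1 + (x \<bullet> b)\<^sup>2 \<le> (1 + norm x)\<^sup>2"
        using norm_ge_zero[of x] unfolding power2_sum one_power2 mult_1_right by linarith
      then show "inverse ((1 + norm x)\<^sup>2) \<le> inverse (1 + (x \<bullet> b)\<^sup>2)"
        by (intro le_imp_inverse_le) (auto simp: add_pos_nonneg)
    qed simp
    moreover have "1 / (1 + norm x) ^ (2 * DIM('a)) = (\<Prod>b\<in>(Basis::'a set). inverse ((1 + norm x)\<^sup>2))"
      by (simp add: power_mult power_inverse divide_inverse)
    moreover have "norm (\<Prod>b\<in>Basis. complex_of_real (inverse (1 + (x \<bullet> b)\<^sup>2))) = (\<Prod>b\<in>Basis. inverse (1 + (x \<bullet> b)\<^sup>2))"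
      unfolding of_real_prod[symmetric] norm_of_real by (intro abs_of_nonneg prod_nonneg) auto
    ultimately show "norm (1 / (1 + norm x) ^ (2 * DIM('a))) \<le> norm (\<Prod>b\<in>Basis. complex_of_real (inverse (1 + (x \<bullet> b)\<^sup>2)))"
      by simp
  qed
qed measurable

text \<open>Made for kernels that are a product of one integrable function per variable with phase
  factors: absolute integrability is read off from the moduli.\<close>

lemma integrable_pair_mult:
  fixes f g :: "'a::euclidean_space \<Rightarrow> complex" and h :: "'a \<Rightarrow> 'a \<Rightarrow> complex"
  assumes f: "integrable lborel f" and g: "integrable lborel g"
    and h: "case_prod h \<in> borel_measurable (lborel \<Otimes>\<^sub>M lborel)" "\<And>x y. cmod (h x y) = cmod (f x) * cmod (g y)"
  shows "integrable (lborel \<Otimes>\<^sub>M lborel) (case_prod h)"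
proof (rule lborel_pair.Fubini_integrable[OF h(1)])
  have n: "integrable lborel (\<lambda>x. cmod (f x))" "integrable lborel (\<lambda>x. cmod (g x))"
    using f g by auto
  show "integrable lborel (\<lambda>x. LINT y|lborel. cmod (case (x, y) of (x, y) \<Rightarrow> h x y))"
    using n by (simp add: h)
  show "AE x in lborel. integrable lborel (\<lambda>y. case (x, y) of (x, y) \<Rightarrow> h x y)"
  proof (rule AE_I2)
    fix x :: 'a
    have "(\<lambda>y. h x y) \<in> borel_measurable lborel"
      using measurable_compose[OF measurable_Pair1' h(1), of x] by simp
    moreover have "integrable lborel (\<lambda>y. cmod (f x) * cmod (g y))"
      using n by simp
    ultimately have "integrable lborel (\<lambda>y. h x y)"
      by (intro Bochner_Integration.integrable_bound[where f="\<lambda>y. cmod (f x) * cmod (g y)" and g="h x"]) (auto simp: h)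
    then show "integrable lborel (\<lambda>y. case (x, y) of (x, y) \<Rightarrow> h x y)" by simp
  qed
qed

section \<open>Integrable transforms and Fourier inversion\<close>

lemma fourier_measurable [measurable]:
  fixes f :: "real ^ 'd \<Rightarrow> complex"
  assumes [measurable]: "f \<in> borel_measurable borel"
  shows "fourier f \<in> borel_measurable borel"
proof -
  have "(\<lambda>\<xi>. LINT x|lborel. exp (- (\<i> * of_real (x \<bullet> \<xi>))) * f x) \<in> borel_measurable borel"
    by measurable
  then show ?thesis by (simp add: fourier_def[abs_def])
qed

lemma test_functions_measurable: "\<theta> \<in> test_functions S \<Longrightarrow> \<theta> \<in> borel_measurable borel"
  by (intro borel_measurable_continuous_onI test_functionsD(4))

lemma test_functions_decay:
  fixes \<theta> :: "real ^ 'd \<Rightarrow> complex"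
  assumes "\<theta> \<in> test_functions S"
  obtains A where "\<And>\<eta>. (1 + norm \<eta>) ^ M * cmod (fourier \<theta> \<eta>) \<le> A"
proof -
  have "\<forall>is. \<exists>B. \<forall>x. cmod (partials is \<theta> x) \<le> B"
    using test_functions_bounded[OF assms] by metis
  then obtain b where b: "\<And>is x. cmod (partials is \<theta> x) \<le> b is"
    by metis
  define B where "B = b [] + (\<Sum>i\<in>UNIV. b (replicate M i))"
  have b0: "b is \<ge> 0" for "is"
    using b[of "is" 0] norm_ge_zero order_trans by blast
  have "cmod (\<theta> x) \<le> B" "cmod (partials (replicate M i) \<theta> x) \<le> B" for i x
  proof -
    show "cmod (\<theta> x) \<le> B"
      using b[of "[]" x] b0 sum_nonneg[of UNIV "\<lambda>i. b (replicate M i)"] by (simp add: B_def)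
    have "b (replicate M i) \<le> (\<Sum>i\<in>UNIV. b (replicate M i))"
      by (rule member_le_sum) (use b0 in auto)
    then show "cmod (partials (replicate M i) \<theta> x) \<le> B"
      using b[of "replicate M i" x] b0[of "[]"] by (simp add: B_def)
  qed
  moreover have "\<theta> \<in> test_functions (supp \<theta>)"
    using assms by (auto simp: test_functions_def)
  ultimately show thesis
    using that fourier_decay[of "supp \<theta>" \<theta> B M] test_functionsD(2)[OF assms] by blast
qed

lemma integrable_fourier:
  fixes \<theta> :: "real ^ 'd \<Rightarrow> complex"
  assumes \<theta>: "\<theta> \<in> test_functions S"
  shows "integrable lborel (fourier \<theta>)"
proof -
  obtain A where A: "\<And>\<eta>. (1 + norm \<eta>) ^ (2 * CARD('d)) * cmod (fourier \<theta> \<eta>) \<le> A"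
    using test_functions_decay[OF \<theta>] by blast
  have "integrable lborel (\<lambda>\<eta>::real ^ 'd. A * (1 / (1 + norm \<eta>) ^ (2 * CARD('d))))"
    using integrable_lborel_weight[where 'a="real ^ 'd"] by (intro integrable_mult_right) simp
  then show ?thesis
  proof (rule Bochner_Integration.integrable_bound)
    show "fourier \<theta> \<in> borel_measurable lborel"
      using test_functions_measurable[OF \<theta>] by measurable
    have "cmod (fourier \<theta> \<eta>) \<le> A * (1 / (1 + norm \<eta>) ^ (2 * CARD('d)))" for \<eta>
      using A[of \<eta>] by (simp add: pos_le_divide_eq add_pos_nonneg mult.commute)
    then show "AE \<eta> in lborel. cmod (fourier \<theta> \<eta>) \<le> norm (A * (1 / (1 + norm \<eta>) ^ (2 * CARD('d))))"
      by (intro AE_I2) (smt (verit) real_norm_def)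
  qed
qed

text \<open>The Gaussian makes the double integral absolutely convergent, so that the order of
  integration can be exchanged; the integral over the frequency is then the transform of a dilated
  Gaussian, evaluated at the displacement from \<open>x\<close>.\<close>

lemma fourier_inversion_damped:
  fixes \<theta> :: "real ^ 'd \<Rightarrow> complex"
  assumes \<theta>: "\<theta> \<in> test_functions S" and t: "t > 0"
  shows "(LINT \<eta>|lborel. exp (\<i> * of_real (x \<bullet> \<eta>)) * fourier \<theta> \<eta> * of_real (exp (- (norm (t *\<^sub>R \<eta>))\<^sup>2 / 2))) =
    of_real (sqrt (2 * pi) ^ CARD('d)) * (LINT z|lborel. \<theta> (x + t *\<^sub>R z) * of_real (exp (- (norm z)\<^sup>2 / 2)))"
proof -
  let ?G = "\<lambda>z :: real ^ 'd. complex_of_real (exp (- (norm z)\<^sup>2 / 2))"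
  have m[measurable]: "\<theta> \<in> borel_measurable borel"
    by (rule test_functions_measurable[OF \<theta>])
  have scale: "(LINT \<eta>|lborel. h \<eta>) = of_real (t ^ CARD('d)) * (LINT z|lborel. h (y + t *\<^sub>R z))"
    if "h \<in> borel_measurable borel" for h :: "real ^ 'd \<Rightarrow> complex" and y
    using integral_affine[OF that, of t y] t by (simp add: scaleR_conv_of_real)
  have Gt: "integrable lborel (\<lambda>\<eta>. ?G (t *\<^sub>R \<eta>))"
  proof -
    have "integrable lborel ?G"
      using integrable_gaussian[of "0 :: real ^ 'd"] by simp
    then have "integrable (density (distr lborel borel (\<lambda>x. 0 + t *\<^sub>R x)) (\<lambda>_. ennreal (\<bar>t\<bar> ^ DIM(real ^ 'd)))) ?G"
      by (subst (asm) lborel_affine[of t 0]) (use t in auto)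
    then have "integrable (distr lborel borel (\<lambda>x. 0 + t *\<^sub>R x)) (\<lambda>x. \<bar>t\<bar> ^ DIM(real ^ 'd) *\<^sub>R ?G x)"
      by (subst (asm) integrable_density) auto
    from integrable_scaleR_right[OF this, of "inverse (t ^ CARD('d))"]
    have "integrable (distr lborel borel (\<lambda>x. t *\<^sub>R x)) ?G"
      using t by simp
    then show ?thesis
      by (intro integrable_distr[of "\<lambda>x. t *\<^sub>R x" lborel borel]) auto
  qed
  define h where "h = (\<lambda>\<eta> y. exp (\<i> * of_real (x \<bullet> \<eta>)) * (exp (- (\<i> * of_real (y \<bullet> \<eta>))) * \<theta> y) * ?G (t *\<^sub>R \<eta>))"
  have ih: "integrable (lborel \<Otimes>\<^sub>M lborel) (case_prod h)"
    by (rule integrable_pair_mult[OF Gt test_functions_integrable[OF \<theta>]])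
       (auto simp: h_def norm_mult)
  have "(LINT \<eta>|lborel. exp (\<i> * of_real (x \<bullet> \<eta>)) * fourier \<theta> \<eta> * ?G (t *\<^sub>R \<eta>)) = (LINT \<eta>|lborel. LINT y|lborel. h \<eta> y)"
    unfolding h_def fourier_def by simp
  also have "\<dots> = (LINT y|lborel. LINT \<eta>|lborel. h \<eta> y)"
    using lborel_pair.Fubini_integral[OF ih] by simp
  \<comment> \<open>Substitution of \<open>x + t *\<^sub>R z\<close> for \<open>y\<close>; its
    Jacobian cancels the inverse power of \<open>t\<close> that comes from the transform of the
    dilated Gaussian.\<close>
  also have "\<dots> = of_real (t ^ CARD('d)) * (LINT z|lborel. LINT \<eta>|lborel. h \<eta> (x + t *\<^sub>R z))"
    by (rule scale) (simp add: h_def)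
  also have "(\<lambda>z. LINT \<eta>|lborel. h \<eta> (x + t *\<^sub>R z)) =
      (\<lambda>z. of_real (sqrt (2 * pi) ^ CARD('d) / t ^ CARD('d)) * (\<theta> (x + t *\<^sub>R z) * ?G z))"
  proof
    fix z
    have e: "h \<eta> (x + t *\<^sub>R z) = \<theta> (x + t *\<^sub>R z) * (exp (- (\<i> * of_real ((t *\<^sub>R \<eta>) \<bullet> z))) * ?G (t *\<^sub>R \<eta>))" for \<eta>
    proof -
      have "exp (\<i> * of_real (x \<bullet> \<eta>)) * exp (- (\<i> * of_real ((x + t *\<^sub>R z) \<bullet> \<eta>))) = exp (- (\<i> * of_real ((t *\<^sub>R \<eta>) \<bullet> z)))"
        by (simp add: exp_add[symmetric] inner_add_left algebra_simps inner_commute)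
      then show ?thesis unfolding h_def by (simp add: mult_ac)
    qed
    have "of_real (sqrt (2 * pi) ^ CARD('d) * exp (- (norm z)\<^sup>2 / 2)) =
       of_real (t ^ CARD('d)) * (LINT \<eta>|lborel. exp (- (\<i> * of_real ((t *\<^sub>R \<eta>) \<bullet> z))) * ?G (t *\<^sub>R \<eta>))"
      using scale[of "\<lambda>\<eta>. exp (- (\<i> * of_real (\<eta> \<bullet> z))) * ?G \<eta>" 0] integral_gaussian[of z] by simp
    then have "(LINT \<eta>|lborel. exp (- (\<i> * of_real ((t *\<^sub>R \<eta>) \<bullet> z))) * ?G (t *\<^sub>R \<eta>)) =
        of_real (sqrt (2 * pi) ^ CARD('d) / t ^ CARD('d)) * ?G z"
      using t by (simp add: field_simps)
    then show "(LINT \<eta>|lborel. h \<eta> (x + t *\<^sub>R z)) =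
      of_real (sqrt (2 * pi) ^ CARD('d) / t ^ CARD('d)) * (\<theta> (x + t *\<^sub>R z) * ?G z)"
      unfolding e by simp
  qed
  finally show ?thesis
    using t by simp
qed

text \<open>The damping parameter tends to zero along \<open>1 / Suc n\<close>, with dominated
  convergence on both sides. The constant arises as a square: one factor
  \<open>sqrt (2 * pi) ^ CARD('d)\<close> stands in the damped formula, the other is the total mass
  of the Gaussian.\<close>

lemma fourier_inversion:
  fixes \<theta> :: "real ^ 'd \<Rightarrow> complex"
  assumes \<theta>: "\<theta> \<in> test_functions S"
  shows "of_real ((2 * pi) ^ CARD('d)) * \<theta> x = (LINT \<eta>|lborel. exp (\<i> * of_real (x \<bullet> \<eta>)) * fourier \<theta> \<eta>)"
proof -
  let ?G = "\<lambda>z :: real ^ 'd. complex_of_real (exp (- (norm z)\<^sup>2 / 2))"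
  let ?t = "\<lambda>n. 1 / real (Suc n)"
  have t0: "?t \<longlonglongrightarrow> 0"
    using LIMSEQ_Suc[OF lim_1_over_n] .
  have m[measurable]: "\<theta> \<in> borel_measurable borel"
    by (rule test_functions_measurable[OF \<theta>])
  obtain B where B: "\<And>x. cmod (\<theta> x) \<le> B"
    using test_functions_bounded[OF \<theta>, of "[]"] by auto
  have GI: "integrable lborel ?G"
    using integrable_gaussian[of "0 :: real ^ 'd"] by simp
  have lhs: "(\<lambda>n. LINT \<eta>|lborel. exp (\<i> * of_real (x \<bullet> \<eta>)) * fourier \<theta> \<eta> * ?G (?t n *\<^sub>R \<eta>)) \<longlonglongrightarrow>
      (LINT \<eta>|lborel. exp (\<i> * of_real (x \<bullet> \<eta>)) * fourier \<theta> \<eta>)"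
  proof (rule integral_dominated_convergence)
    show "integrable lborel (\<lambda>\<eta>. cmod (fourier \<theta> \<eta>))"
      using integrable_fourier[OF \<theta>] by simp
    show "AE \<eta> in lborel. (\<lambda>n. exp (\<i> * of_real (x \<bullet> \<eta>)) * fourier \<theta> \<eta> * ?G (?t n *\<^sub>R \<eta>)) \<longlonglongrightarrow> exp (\<i> * of_real (x \<bullet> \<eta>)) * fourier \<theta> \<eta>"
    proof (rule AE_I2)
      fix \<eta> :: "real ^ 'd"
      have "(\<lambda>n. ?G (?t n *\<^sub>R \<eta>)) \<longlonglongrightarrow> ?G (0 *\<^sub>R \<eta>)"
        by (rule isCont_tendsto_compose[OF _ t0]) (intro continuous_intros, simp)
      from tendsto_mult[OF tendsto_const this]
      show "(\<lambda>n. exp (\<i> * of_real (x \<bullet> \<eta>)) * fourier \<theta> \<eta> * ?G (?t n *\<^sub>R \<eta>)) \<longlonglongrightarrow> exp (\<i> * of_real (x \<bullet> \<eta>)) * fourier \<theta> \<eta>"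
        by simp
    qed
    show "AE \<eta> in lborel. norm (exp (\<i> * of_real (x \<bullet> \<eta>)) * fourier \<theta> \<eta> * ?G (?t n *\<^sub>R \<eta>)) \<le> cmod (fourier \<theta> \<eta>)" for n
      by (intro AE_I2) (auto simp: norm_mult intro!: mult_left_le)
  qed measurable
  have rhs: "(\<lambda>n. of_real (sqrt (2 * pi) ^ CARD('d)) * (LINT z|lborel. \<theta> (x + ?t n *\<^sub>R z) * ?G z)) \<longlonglongrightarrow>
      of_real (sqrt (2 * pi) ^ CARD('d)) * (LINT z|lborel. \<theta> x * ?G z)"
  proof (intro tendsto_mult tendsto_const, rule integral_dominated_convergence)
    show "integrable lborel (\<lambda>z. B * cmod (?G z))"
      using GI by (intro integrable_mult_right integrable_norm)
    show "AE z in lborel. (\<lambda>n. \<theta> (x + ?t n *\<^sub>R z) * ?G z) \<longlonglongrightarrow> \<theta> x * ?G z"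
    proof (rule AE_I2)
      fix z :: "real ^ 'd"
      have "(\<lambda>n. x + ?t n *\<^sub>R z) \<longlonglongrightarrow> x + 0 *\<^sub>R z"
        by (intro tendsto_intros t0)
      moreover have "isCont \<theta> x"
        using test_functionsD(4)[OF \<theta>] by (simp add: continuous_on_eq_continuous_at)
      ultimately have "(\<lambda>n. \<theta> (x + ?t n *\<^sub>R z)) \<longlonglongrightarrow> \<theta> x"
        using isCont_tendsto_compose[of x \<theta>] by simp
      then show "(\<lambda>n. \<theta> (x + ?t n *\<^sub>R z) * ?G z) \<longlonglongrightarrow> \<theta> x * ?G z"
        by (intro tendsto_mult tendsto_const)
    qed
    show "AE z in lborel. norm (\<theta> (x + ?t n *\<^sub>R z) * ?G z) \<le> B * cmod (?G z)" for n
      by (intro AE_I2) (auto simp: norm_mult intro!: mult_right_mono B)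
  qed measurable
  have G0: "(LINT z|lborel. \<theta> x * ?G z) = \<theta> x * of_real (sqrt (2 * pi) ^ CARD('d))"
    using integral_gaussian[of "0 :: real ^ 'd"] by simp
  have damped: "(LINT \<eta>|lborel. exp (\<i> * of_real (x \<bullet> \<eta>)) * fourier \<theta> \<eta> * ?G (?t n *\<^sub>R \<eta>)) =
      of_real (sqrt (2 * pi) ^ CARD('d)) * (LINT z|lborel. \<theta> (x + ?t n *\<^sub>R z) * ?G z)" for n
    by (rule fourier_inversion_damped[OF \<theta>]) simp
  have "(LINT \<eta>|lborel. exp (\<i> * of_real (x \<bullet> \<eta>)) * fourier \<theta> \<eta>) =
      of_real (sqrt (2 * pi) ^ CARD('d)) * (\<theta> x * of_real (sqrt (2 * pi) ^ CARD('d)))"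
    unfolding G0[symmetric] by (rule LIMSEQ_unique[OF lhs[unfolded damped] rhs])
  also have "\<dots> = of_real (sqrt (2 * pi) ^ CARD('d) * sqrt (2 * pi) ^ CARD('d)) * \<theta> x"
    by simp
  also have "sqrt (2 * pi) ^ CARD('d) * sqrt (2 * pi) ^ CARD('d) = (2 * pi) ^ CARD('d)"
    unfolding power_mult_distrib[symmetric] by simp
  finally show ?thesis ..
qed

text \<open>Meant for functions whose transform is concentrated near a frequency \<zeta>. By
  inversion a partial is an integral over its transform, and \<open>1 + norm \<eta> \<le> (1 + norm
  (\<eta> - \<zeta>)) * (1 + norm \<zeta>)\<close> charges the derivatives to \<zeta> and to
  \<open>m\<close> powers of decay; the remaining \<open>2 * CARD('d)\<close> powers make the
  integral converge.\<close>

lemma sup_partials_bound: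
  fixes \<theta> :: "real ^ 'd \<Rightarrow> complex"
  assumes \<theta>: "\<theta> \<in> test_functions S"
    and A: "\<And>\<eta>. (1 + norm (\<eta> - \<zeta>)) ^ (m + 2 * CARD('d)) * cmod (fourier \<theta> \<eta>) \<le> A"
    and len: "length is \<le> m"
  shows "cmod (partials is \<theta> x) \<le> A * (1 + norm \<zeta>) ^ m * (LINT \<eta>|lborel. 1 / (1 + norm (\<eta> :: real ^ 'd)) ^ (2 * CARD('d)))"
proof -
  let ?w = "\<lambda>\<eta> :: real ^ 'd. 1 / (1 + norm \<eta>) ^ (2 * CARD('d))"
  have wi: "integrable lborel ?w"
    using integrable_lborel_weight[where 'a="real ^ 'd"] by simp
  have A0: "A \<ge> 0"
    using A[of 0] by (smt (verit) mult_nonneg_nonneg norm_ge_zero zero_le_power)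
  have pb: "cmod (fourier (partials is \<theta>) \<eta>) \<le> A * (1 + norm \<zeta>) ^ m * ?w (\<eta> - \<zeta>)" for \<eta>
  proof -
    have "(\<Prod>i\<leftarrow>is. \<bar>\<eta> $ i\<bar>) \<le> (1 + norm \<eta>) ^ length is"
    proof (induction "is")
      case (Cons i "is")
      have "\<bar>\<eta> $ i\<bar> \<le> 1 + norm \<eta>"
        using component_le_norm_cart[of \<eta> i] by simp
      moreover have "0 \<le> (\<Prod>i\<leftarrow>is. \<bar>\<eta> $ i\<bar>)"
        by (intro prod_list_nonneg) auto
      ultimately show ?case
        using Cons by (auto intro!: mult_mono)
    qed simp
    also have "\<dots> \<le> (1 + norm \<eta>) ^ m"
      using len by (intro power_increasing) auto
    also have "\<dots> \<le> ((1 + norm (\<eta> - \<zeta>)) * (1 + norm \<zeta>)) ^ m"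
    proof (intro power_mono)
      have "norm \<eta> \<le> norm (\<eta> - \<zeta>) + norm \<zeta>"
        by (metis diff_add_cancel norm_triangle_ineq)
      moreover have "0 \<le> norm (\<eta> - \<zeta>) * norm \<zeta>" by simp
      ultimately show "1 + norm \<eta> \<le> (1 + norm (\<eta> - \<zeta>)) * (1 + norm \<zeta>)"
        unfolding distrib_left distrib_right mult_1_left mult_1_right by linarith
    qed auto
    finally have "cmod (fourier (partials is \<theta>) \<eta>) \<le> ((1 + norm (\<eta> - \<zeta>)) * (1 + norm \<zeta>)) ^ m * cmod (fourier \<theta> \<eta>)"
      unfolding fourier_partials[OF \<theta>] by (intro mult_right_mono) auto
    also have "\<dots> = (1 + norm \<zeta>) ^ m * ((1 + norm (\<eta> - \<zeta>)) ^ (m + 2 * CARD('d)) * cmod (fourier \<theta> \<eta>)) * ?w (\<eta> - \<zeta>)"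
    proof -
      have "1 + norm (\<eta> - \<zeta>) \<noteq> 0"
        by (metis add.commute add_nonneg_eq_0_iff norm_ge_zero zero_le_one zero_neq_one)
      then show ?thesis by (simp add: power_mult_distrib power_add)
    qed
    also have "\<dots> \<le> (1 + norm \<zeta>) ^ m * A * ?w (\<eta> - \<zeta>)"
      by (intro mult_mono A) (use A0 in auto)
    finally show ?thesis by (simp add: mult_ac)
  qed
  have "(2 * pi) ^ CARD('d) * cmod (partials is \<theta> x) = cmod (of_real ((2 * pi) ^ CARD('d)) * partials is \<theta> x)"
    by (simp add: norm_mult norm_power)
  also have "\<dots> = cmod (LINT \<eta>|lborel. exp (\<i> * of_real (x \<bullet> \<eta>)) * fourier (partials is \<theta>) \<eta>)"
    by (simp only: fourier_inversion[OF test_functions_partials[OF \<theta>]])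
  also have "\<dots> \<le> (LINT \<eta>|lborel. cmod (exp (\<i> * of_real (x \<bullet> \<eta>)) * fourier (partials is \<theta>) \<eta>))"
    by (rule integral_norm_bound)
  also have "\<dots> \<le> (LINT \<eta>|lborel. A * (1 + norm \<zeta>) ^ m * ?w (\<eta> - \<zeta>))"
  proof (rule integral_mono')
    show "integrable lborel (\<lambda>\<eta>. A * (1 + norm \<zeta>) ^ m * ?w (\<eta> - \<zeta>))"
      using integrable_translate[OF wi, of "- \<zeta>"] by (intro integrable_mult_right) simp
  qed (use pb A0 in \<open>auto simp: norm_mult\<close>)
  also have "\<dots> = A * (1 + norm \<zeta>) ^ m * (LINT \<eta>|lborel. ?w (\<eta> - \<zeta>))"
    by (rule integral_mult_right_zero)
  also have "(LINT \<eta>|lborel. ?w (\<eta> - \<zeta>)) = (LINT \<eta>|lborel. ?w \<eta>)"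
  proof -
    have "complex_of_real (LINT \<eta>|lborel. ?w (\<eta> + - \<zeta>)) = of_real (LINT \<eta>|lborel. ?w \<eta>)"
      unfolding integral_complex_of_real[symmetric] by (rule integral_translate) measurable
    then show ?thesis by (simp del: of_real_divide)
  qed
  finally have "(2 * pi) ^ CARD('d) * cmod (partials is \<theta> x) \<le> A * (1 + norm \<zeta>) ^ m * (LINT \<eta>|lborel. ?w \<eta>)" .
  moreover have "1 * cmod (partials is \<theta> x) \<le> (2 * pi) ^ CARD('d) * cmod (partials is \<theta> x)"
    using pi_gt3 by (intro mult_right_mono one_le_power) auto
  ultimately show ?thesis by simp
qed

text \<open>Only \<kappa> is written as an inverse Fourier integral, so \<open>g\<close> may be
  merely integrable; exchanging the integrals yields the convolution.\<close>

lemma fourier_mult: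
  fixes \<kappa> g :: "real ^ 'd \<Rightarrow> complex"
  assumes \<kappa>: "\<kappa> \<in> test_functions S" and g: "integrable lborel g"
  shows "of_real ((2 * pi) ^ CARD('d)) * fourier (\<lambda>x. \<kappa> x * g x) \<xi> = (LINT \<eta>|lborel. fourier \<kappa> \<eta> * fourier g (\<xi> - \<eta>))"
proof -
  have m[measurable]: "\<kappa> \<in> borel_measurable borel" "g \<in> borel_measurable borel"
    using test_functions_measurable[OF \<kappa>] borel_measurable_integrable[OF g] by auto
  define h where "h = (\<lambda>x \<eta>. (exp (- (\<i> * of_real (x \<bullet> \<xi>))) * g x) * (exp (\<i> * of_real (x \<bullet> \<eta>)) * fourier \<kappa> \<eta>))"
  have ih: "integrable (lborel \<Otimes>\<^sub>M lborel) (case_prod h)"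
    by (rule integrable_pair_mult[OF g integrable_fourier[OF \<kappa>]])
       (auto simp: h_def norm_mult)
  have "of_real ((2 * pi) ^ CARD('d)) * fourier (\<lambda>x. \<kappa> x * g x) \<xi> =
      (LINT x|lborel. (exp (- (\<i> * of_real (x \<bullet> \<xi>))) * g x) * (of_real ((2 * pi) ^ CARD('d)) * \<kappa> x))"
    unfolding fourier_def by (simp add: mult_ac flip: integral_mult_right_zero)
  also have "\<dots> = (LINT x|lborel. LINT \<eta>|lborel. h x \<eta>)"
    unfolding fourier_inversion[OF \<kappa>] h_def by simp
  also have "\<dots> = (LINT \<eta>|lborel. LINT x|lborel. h x \<eta>)"
    using lborel_pair.Fubini_integral[OF ih] by simp
  also have "(\<lambda>\<eta>. LINT x|lborel. h x \<eta>) = (\<lambda>\<eta>. fourier \<kappa> \<eta> * fourier g (\<xi> - \<eta>))"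
  proof
    fix \<eta>
    have "h x \<eta> = fourier \<kappa> \<eta> * (exp (- (\<i> * of_real (x \<bullet> (\<xi> - \<eta>)))) * g x)" for x
    proof -
      have "exp (- (\<i> * of_real (x \<bullet> \<xi>))) * exp (\<i> * of_real (x \<bullet> \<eta>)) = exp (- (\<i> * of_real (x \<bullet> (\<xi> - \<eta>))))"
        by (simp add: exp_add[symmetric] inner_diff_right algebra_simps)
      then show ?thesis unfolding h_def by (simp add: mult_ac)
    qed
    then show "(LINT x|lborel. h x \<eta>) = fourier \<kappa> \<eta> * fourier g (\<xi> - \<eta>)"
      by (simp add: fourier_def)
  qed
  finally show ?thesis .
qed

section \<open>Uniform boundedness on test functions\<close>

text \<open>Baire's theorem in \<open>\<ell>\<^sup>\<infinity>\<close>, represented by the bounded continuous functions on the line sampled at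
  the natural numbers. Applied to a normalised sequence of test functions, it replaces the
  completeness of the Frechet space of test functions in the Banach--Steinhaus theorem.\<close>

lemma bounded_diagonal:
  fixes a :: "nat \<Rightarrow> nat \<Rightarrow> complex"
  assumes sm: "\<And>j. summable (\<lambda>k. cmod (a j k))"
    and pt: "\<And>s :: nat \<Rightarrow> real. bounded (range s) \<Longrightarrow> \<exists>M. \<forall>j. cmod (\<Sum>k. of_real (s k) * a j k) \<le> M"
  obtains M where "\<And>j. cmod (a j j) \<le> M"
proof -
  define X where "X = (\<lambda>j (s :: real \<Rightarrow>\<^sub>C real). \<Sum>k. of_real (s (real k)) * a j k)"
  have smX: "summable (\<lambda>k. of_real (apply_bcontfun s (real k)) * a j k)" for s j
  proof (rule summable_comparison_test')
    show "summable (\<lambda>k. norm s * cmod (a j k))"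
      using sm by (rule summable_mult)
    show "norm (of_real (apply_bcontfun s (real k)) * a j k) \<le> norm s * cmod (a j k)" for k
      using norm_bounded[of s "real k"] by (auto simp: norm_mult intro!: mult_right_mono)
  qed
  have diff: "X j (s + t) = X j s + X j t" for j s t
    unfolding X_def using suminf_add[OF smX smX, of s j t j] by (simp add: ring_distribs)
  have Xb: "cmod (X j s) \<le> norm s * (\<Sum>k. cmod (a j k))" for j s
  proof -
    have "cmod (X j s) \<le> (\<Sum>k. norm s * cmod (a j k))"
      unfolding X_def
      by (rule norm_suminf_le)
         (use sm norm_bounded[of s] in \<open>auto simp: norm_mult intro!: mult_right_mono summable_mult\<close>)
    then show ?thesis using sm by (simp add: suminf_mult)
  qed
  have lip: "dist (X j s) (X j t) \<le> (\<Sum>k. cmod (a j k)) * dist s t" for j s t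
  proof -
    have "X j s - X j t = X j (s - t)"
      using diff[of j "s - t" t] by simp
    then show ?thesis
      using Xb[of j "s - t"] by (simp add: dist_norm mult.commute)
  qed
  have cont: "continuous_on UNIV (X j)" for j
    by (rule lipschitz_on_continuous_on[of "\<Sum>k. cmod (a j k)"], rule lipschitz_onI)
       (use lip in \<open>auto intro: suminf_nonneg sm\<close>)
  \<comment> \<open>Pointwise boundedness says that these closed sets cover the space, so by Baire
    one of them contains a ball.\<close>
  define A where "A = (\<lambda>M :: nat. {s. \<forall>j. cmod (X j s) \<le> real M})"
  have clA: "closed (A M)" for M
    unfolding A_def by (intro closed_Collect_all closed_Collect_le continuous_intros cont)
  have "(\<Union>M. A M) = UNIV"
  proof (intro equalityI subset_UNIV subsetI)
    fix s :: "real \<Rightarrow>\<^sub>C real"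
    have "bounded (range (\<lambda>k. s (real k)))"
      by (rule bounded_subset[OF bounded_apply_bcontfun[of s]]) auto
    from pt[OF this] obtain M where "\<And>j. cmod (X j s) \<le> M"
      by (auto simp: X_def)
    then have "s \<in> A (nat \<lceil>M\<rceil>)"
      unfolding A_def by (auto intro: order_trans real_nat_ceiling_ge)
    then show "s \<in> (\<Union>M. A M)" by blast
  qed
  moreover have "euclidean interior_of \<Union>(range A) = {}" if "\<And>M. interior (A M) = {}"
    by (rule Baire_category_alt[OF disjI1[OF completely_metrizable_space_euclidean]]) (use that clA in auto)
  ultimately obtain M where "interior (A M) \<noteq> {}"
    by (metis interior_UNIV euclidean_interior_of UNIV_not_empty)
  then obtain s0 r where r: "r > 0" "ball s0 r \<subseteq> A M"
    using mem_interior by blast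
  have "cmod (a j j) \<le> 4 * real M / r" for j
  proof -
    \<comment> \<open>A tent of height \<open>r / 2\<close> and half-width \<open>1\<close> at
      \<open>j\<close> vanishes at all other natural numbers and so isolates the coordinate
      \<open>j\<close>; its norm keeps \<open>s0 + Bcontfun f\<close> inside the ball.\<close>
    define f where "f = (\<lambda>x :: real. r / 2 * max 0 (1 - \<bar>x - real j\<bar>))"
    have fb: "\<bar>f x\<bar> \<le> r / 2" for x
      using r(1) mult_left_mono[of "max 0 (1 - \<bar>x - real j\<bar>)" 1 "r / 2"] by (simp add: f_def abs_mult)
    have fk: "f (real k) = (if k = j then r / 2 else 0)" for k
      by (auto simp: f_def)
    have "continuous_on UNIV f"
      unfolding f_def by (intro continuous_intros)
    moreover have "bounded (range f)"
      unfolding bounded_iff using fb by (intro exI[of _ "r / 2"]) auto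
    ultimately have "f \<in> bcontfun"
      by (simp add: bcontfun_def)
    then have f: "apply_bcontfun (Bcontfun f) = f"
      by (rule Bcontfun_inverse)
    have "norm (Bcontfun f) \<le> r / 2"
      by (rule norm_bound) (use fb in \<open>simp add: f\<close>)
    then have "s0 + Bcontfun f \<in> ball s0 r" "s0 \<in> ball s0 r"
      using r by (auto simp: dist_norm)
    then have "s0 + Bcontfun f \<in> A M" "s0 \<in> A M"
      using r(2) by blast+
    then have "cmod (X j (s0 + Bcontfun f)) \<le> M" "cmod (X j s0) \<le> M"
      by (simp_all add: A_def)
    then have "cmod (X j (Bcontfun f)) \<le> 2 * M"
      using diff[of j s0 "Bcontfun f"] norm_triangle_ineq4[of "X j (s0 + Bcontfun f)" "X j s0"] by simp
    moreover have "X j (Bcontfun f) = of_real (r / 2) * a j j"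
    proof -
      have "X j (Bcontfun f) = (\<Sum>k. if k = j then of_real (r / 2) * a j j else 0)"
        unfolding X_def f fk by (intro suminf_cong) auto
      also have "\<dots> = of_real (r / 2) * a j j"
        using sums_single[of j "\<lambda>k. of_real (r / 2) * a j j"] sums_unique by metis
      finally show ?thesis .
    qed
    ultimately have "cmod (of_real (r / 2) * a j j) \<le> 2 * M"
      by (simp only:)
    then have "r / 2 * cmod (a j j) \<le> 2 * M"
      using r(1) unfolding norm_mult norm_of_real by simp
    then show ?thesis using r(1) by (simp add: field_simps)
  qed
  then show thesis using that by blast
qed

text \<open>Says that the \<open>C^m\<close> norm is at most \<open>B\<close>. As a predicate it
  makes sense before any supremum is known to be finite.\<close>

definition bounded_partials :: "nat \<Rightarrow> real \<Rightarrow> (real ^ 'd \<Rightarrow> complex) \<Rightarrow> bool" where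
  "bounded_partials m B \<theta> \<longleftrightarrow> (\<forall>is x. length is \<le> m \<longrightarrow> cmod (partials is \<theta> x) \<le> B)"

lemma bounded_partials_cmult:
  assumes "bounded_partials m B \<theta>" "\<theta> \<in> test_functions S"
  shows "bounded_partials m (cmod c * B) (\<lambda>x. c * \<theta> x)"
  using assms by (auto simp: bounded_partials_def partials_cmult[OF test_functionsD(1)] norm_mult intro!: mult_left_mono)

lemma bounded_partials_nonneg: "bounded_partials m B \<theta> \<Longrightarrow> 0 \<le> B"
  unfolding bounded_partials_def by (metis le0 list.size(3) norm_ge_zero order_trans)

text \<open>Continuity for a single \<open>C^m\<close> norm upgrades additivity to countable
  additivity on series with majorants: each tail \<open>R n\<close> is again a test function, its
  \<open>C^m\<close> norm tends to zero, and the values on the tails telescope.\<close>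

lemma functional_series:
  fixes \<phi> :: "nat \<Rightarrow> real ^ 'd \<Rightarrow> complex"
  assumes K: "compact K" and \<phi>: "\<And>k. \<phi> k \<in> test_functions K"
    and M: "\<And>is. summable (M is)" "\<And>is k x. cmod (partials is (\<phi> k) x) \<le> M is k"
    and add: "\<And>\<theta> \<psi>. \<theta> \<in> test_functions K \<Longrightarrow> \<psi> \<in> test_functions K \<Longrightarrow> L (\<lambda>x. \<theta> x + \<psi> x) = L \<theta> + L \<psi>"
    and cont: "\<And>\<theta> B. \<theta> \<in> test_functions K \<Longrightarrow> bounded_partials m B \<theta> \<Longrightarrow> cmod (L \<theta>) \<le> A * B"
  shows "summable (\<lambda>k. cmod (L (\<phi> k)))" and "(\<lambda>k. L (\<phi> k)) sums L (\<lambda>x. \<Sum>k. \<phi> k x)"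
proof -
  let ?I = "{is :: 'd list. length is \<le> m}"
  have fin: "finite ?I"
    using finite_lists_length_le[of "UNIV :: 'd set" m] by simp
  have M0: "0 \<le> M is k" for "is" k
    using M(2)[of "is" k 0] norm_ge_zero order_trans by blast
  have Msh: "summable (\<lambda>k. M is (k + n))" for "is" n
    using M(1) by (rule summable_ignore_initial_segment)
  \<comment> \<open>Summing the majorants over the finitely many lists of length at most
    \<open>m\<close> gives one bound for all of them.\<close>
  have b: "bounded_partials m (\<Sum>is\<in>?I. M is k) (\<phi> k)" for k
    unfolding bounded_partials_def
    by (intro allI impI order_trans[OF M(2)] member_le_sum) (auto simp: M0 fin)
  show "summable (\<lambda>k. cmod (L (\<phi> k)))"
  proof (rule summable_comparison_test')
    show "summable (\<lambda>k. A * (\<Sum>is\<in>?I. M is k))"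
      by (intro summable_mult summable_sum M)
    show "norm (cmod (L (\<phi> k))) \<le> A * (\<Sum>is\<in>?I. M is k)" for k
      using cont[OF \<phi> b] by simp
  qed
  define R where "R = (\<lambda>n x. \<Sum>k. \<phi> (k + n) x)"
  have R: "R n \<in> test_functions K" for n
    unfolding R_def
    by (rule test_functions_series[OF K, of _ "\<lambda>is k. M is (k + n)"]) (use \<phi> M Msh in auto)
  have smphi: "summable (\<lambda>k. \<phi> k x)" for x
    using M(2)[of "[]"] by (intro summable_comparison_test'[OF M(1)[of "[]"]]) auto
  have step: "R n = (\<lambda>x. \<phi> n x + R (Suc n) x)" for n
  proof
    fix x
    have "(\<Sum>k. \<phi> (Suc k + n) x) = (\<Sum>k. \<phi> (k + n) x) - \<phi> (0 + n) x"
      by (rule suminf_split_head) (rule summable_ignore_initial_segment[OF smphi])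
    then show "R n x = \<phi> n x + R (Suc n) x" by (simp add: R_def)
  qed
  have part: "L (R 0) = (\<Sum>k<n. L (\<phi> k)) + L (R n)" for n
  proof (induction n)
    case (Suc n)
    have "L (R n) = L (\<phi> n) + L (R (Suc n))"
      by (subst step) (rule add[OF \<phi> R])
    with Suc show ?case by simp
  qed simp
  have lim: "(\<lambda>n. L (R n)) \<longlonglongrightarrow> 0"
  proof (rule Lim_null_comparison)
    show "\<forall>\<^sub>F n in sequentially. cmod (L (R n)) \<le> A * (\<Sum>is\<in>?I. \<Sum>k. M is (k + n))"
    proof (intro always_eventually allI cont R)
      fix n
      show "bounded_partials m (\<Sum>is\<in>?I. \<Sum>k. M is (k + n)) (R n)"
        unfolding bounded_partials_def
      proof (intro allI impI)
        fix "is" :: "'d list" and x assume l: "length is \<le> m"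
        have "partials is (R n) = (\<lambda>x. \<Sum>k. partials is (\<phi> (k + n)) x)"
          unfolding R_def
          by (rule partials_series(1)[of _ "\<lambda>is k. M is (k + n)"]) (use \<phi> M Msh in \<open>auto intro: test_functionsD\<close>)
        then have "cmod (partials is (R n) x) \<le> (\<Sum>k. M is (k + n))"
          by (simp add: norm_suminf_le M Msh)
        also have "\<dots> \<le> (\<Sum>is\<in>?I. \<Sum>k. M is (k + n))"
          by (rule member_le_sum) (use l M0 fin Msh in \<open>auto intro!: suminf_nonneg\<close>)
        finally show "cmod (partials is (R n) x) \<le> (\<Sum>is\<in>?I. \<Sum>k. M is (k + n))" .
      qed
    qed
    have "(\<lambda>n. A * (\<Sum>is\<in>?I. \<Sum>k. M is (k + n))) \<longlonglongrightarrow> A * (\<Sum>is\<in>?I. 0)"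
      by (intro tendsto_intros suminf_exist_split2 M)
    then show "(\<lambda>n. A * (\<Sum>is\<in>?I. \<Sum>k. M is (k + n))) \<longlonglongrightarrow> 0" by simp
  qed
  have "(\<lambda>n. L (R 0) - L (R n)) \<longlonglongrightarrow> L (R 0) - 0"
    by (intro tendsto_intros lim)
  moreover have "L (R 0) - L (R n) = (\<Sum>k<n. L (\<phi> k))" for n
    using part[of n] by simp
  moreover have "R 0 = (\<lambda>x. \<Sum>k. \<phi> k x)"
    by (simp add: R_def)
  ultimately show "(\<lambda>k. L (\<phi> k)) sums L (\<lambda>x. \<Sum>k. \<phi> k x)"
    by (simp add: sums_def)
qed

text \<open>If no uniform bound exists, there are parameters \<open>e j\<close> tending to zero and
  test functions \<open>\<psi> j\<close> with \<open>C^j\<close> norm at most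
  \<open>(1/2) ^ j\<close> on which the functional exceeds \<open>j\<close>. For bounded
  coefficients \<open>s\<close>, the series of \<open>s k * \<psi> k\<close> is again a test
  function, so \<open>pt\<close> supplies the hypothesis of \<open>bounded_diagonal\<close>, which
  then bounds a diagonal that was built to be unbounded.\<close>

lemma banach_steinhaus_test_functions:
  fixes L :: "real \<Rightarrow> (real ^ 'd \<Rightarrow> complex) \<Rightarrow> complex"
  assumes K: "compact K"
    and add: "\<And>\<epsilon> \<theta> \<psi>. \<epsilon> \<in> {0<..<1} \<Longrightarrow> \<theta> \<in> test_functions K \<Longrightarrow> \<psi> \<in> test_functions K \<Longrightarrow>
        L \<epsilon> (\<lambda>x. \<theta> x + \<psi> x) = L \<epsilon> \<theta> + L \<epsilon> \<psi>"
    and cmult: "\<And>\<epsilon> \<theta> c. \<epsilon> \<in> {0<..<1} \<Longrightarrow> \<theta> \<in> test_functions K \<Longrightarrow> L \<epsilon> (\<lambda>x. c * \<theta> x) = c * L \<epsilon> \<theta>"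
    and cont: "\<And>\<epsilon>. \<epsilon> \<in> {0<..<1} \<Longrightarrow>
        \<exists>A m. \<forall>\<theta> B. \<theta> \<in> test_functions K \<longrightarrow> bounded_partials m B \<theta> \<longrightarrow> cmod (L \<epsilon> \<theta>) \<le> A * B"
    and pt: "\<And>\<theta>. \<theta> \<in> test_functions K \<Longrightarrow> \<exists>M. \<forall>\<^sub>F \<epsilon> in at_right 0. cmod (L \<epsilon> \<theta>) \<le> M"
  obtains C m \<epsilon>1 where "C > 0" "\<epsilon>1 \<in> {0<..<1}"
    "\<And>\<epsilon> \<theta> B. \<epsilon> \<in> {0<..<\<epsilon>1} \<Longrightarrow> \<theta> \<in> test_functions K \<Longrightarrow> bounded_partials m B \<theta> \<Longrightarrow> cmod (L \<epsilon> \<theta>) \<le> C * B"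
proof (rule ccontr)
  note conclude = that
  assume "\<not> thesis"
  then have neg: "\<exists>\<epsilon> \<theta> B. \<epsilon> \<in> {0<..<\<epsilon>1} \<and> \<theta> \<in> test_functions K \<and> bounded_partials m B \<theta> \<and> C * B < cmod (L \<epsilon> \<theta>)"
    if "C > 0" "\<epsilon>1 \<in> {0<..<1}" for C m \<epsilon>1
    using that conclude[of C \<epsilon>1 m] by (meson not_less)
  have "\<forall>j. \<exists>\<epsilon> \<psi>. \<epsilon> \<in> {0<..<1 / real (j + 2)} \<and> \<psi> \<in> test_functions K \<and>
      bounded_partials j ((1/2) ^ j) \<psi> \<and> real j < cmod (L \<epsilon> \<psi>)"
  proof
    fix j :: nat
    \<comment> \<open>The shift by \<open>2\<close> keeps this bound below \<open>1\<close> already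
      for \<open>j = 0\<close>.\<close>
    have "1 / real (j + 2) \<in> {0<..<1}" by auto
    then obtain \<epsilon> \<theta> B where *: "\<epsilon> \<in> {0<..<1 / real (j + 2)}" "\<theta> \<in> test_functions K" "bounded_partials j B \<theta>"
        "(2 ^ j * real (j + 1)) * B < cmod (L \<epsilon> \<theta>)"
      using neg[of "2 ^ j * real (j + 1)" "1 / real (j + 2)" j] by auto
    have \<epsilon>1: "\<epsilon> \<in> {0<..<1}"
      using *(1) by (auto intro: less_trans[of _ "1 / real (j + 2)"])
    \<comment> \<open>Normalisation divides by \<open>B\<close>; \<open>B = 0\<close> would make
      \<theta> vanish, against the strict lower bound.\<close>
    have "B \<noteq> 0"
    proof
      assume "B = 0"
      then have "\<theta> = (\<lambda>x. 0 * \<theta> x)"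
        using *(3) by (force simp: bounded_partials_def dest: spec[of _ "[]"])
      then have "L \<epsilon> \<theta> = 0 * L \<epsilon> \<theta>"
        using cmult[OF \<epsilon>1 *(2), of 0] by metis
      with *(4) \<open>B = 0\<close> show False by simp
    qed
    with bounded_partials_nonneg[OF *(3)] have B: "B > 0" by simp
    define c where "c = (1/2) ^ j / B"
    have c: "c > 0" using B by (simp add: c_def)
    have "bounded_partials j (cmod (of_real c) * B) (\<lambda>x. of_real c * \<theta> x)"
      by (rule bounded_partials_cmult[OF *(3,2)])
    moreover have "cmod (of_real c) * B = (1/2) ^ j"
      using B c unfolding norm_of_real by (simp add: c_def)
    ultimately have "bounded_partials j ((1/2) ^ j) (\<lambda>x. of_real c * \<theta> x)"
      by simp
    moreover have "real j < cmod (L \<epsilon> (\<lambda>x. of_real c * \<theta> x))"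
    proof -
      have "real j < c * ((2 ^ j * real (j + 1)) * B)"
        using B by (simp add: c_def power_one_over)
      also have "\<dots> < c * cmod (L \<epsilon> \<theta>)"
        using *(4) c by (rule mult_strict_left_mono)
      also have "\<dots> = cmod (L \<epsilon> (\<lambda>x. of_real c * \<theta> x))"
        using cmult[OF \<epsilon>1 *(2), of "of_real c"] c by (simp add: norm_mult)
      finally show ?thesis .
    qed
    ultimately show "\<exists>\<epsilon> \<psi>. \<epsilon> \<in> {0<..<1 / real (j + 2)} \<and> \<psi> \<in> test_functions K \<and>
      bounded_partials j ((1/2) ^ j) \<psi> \<and> real j < cmod (L \<epsilon> \<psi>)"
      using *(1) test_functions_cmult[OF *(2)] by blast
  qed
  then obtain e \<psi> where e: "\<And>j. e j \<in> {0<..<1 / real (j + 2)}" and \<psi>: "\<And>j. \<psi> j \<in> test_functions K"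
    and \<psi>b: "\<And>j. bounded_partials j ((1/2) ^ j) (\<psi> j)" and big: "\<And>j. real j < cmod (L (e j) (\<psi> j))"
    by metis
  have e1: "e j \<in> {0<..<1}" for j
    using e[of j] by (auto intro: less_trans[of _ "1 / real (j + 2)"])
  have "\<forall>is j. \<exists>b. \<forall>x. cmod (partials is (\<psi> j) x) \<le> b"
    using test_functions_bounded[OF \<psi>] by metis
  then obtain b where b: "\<And>is j x. cmod (partials is (\<psi> j) x) \<le> b is j"
    by metis
  \<comment> \<open>From \<open>j = length is\<close> on, the \<open>C^j\<close> norm controls this
    partial and gives a geometric series; the finitely many earlier terms may be arbitrary.\<close>
  define M where "M = (\<lambda>is j. if length is \<le> j then (1/2) ^ j else b is j)"
  have M: "summable (M is)" for "is"
  proof -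
    have "eventually (\<lambda>j. M is j = (1/2) ^ j) sequentially"
      unfolding M_def eventually_sequentially by (intro exI[of _ "length is"]) auto
    then show ?thesis by (subst summable_cong) (auto intro: summable_geometric)
  qed
  have Mb: "cmod (partials is (\<psi> j) x) \<le> M is j" for "is" j x
    using \<psi>b[of j] b[of "is" j x] by (auto simp: M_def bounded_partials_def)
  define a where "a = (\<lambda>j k. L (e j) (\<psi> k))"
  have "\<exists>M. \<forall>j. cmod (a j j) \<le> M"
  proof (rule bounded_diagonal[of a])
    fix j
    obtain A m where Am: "\<And>\<theta> B. \<theta> \<in> test_functions K \<Longrightarrow> bounded_partials m B \<theta> \<Longrightarrow> cmod (L (e j) \<theta>) \<le> A * B"
      using cont[OF e1] by metis
    show "summable (\<lambda>k. cmod (a j k))"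
      unfolding a_def by (rule functional_series(1)[OF K \<psi> M Mb add[OF e1] Am])
  next
    fix s :: "nat \<Rightarrow> real" assume "bounded (range s)"
    then obtain S where S: "\<And>k. \<bar>s k\<bar> \<le> S"
      by (auto simp: bounded_iff)
    define \<phi> where "\<phi> = (\<lambda>k x. of_real (s k) * \<psi> k x)"
    have \<phi>: "\<phi> k \<in> test_functions K" for k
      unfolding \<phi>_def by (rule test_functions_cmult[OF \<psi>])
    have M': "summable (\<lambda>k. S * M is k)" for "is"
      using M by (rule summable_mult)
    have Mb': "cmod (partials is (\<phi> k) x) \<le> S * M is k" for "is" k x
      unfolding \<phi>_def partials_cmult[OF test_functionsD(1)[OF \<psi>]] norm_mult norm_of_real
      using S[of k] by (intro mult_mono Mb) auto
    have sum: "(\<Sum>k. of_real (s k) * a j k) = L (e j) (\<lambda>x. \<Sum>k. \<phi> k x)" for j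
    proof -
      obtain A m where Am: "\<And>\<theta> B. \<theta> \<in> test_functions K \<Longrightarrow> bounded_partials m B \<theta> \<Longrightarrow> cmod (L (e j) \<theta>) \<le> A * B"
        using cont[OF e1] by metis
      have "(\<lambda>k. L (e j) (\<phi> k)) sums L (e j) (\<lambda>x. \<Sum>k. \<phi> k x)"
        by (rule functional_series(2)[OF K \<phi> M' Mb' add[OF e1] Am])
      then show ?thesis
        unfolding \<phi>_def cmult[OF e1 \<psi>] a_def by (simp add: sums_iff)
    qed
    have "(\<lambda>x. \<Sum>k. \<phi> k x) \<in> test_functions K"
      by (rule test_functions_series[OF K \<phi> M' Mb'])
    from pt[OF this] obtain B where B: "\<forall>\<^sub>F \<epsilon> in at_right 0. cmod (L \<epsilon> (\<lambda>x. \<Sum>k. \<phi> k x)) \<le> B" by blast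
    have "filterlim e (at_right 0) sequentially"
      unfolding filterlim_at
    proof
      show "\<forall>\<^sub>F j in sequentially. e j \<in> {0<..} \<and> e j \<noteq> 0"
        using e by (intro always_eventually) (auto simp: less_le)
      show "e \<longlonglongrightarrow> 0"
      proof (rule tendsto_sandwich[of "\<lambda>_. 0" e _ "\<lambda>j. 1 / real (j + 2)"])
        show "(\<lambda>j. 1 / real (j + 2)) \<longlonglongrightarrow> 0"
          using LIMSEQ_ignore_initial_segment[OF lim_1_over_n] by blast
      qed (use e in \<open>auto intro!: always_eventually less_imp_le\<close>)
    qed
    from eventually_compose_filterlim[OF B this]
    obtain J where J: "\<And>j. j \<ge> J \<Longrightarrow> cmod (\<Sum>k. of_real (s k) * a j k) \<le> B"
      unfolding sum[symmetric] eventually_sequentially by blast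
    \<comment> \<open>Boundedness is known only for \<epsilon> near zero, that is for
      \<open>j \<ge> J\<close>; the finitely many remaining values are added to the bound.\<close>
    have "cmod (\<Sum>k. of_real (s k) * a j k) \<le> \<bar>B\<bar> + (\<Sum>j<J. cmod (\<Sum>k. of_real (s k) * a j k))" for j
    proof (cases "j < J")
      case True
      then have "cmod (\<Sum>k. of_real (s k) * a j k) \<le> (\<Sum>j<J. cmod (\<Sum>k. of_real (s k) * a j k))"
        by (intro member_le_sum) auto
      then show ?thesis by simp
    next
      case False
      then show ?thesis
        using J[of j] sum_nonneg[of "{..<J}" "\<lambda>j. cmod (\<Sum>k. of_real (s k) * a j k)"] by simp
    qed
    then show "\<exists>M. \<forall>j. cmod (\<Sum>k. of_real (s k) * a j k) \<le> M" by blast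
  qed blast
  then obtain N where "\<And>j. cmod (a j j) \<le> N" by blast
  moreover obtain j :: nat where "N < real j"
    using reals_Archimedean2 by blast
  ultimately show False
    using big[of j] unfolding a_def by (meson less_le_trans not_less less_trans less_irrefl)
qed

section \<open>Cut-off sequences\<close>

lemma distribution_continuous:
  fixes V :: "(real ^ 'd) set"
  assumes T: "distribution V T" and K: "compact K" "K \<subseteq> V"
  obtains A m where "A \<ge> 0"
    "\<And>\<theta> B. \<theta> \<in> test_functions K \<Longrightarrow> bounded_partials m B \<theta> \<Longrightarrow> cmod (T \<theta>) \<le> A * B"
proof -
  obtain C m where Cm: "\<And>\<theta>. \<theta> \<in> test_functions V \<Longrightarrow> supp \<theta> \<subseteq> K \<Longrightarrow>
      cmod (T \<theta>) \<le> C * (\<Sum>\<alpha> | mi_order \<alpha> \<le> m. SUP x. cmod (mderiv \<alpha> \<theta> x))"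
    using T K unfolding distribution_def by meson
  let ?N = "real (card {\<alpha> :: nat ^ 'd. mi_order \<alpha> \<le> m})"
  have "cmod (T \<theta>) \<le> \<bar>C\<bar> * ?N * B" if \<theta>: "\<theta> \<in> test_functions K" and B: "bounded_partials m B \<theta>" for \<theta> B
  proof -
    have b: "cmod (mderiv \<alpha> \<theta> x) \<le> B" if "mi_order \<alpha> \<le> m" for \<alpha> x
      using that B by (metis bounded_partials_def mderiv_partials)
    have sup: "0 \<le> (SUP x. cmod (mderiv \<alpha> \<theta> x))" "(SUP x. cmod (mderiv \<alpha> \<theta> x)) \<le> B" if "mi_order \<alpha> \<le> m" for \<alpha>
    proof -
      show "(SUP x. cmod (mderiv \<alpha> \<theta> x)) \<le> B"
        by (rule cSUP_least) (use b that in auto)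
      have "cmod (mderiv \<alpha> \<theta> 0) \<le> (SUP x. cmod (mderiv \<alpha> \<theta> x))"
        by (rule cSUP_upper) (use b that in \<open>auto intro!: bdd_aboveI[of _ B]\<close>)
      then show "0 \<le> (SUP x. cmod (mderiv \<alpha> \<theta> x))"
        using norm_ge_zero order_trans by blast
    qed
    have "\<theta> \<in> test_functions V" "supp \<theta> \<subseteq> K"
      using \<theta> K test_functions_mono test_functionsD(3) by blast+
    from Cm[OF this] have "cmod (T \<theta>) \<le> C * (\<Sum>\<alpha> | mi_order \<alpha> \<le> m. SUP x. cmod (mderiv \<alpha> \<theta> x))" .
    also have "\<dots> \<le> \<bar>C\<bar> * (\<Sum>\<alpha> | mi_order \<alpha> \<le> m. SUP x. cmod (mderiv \<alpha> \<theta> x))"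
      by (intro mult_right_mono sum_nonneg) (use sup in auto)
    also have "\<dots> \<le> \<bar>C\<bar> * (?N * B)"
      by (intro mult_left_mono sum_bounded_above) (use sup in auto)
    finally show ?thesis by (simp add: mult.assoc)
  qed
  then show thesis using that[of "\<bar>C\<bar> * ?N" m] by simp
qed

section \<open>Admissible cut-offs and the decay of their transforms\<close>

lemma mi_order_axis [simp]: "mi_order (axis i k) = k"
  by (simp add: mi_order_def axis_def if_distrib cong: if_cong)

lemma mi_order_0 [simp]: "mi_order 0 = 0"
  by (simp add: mi_order_def)

lemma axis_add: "axis i (j :: nat) + axis i k = axis i (j + k)"
  by (simp add: vec_eq_iff axis_def)

lemma admissible_cutoff_mono: "admissible_cutoff S x0 W U \<kappa> \<Longrightarrow> S \<subseteq> S' \<Longrightarrow> admissible_cutoff S' x0 W U \<kappa>"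
  unfolding admissible_cutoff_def compactly_inside_def by blast

lemma admissible_cutoff_test_functions:
  assumes "admissible_cutoff S x0 W U \<kappa>" "n \<ge> 1"
  shows "\<kappa> n \<in> test_functions U" "\<kappa> n \<in> test_functions (closure U)"
proof -
  show "\<kappa> n \<in> test_functions U"
    using assms by (auto simp: admissible_cutoff_def)
  then show "\<kappa> n \<in> test_functions (closure U)"
    using test_functions_mono closure_subset by blast
qed

text \<open>At index \<open>k * n\<close> the estimates hold for at least the derivatives that index
  \<open>n\<close> demands, and the extra factor \<open>k\<close> in the base goes into the
  constant. Such subsequences let decay of order \<open>k * n\<close> be traded for decay of order
  \<open>n\<close>.\<close>

lemma admissible_cutoff_subsequence:
  fixes x0 :: "real ^ 'd"
  assumes \<kappa>: "admissible_cutoff S x0 W U \<kappa>" and k: "k \<ge> 1"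
  shows "admissible_cutoff S x0 W U (\<lambda>n. \<kappa> (k * n))"
  unfolding admissible_cutoff_def
proof (intro conjI allI impI)
  fix \<alpha> :: "nat ^ 'd"
  obtain C where C: "C > 0" "\<And>n \<beta> x. n \<ge> 1 \<Longrightarrow> mi_order \<beta> \<le> n \<Longrightarrow>
      cmod (mderiv (\<alpha> + \<beta>) (\<kappa> n) x) \<le> C * (C * real n) ^ mi_order \<beta>"
    using \<kappa> unfolding admissible_cutoff_def by meson
  show "\<exists>C>0. \<forall>n\<ge>1. \<forall>\<beta> x. mi_order \<beta> \<le> n \<longrightarrow>
        cmod (mderiv (\<alpha> + \<beta>) (\<kappa> (k * n)) x) \<le> C * (C * real n) ^ mi_order \<beta>"
  proof (intro exI[of _ "C * real k"] conjI allI impI)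
    fix n and \<beta> :: "nat ^ 'd" and x assume n: "1 \<le> n" "mi_order \<beta> \<le> n"
    have "n \<le> k * n" using k by simp
    then have "cmod (mderiv (\<alpha> + \<beta>) (\<kappa> (k * n)) x) \<le> C * (C * real (k * n)) ^ mi_order \<beta>"
      using n by (intro C(2)) linarith+
    also have "\<dots> \<le> (C * real k) * (C * real (k * n)) ^ mi_order \<beta>"
      using k C(1) by (intro mult_right_mono) auto
    finally show "cmod (mderiv (\<alpha> + \<beta>) (\<kappa> (k * n)) x) \<le> (C * real k) * (C * real k * real n) ^ mi_order \<beta>"
      by (simp add: mult.assoc)
  qed (use C k in auto)
next
  fix n :: nat assume "1 \<le> n"
  then have "k * n \<ge> 1" using k by simp
  then show "\<kappa> (k * n) \<in> test_functions U" "\<forall>x\<in>W. \<kappa> (k * n) x = 1"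
    using \<kappa> unfolding admissible_cutoff_def by auto
qed (use \<kappa> in \<open>auto simp: admissible_cutoff_def\<close>)

text \<open>A homothety centred at \<open>x0\<close> compresses the supports into a small ball.
  Derivatives grow by one factor \<open>c\<close> per order; the part belonging to \<beta> is
  geometric and is absorbed in the base of the admissible bound, the part belonging to \<alpha> in
  its prefactor.\<close>

lemma admissible_cutoff_shrink:
  fixes x0 :: "real ^ 'd"
  assumes \<kappa>: "admissible_cutoff S x0 W U \<kappa>" and G: "open G" "x0 \<in> G"
  obtains W' U' \<kappa>' where "admissible_cutoff G x0 W' U' \<kappa>'"
proof -
  have W: "open W" "x0 \<in> W" "compact (closure W)" "closure W \<subseteq> U" and U: "open U" "compact (closure U)"
    using \<kappa> by (auto simp: admissible_cutoff_def compactly_inside_def)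
  obtain r where r: "r > 0" "cball x0 r \<subseteq> G"
    using G open_contains_cball by blast
  obtain R where R: "R > 0" "\<And>x. x \<in> closure U \<Longrightarrow> dist x0 x \<le> R"
    using compact_imp_bounded[OF U(2)] bounded_any_center[of "closure U" x0]
    by (metis (no_types) less_max_iff_disj max.coboundedI1 zero_less_one)
  \<comment> \<open>\<open>R / r\<close> squeezes a ball of radius \<open>R\<close> into one of
    radius \<open>r\<close>; the maximum with \<open>1\<close> makes the powers of \<open>c\<close>
    increasing.\<close>
  define c where "c = max 1 (R / r)"
  have c: "c \<ge> 1" "R \<le> c * r"
    using r(1) by (auto simp: c_def field_simps max_def)
  define \<phi> where "\<phi> = (\<lambda>x. x0 + c *\<^sub>R (x - x0))"
  define \<psi> where "\<psi> = (\<lambda>y. x0 + (1 / c) *\<^sub>R (y - x0))"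
  have inv: "\<phi> (\<psi> y) = y" "\<psi> (\<phi> x) = x" for x y
    using c by (auto simp: \<phi>_def \<psi>_def)
  have vimage: "\<phi> -` A = \<psi> ` A" for A
    using inv by (auto simp: image_iff) metis
  have cont: "continuous_on A \<phi>" "continuous_on A \<psi>" for A
    unfolding \<phi>_def \<psi>_def by (intro continuous_intros)+
  have clos: "compact (closure (\<psi> ` A))" "closure (\<psi> ` A) \<subseteq> \<psi> ` closure A" if "compact (closure A)" for A
  proof -
    have cp: "compact (\<psi> ` closure A)"
      using compact_continuous_image[OF cont(2) that] .
    show cl: "closure (\<psi> ` A) \<subseteq> \<psi> ` closure A"
      by (rule closure_minimal) (use cp closure_subset[of A] in \<open>auto simp: compact_imp_closed\<close>)
    show "compact (closure (\<psi> ` A))"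
      using compact_Int_closed[OF cp closed_closure[of "\<psi> ` A"]] cl by (simp add: Int_absorb1)
  qed
  have "admissible_cutoff G x0 (\<phi> -` W) (\<phi> -` U) (\<lambda>n x. \<kappa> n (\<phi> x))"
    unfolding admissible_cutoff_def compactly_inside_def
  proof (intro conjI allI impI)
    show "open (\<phi> -` W)" "open (\<phi> -` U)"
      using W U cont by (auto intro: open_vimage)
    show "x0 \<in> \<phi> -` W"
      using W by (simp add: \<phi>_def)
    show "compact (closure (\<phi> -` W))" "compact (closure (\<phi> -` U))"
      using clos W U by (auto simp: vimage)
    show "closure (\<phi> -` W) \<subseteq> \<phi> -` U"
      using clos(2)[OF W(3)] W(4) unfolding vimage by blast
    have "\<psi> ` closure U \<subseteq> cball x0 r"
    proof safe
      fix y assume "y \<in> closure U"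
      then have "norm (y - x0) \<le> c * r"
        using R(2)[of y] c by (simp add: dist_norm norm_minus_commute)
      then show "\<psi> y \<in> cball x0 r"
        using c by (simp add: \<psi>_def dist_norm divide_le_eq mult.commute)
    qed
    then show "closure (\<phi> -` U) \<subseteq> G"
      using clos(2)[OF U(2)] r(2) unfolding vimage by blast
  next
    fix n :: nat assume n: "1 \<le> n"
    have \<kappa>n: "\<kappa> n \<in> test_functions U"
      using \<kappa> n by (simp add: admissible_cutoff_def)
    show "(\<lambda>x. \<kappa> n (\<phi> x)) \<in> test_functions (\<phi> -` U)"
    proof (rule test_functionsI)
      show "smooth_on UNIV (\<lambda>x. \<kappa> n (\<phi> x))"
        unfolding \<phi>_def by (rule smooth_on_rescale[OF test_functionsD(1)[OF \<kappa>n]])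
      show "compact (\<psi> ` supp (\<kappa> n))"
        using compact_continuous_image[OF cont(2)] test_functionsD(2)[OF \<kappa>n] by blast
      show "\<psi> ` supp (\<kappa> n) \<subseteq> \<phi> -` U"
        using test_functionsD(3)[OF \<kappa>n] by (auto simp: inv)
      show "\<kappa> n (\<phi> x) = 0" if "x \<notin> \<psi> ` supp (\<kappa> n)" for x
        using that not_in_supp[of "\<phi> x" "\<kappa> n"] inv by (metis imageI)
    qed
    show "\<forall>x\<in>\<phi> -` W. \<kappa> n (\<phi> x) = 1"
      using \<kappa> n by (simp add: admissible_cutoff_def)
  next
    fix \<alpha> :: "nat ^ 'd"
    obtain C where C: "C > 0" "\<And>n \<beta> x. n \<ge> 1 \<Longrightarrow> mi_order \<beta> \<le> n \<Longrightarrow>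
        cmod (mderiv (\<alpha> + \<beta>) (\<kappa> n) x) \<le> C * (C * real n) ^ mi_order \<beta>"
      using \<kappa> unfolding admissible_cutoff_def by meson
    \<comment> \<open>One constant has to serve as prefactor, where
      \<open>C * c ^ mi_order \<alpha>\<close> is wanted, and as base, where \<open>C * c\<close> is
      wanted; this power dominates both.\<close>
    define E where "E = C * c ^ Suc (mi_order \<alpha>)"
    have cc: "c \<le> c ^ Suc (mi_order \<alpha>)" "c ^ mi_order \<alpha> \<le> c ^ Suc (mi_order \<alpha>)"
      using c(1) power_increasing[of 1 "Suc (mi_order \<alpha>)" c] power_increasing[of "mi_order \<alpha>" "Suc (mi_order \<alpha>)" c]
      by auto
    show "\<exists>C>0. \<forall>n\<ge>1. \<forall>\<beta> x. mi_order \<beta> \<le> n \<longrightarrow>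
        cmod (mderiv (\<alpha> + \<beta>) (\<lambda>x. \<kappa> n (\<phi> x)) x) \<le> C * (C * real n) ^ mi_order \<beta>"
    proof (intro exI[of _ E] conjI allI impI)
      show "E > 0" using C c by (simp add: E_def)
      fix n and \<beta> :: "nat ^ 'd" and x assume n: "1 \<le> n" "mi_order \<beta> \<le> n"
      have sm: "smooth_on UNIV (\<kappa> n)"
        using \<kappa> n test_functionsD(1) by (fastforce simp: admissible_cutoff_def)
      obtain "is" where list: "length is = mi_order (\<alpha> + \<beta>)" "\<And>f. mderiv (\<alpha> + \<beta>) f = partials is f"
        using mderiv_partials by metis
      have "mi_order (\<alpha> + \<beta>) = mi_order \<alpha> + mi_order \<beta>"
        by (simp add: mi_order_def sum.distrib)
      then have "cmod (mderiv (\<alpha> + \<beta>) (\<lambda>x. \<kappa> n (\<phi> x)) x) = c ^ mi_order \<alpha> * c ^ mi_order \<beta> * cmod (mderiv (\<alpha> + \<beta>) (\<kappa> n) (\<phi> x))"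
        using c unfolding list(2) \<phi>_def partials_rescale[OF sm] by (simp add: norm_mult norm_power list(1) power_add)
      also have "\<dots> \<le> c ^ mi_order \<alpha> * c ^ mi_order \<beta> * (C * (C * real n) ^ mi_order \<beta>)"
        using c n by (intro mult_left_mono C(2)) auto
      also have "\<dots> = (C * c ^ mi_order \<alpha>) * (C * c * real n) ^ mi_order \<beta>"
        by (simp add: power_mult_distrib)
      also have "\<dots> \<le> E * (E * real n) ^ mi_order \<beta>"
        unfolding E_def using C c cc by (intro mult_mono power_mono) auto
      finally show "cmod (mderiv (\<alpha> + \<beta>) (\<lambda>x. \<kappa> n (\<phi> x)) x) \<le> E * (E * real n) ^ mi_order \<beta>" .
    qed
  qed
  then show thesis by (rule that)
qed

text \<open>Here \<alpha> is spent on a fixed number \<open>M\<close> of derivatives and \<beta> on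
  the \<open>k \<le> n\<close> whose number grows with \<open>n\<close>, both along the same axis.
  Only \<open>\<alpha> = 0\<close> and \<open>\<alpha> = axis i M\<close> occur, so finitely many
  constants are added up.\<close>

lemma admissible_cutoff_bound:
  fixes x0 :: "real ^ 'd"
  assumes \<kappa>: "admissible_cutoff S x0 W U \<kappa>"
  obtains C where "C \<ge> 1"
    "\<And>n x. n \<ge> 1 \<Longrightarrow> cmod (\<kappa> n x) \<le> C"
    "\<And>n i k x. n \<ge> 1 \<Longrightarrow> k \<le> n \<Longrightarrow> cmod (partials (replicate (k + M) i) (\<kappa> n) x) \<le> C * (C * real n) ^ k"
proof -
  have "\<forall>\<alpha>. \<exists>C>0. \<forall>n \<beta> x. n \<ge> 1 \<longrightarrow> mi_order \<beta> \<le> n \<longrightarrow>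
        cmod (mderiv (\<alpha> + \<beta>) (\<kappa> n) x) \<le> C * (C * real n) ^ mi_order \<beta>"
    using \<kappa> unfolding admissible_cutoff_def by meson
  then obtain c where c: "\<And>\<alpha>. c \<alpha> > 0" "\<And>\<alpha> n \<beta> x. n \<ge> 1 \<Longrightarrow> mi_order \<beta> \<le> n \<Longrightarrow>
        cmod (mderiv (\<alpha> + \<beta>) (\<kappa> n) x) \<le> c \<alpha> * (c \<alpha> * real n) ^ mi_order \<beta>"
    by metis
  define C where "C = 1 + c 0 + (\<Sum>i\<in>UNIV. c (axis i M))"
  have s: "0 \<le> (\<Sum>i\<in>UNIV. c (axis i M))"
    using c(1) by (intro sum_nonneg) (auto intro: less_imp_le)
  show thesis
  proof (rule that)
    show "C \<ge> 1" using s c(1)[of 0] by (simp add: C_def)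
    fix n :: nat assume n: "n \<ge> 1"
    show "cmod (\<kappa> n x) \<le> C" for x
      using c(2)[OF n, of 0 0 x] s by (simp add: C_def)
    fix i k x assume k: "k \<le> n"
    have ci: "c (axis i M) \<le> C"
      using member_le_sum[of i UNIV "\<lambda>i. c (axis i M)"] c(1) unfolding C_def by (smt (verit) UNIV_I finite)
    have "cmod (partials (replicate (k + M) i) (\<kappa> n) x) \<le> c (axis i M) * (c (axis i M) * real n) ^ k"
      using c(2)[OF n, of "axis i k" "axis i M" x] k by (simp add: axis_add mderiv_axis add.commute)
    also have "\<dots> \<le> C * (C * real n) ^ k"
      using ci c(1)[of "axis i M"] by (intro mult_mono power_mono) auto
    finally show "cmod (partials (replicate (k + M) i) (\<kappa> n) x) \<le> C * (C * real n) ^ k" .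
  qed
qed

text \<open>The two estimates are the cases \<open>k = 0\<close> and \<open>k = n\<close> of one
  bound. The \<open>M\<close> additional powers cost only a constant independent of
  \<open>n\<close>; they pay for integrability and for the derivatives that enter a seminorm of
  fixed order.\<close>

lemma admissible_cutoff_fourier_decay:
  fixes x0 :: "real ^ 'd"
  assumes \<kappa>: "admissible_cutoff S x0 W U \<kappa>"
  obtains A where "A \<ge> 1"
    "\<And>n \<eta>. n \<ge> 1 \<Longrightarrow> (1 + norm \<eta>) ^ M * cmod (fourier (\<kappa> n) \<eta>) \<le> A"
    "\<And>n \<eta>. n \<ge> 1 \<Longrightarrow> (1 + norm \<eta>) ^ (n + M) * cmod (fourier (\<kappa> n) \<eta>) \<le> A * (A * real n) ^ n"
proof -
  let ?K = "closure U" and ?d = "real CARD('d) + 1"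
  have K: "compact ?K"
    using \<kappa> by (simp add: admissible_cutoff_def compactly_inside_def)
  obtain C where C: "C \<ge> 1" "\<And>n x. n \<ge> 1 \<Longrightarrow> cmod (\<kappa> n x) \<le> C"
    "\<And>n i k x. n \<ge> 1 \<Longrightarrow> k \<le> n \<Longrightarrow> cmod (partials (replicate (k + M) i) (\<kappa> n) x) \<le> C * (C * real n) ^ k"
    using admissible_cutoff_bound[OF \<kappa>] by metis
  define A where "A = 1 + ?d * C + ?d ^ M * C * measure lborel ?K"
  have m: "0 \<le> ?d ^ M * C * measure lborel ?K"
    using C by simp
  have A: "1 \<le> A" "?d * C \<le> A" "?d ^ M * C * measure lborel ?K \<le> A"
    using m C mult_nonneg_nonneg[of ?d C] by (auto simp: A_def)
  have decay: "(1 + norm \<eta>) ^ (k + M) * cmod (fourier (\<kappa> n) \<eta>) \<le> A * (A * real n) ^ k"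
    if n: "n \<ge> 1" and k: "k \<le> n" for n k \<eta>
  proof -
    \<comment> \<open>\<open>fourier_decay\<close> wants a common bound for
      \<open>\<kappa> n\<close> and its derivatives, so the factor belonging to the derivatives must
      be at least \<open>1\<close>.\<close>
    have nk: "1 \<le> (C * real n) ^ k"
      using C n mult_mono[of 1 C 1 "real n"] by (intro one_le_power) auto
    have "(1 + norm \<eta>) ^ (k + M) * cmod (fourier (\<kappa> n) \<eta>) \<le> ?d ^ (k + M) * (C * (C * real n) ^ k) * measure lborel ?K"
    proof (rule fourier_decay[OF K admissible_cutoff_test_functions(2)[OF \<kappa> n]])
      show "cmod (\<kappa> n x) \<le> C * (C * real n) ^ k" for x
        using order_trans[OF C(2)[OF n, of x], of "C * (C * real n) ^ k"] mult_left_mono[OF nk, of C] C(1) by simp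
    qed (use C(3) n k in auto)
    also have "\<dots> = (?d ^ M * C * measure lborel ?K) * ((?d * C) * real n) ^ k"
      by (simp add: power_add power_mult_distrib)
    also have "\<dots> \<le> A * (A * real n) ^ k"
      using A C by (intro mult_mono power_mono) auto
    finally show ?thesis .
  qed
  show thesis
  proof (rule that[OF A(1)])
    show "(1 + norm \<eta>) ^ M * cmod (fourier (\<kappa> n) \<eta>) \<le> A" if "n \<ge> 1" for n \<eta>
      using decay[of n 0 \<eta>] that by simp
    show "(1 + norm \<eta>) ^ (n + M) * cmod (fourier (\<kappa> n) \<eta>) \<le> A * (A * real n) ^ n" if "n \<ge> 1" for n \<eta>
      using decay[of n n \<eta>] that by simp
  qed
qed

text \<open>The function \<open>f\<close> is meaningful on \<open>S\<close> only. The product is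
  continuous on \<open>S\<close> and zero on the complement of the support of \<theta>, and these
  two open sets cover the space.\<close>

lemma continuous_test_function_mult:
  fixes \<theta> f :: "real ^ 'd \<Rightarrow> complex"
  assumes \<theta>: "\<theta> \<in> test_functions S" and S: "open S" and f: "continuous_on S f"
  shows "continuous_on UNIV (\<lambda>x. \<theta> x * f x)" "compact (supp (\<lambda>x. \<theta> x * f x))"
    "integrable lborel (\<lambda>x. \<theta> x * f x)"
proof -
  have z: "\<theta> x = 0" if "x \<notin> supp \<theta>" for x
    using that by (rule not_in_supp)
  have cl: "closed (supp \<theta>)" by (simp add: supp_def)
  have "continuous_on (S \<union> - supp \<theta>) (\<lambda>x. \<theta> x * f x)"
  proof (rule continuous_on_open_Un)
    show "continuous_on S (\<lambda>x. \<theta> x * f x)"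
      using test_functionsD(4)[OF \<theta>] f by (intro continuous_intros) (auto intro: continuous_on_subset)
    show "continuous_on (- supp \<theta>) (\<lambda>x. \<theta> x * f x)"
      using z by (intro continuous_on_eq[OF continuous_on_const[of _ 0]]) auto
  qed (use S cl in auto)
  moreover have "S \<union> - supp \<theta> = UNIV"
    using test_functionsD(3)[OF \<theta>] by auto
  ultimately show c: "continuous_on UNIV (\<lambda>x. \<theta> x * f x)" by simp
  have "supp (\<lambda>x. \<theta> x * f x) \<subseteq> supp \<theta>"
    by (rule supp_subset[OF cl]) (simp add: z)
  then show k: "compact (supp (\<lambda>x. \<theta> x * f x))"
    using compact_Int_closed[OF test_functionsD(2)[OF \<theta>], of "supp (\<lambda>x. \<theta> x * f x)"]
    by (simp add: Int_absorb1 supp_def)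
  show "integrable lborel (\<lambda>x. \<theta> x * f x)"
    by (rule compact_supp_integrable[OF c k])
qed

text \<open>In the convolution, frequencies \<open>\<eta>\<close> of \<open>\<kappa>\<close> that are small compared with \<open>\<xi>\<close> keep \<open>\<xi> - \<eta>\<close>
  inside the cone where the transform of \<open>g\<close> decays; the others are damped by the decay of the
  transform of \<open>\<kappa>\<close>.\<close>

lemma fourier_mult_cone_bound:
  fixes \<kappa> g :: "real ^ 'd \<Rightarrow> complex"
  defines "D \<equiv> LINT \<eta>|lborel. 1 / (1 + norm (\<eta> :: real ^ 'd)) ^ (2 * CARD('d))"
  assumes \<kappa>: "\<kappa> \<in> test_functions S" and g: "integrable lborel g"
    and c: "0 < c" "c \<le> 1 / 2" and cone: "\<And>\<eta>. norm \<eta> \<le> c * norm \<xi> \<Longrightarrow> \<xi> - \<eta> \<in> \<Gamma>"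
    and P: "\<And>\<zeta>. cmod (fourier g \<zeta>) \<le> P"
    and Q: "\<And>\<zeta>. \<zeta> \<in> \<Gamma> \<Longrightarrow> cmod (fourier g \<zeta>) \<le> Q * (C * real n / (1 + norm \<zeta>)) ^ n"
    and A: "\<And>\<eta>. (1 + norm \<eta>) ^ (2 * CARD('d)) * cmod (fourier \<kappa> \<eta>) \<le> A"
      "\<And>\<eta>. (1 + norm \<eta>) ^ (n + 2 * CARD('d)) * cmod (fourier \<kappa> \<eta>) \<le> A * (A * real n) ^ n"
    and pos: "C \<ge> 0" "A \<ge> 0" "Q \<ge> 0"
    and E: "2 * C \<le> E" "A / c \<le> E"
  shows "cmod (fourier (\<lambda>x. \<kappa> x * g x) \<xi>) \<le> D * A * (P + Q) * (E * real n / (1 + norm \<xi>)) ^ n"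
proof -
  let ?w = "\<lambda>\<eta> :: real ^ 'd. 1 / (1 + norm \<eta>) ^ (2 * CARD('d))"
  let ?R = "1 + norm \<xi>"
  have P0: "P \<ge> 0"
    using P[of 0] norm_ge_zero order_trans by blast
  have np: "0 < 1 + norm \<eta>" for \<eta> :: "real ^ 'd"
    by (simp add: add_pos_nonneg)
  have E0: "E \<ge> 0" using E pos by linarith
  let ?B = "A * (P + Q) * (E * real n / ?R) ^ n"
  have pw: "cmod (fourier \<kappa> \<eta> * fourier g (\<xi> - \<eta>)) \<le> ?B * ?w \<eta>" for \<eta>
  proof (cases "norm \<eta> \<le> c * norm \<xi>")
    case True
    have "norm \<eta> \<le> 1 / 2 * norm \<xi>"
      using True mult_right_mono[OF c(2), of "norm \<xi>"] by simp
    \<comment> \<open>Since \<open>c \<le> 1 / 2\<close>, subtracting such an \<eta> at most halves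
      the frequency; this is the origin of \<open>2 * C \<le> E\<close>.\<close>
    then have "?R \<le> 2 * (1 + norm (\<xi> - \<eta>))"
      using norm_triangle_ineq2[of \<xi> \<eta>] by simp
    then have "C * real n / (1 + norm (\<xi> - \<eta>)) \<le> 2 * C * real n / ?R"
      using pos mult_left_mono[of ?R "2 * (1 + norm (\<xi> - \<eta>))" "C * real n"] np[of "\<xi> - \<eta>"] np[of \<xi>]
      by (simp add: divide_simps mult_ac)
    also have "\<dots> \<le> E * real n / ?R"
      using E np[of \<xi>] by (intro divide_right_mono mult_right_mono) auto
    finally have "(C * real n / (1 + norm (\<xi> - \<eta>))) ^ n \<le> (E * real n / ?R) ^ n"
      using pos np[of "\<xi> - \<eta>"] by (intro power_mono) auto
    then have "cmod (fourier g (\<xi> - \<eta>)) \<le> Q * (E * real n / ?R) ^ n"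
      using Q[OF cone[OF True]] pos by (meson mult_left_mono order_trans)
    moreover have "cmod (fourier \<kappa> \<eta>) \<le> A * ?w \<eta>"
      using A(1)[of \<eta>] np[of \<eta>] by (simp add: pos_le_divide_eq mult.commute)
    ultimately have "cmod (fourier \<kappa> \<eta> * fourier g (\<xi> - \<eta>)) \<le> A * ?w \<eta> * (Q * (E * real n / ?R) ^ n)"
      unfolding norm_mult using pos np[of \<eta>] by (intro mult_mono) auto
    also have "\<dots> = A * Q * (E * real n / ?R) ^ n * ?w \<eta>" by simp
    also have "\<dots> \<le> ?B * ?w \<eta>"
      using pos P0 E0 np[of \<eta>] np[of \<xi>] by (intro mult_right_mono mult_left_mono) auto
    finally show ?thesis .
  next
    case False
    \<comment> \<open>Now \<eta> exceeds the fraction \<open>c\<close> of \<xi>, so decay in \<eta>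
      becomes decay in \<xi> at the price of \<open>1 / c\<close> per power; this is the origin of
      \<open>A / c \<le> E\<close>.\<close>
    then have "c * ?R \<le> 1 + norm \<eta>"
      using c by (simp add: distrib_left)
    then have le: "A * real n / (1 + norm \<eta>) \<le> E * real n / ?R"
    proof -
      have "A * real n / (1 + norm \<eta>) \<le> A * real n / (c * ?R)"
        using \<open>c * ?R \<le> 1 + norm \<eta>\<close> pos c np[of \<xi>] by (intro divide_left_mono) (auto intro!: mult_pos_pos np)
      also have "\<dots> = A / c * real n / ?R" by simp
      also have "\<dots> \<le> E * real n / ?R"
        using E np[of \<xi>] by (intro divide_right_mono mult_right_mono) auto
      finally show ?thesis .
    qed
    have "cmod (fourier \<kappa> \<eta>) \<le> A * (A * real n) ^ n / (1 + norm \<eta>) ^ (n + 2 * CARD('d))"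
      using A(2)[of \<eta>] np[of \<eta>] by (simp add: pos_le_divide_eq mult.commute)
    also have "\<dots> = A * (A * real n / (1 + norm \<eta>)) ^ n * ?w \<eta>"
      by (simp add: power_add power_divide)
    also have "\<dots> \<le> A * (E * real n / ?R) ^ n * ?w \<eta>"
      using le pos np[of \<eta>] by (intro mult_right_mono mult_left_mono power_mono) auto
    finally have "cmod (fourier \<kappa> \<eta> * fourier g (\<xi> - \<eta>)) \<le> (A * (E * real n / ?R) ^ n * ?w \<eta>) * P"
      unfolding norm_mult using P[of "\<xi> - \<eta>"] pos np[of \<eta>] np[of \<xi>] E0 by (intro mult_mono) auto
    also have "\<dots> = A * P * (E * real n / ?R) ^ n * ?w \<eta>" by simp
    also have "\<dots> \<le> ?B * ?w \<eta>"
      using pos P0 E0 np[of \<eta>] np[of \<xi>] by (intro mult_right_mono mult_left_mono) auto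
    finally show ?thesis .
  qed
  have wi: "integrable lborel ?w"
    using integrable_lborel_weight[where 'a="real ^ 'd"] by simp
  have "1 * cmod (fourier (\<lambda>x. \<kappa> x * g x) \<xi>) \<le> (2 * pi) ^ CARD('d) * cmod (fourier (\<lambda>x. \<kappa> x * g x) \<xi>)"
    using pi_gt3 by (intro mult_right_mono one_le_power) auto
  also have "\<dots> = cmod (of_real ((2 * pi) ^ CARD('d)) * fourier (\<lambda>x. \<kappa> x * g x) \<xi>)"
    by (simp add: norm_mult norm_power)
  also have "\<dots> = cmod (LINT \<eta>|lborel. fourier \<kappa> \<eta> * fourier g (\<xi> - \<eta>))"
    by (simp only: fourier_mult[OF \<kappa> g])
  also have "\<dots> \<le> (LINT \<eta>|lborel. cmod (fourier \<kappa> \<eta> * fourier g (\<xi> - \<eta>)))"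
    by (rule integral_norm_bound)
  also have "\<dots> \<le> (LINT \<eta>|lborel. ?B * ?w \<eta>)"
  proof (rule integral_mono')
    show "integrable lborel (\<lambda>\<eta>. ?B * ?w \<eta>)"
      using wi by (rule integrable_mult_right)
    show "0 \<le> ?B * ?w \<eta>" for \<eta>
      using pos P0 E0 np[of \<eta>] np[of \<xi>] by (intro mult_nonneg_nonneg zero_le_power) auto
  qed (rule pw)
  also have "\<dots> = ?B * D"
    unfolding D_def by (rule integral_mult_right_zero)
  finally show ?thesis by (simp add: mult_ac)
qed

section \<open>Nets and strong association\<close>

text \<open>By homogeneity it suffices to treat vectors near \<xi>0: the new cone is generated by a
  ball of half the radius, and a perturbation bounded by a fixed fraction of the norm does not leave
  the larger ball.\<close>

lemma open_cone_around_shrink: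
  fixes \<xi>0 :: "real ^ 'd"
  assumes \<Gamma>: "open_cone_around \<xi>0 \<Gamma>"
  obtains \<Gamma>' c where "open_cone_around \<xi>0 \<Gamma>'" "0 < c" "c \<le> 1 / 2"
    "\<And>\<xi> \<eta>. \<xi> \<in> \<Gamma>' \<Longrightarrow> norm \<eta> \<le> c * norm \<xi> \<Longrightarrow> \<xi> - \<eta> \<in> \<Gamma>"
proof -
  obtain s where s: "s > 0" "ball \<xi>0 s \<subseteq> \<Gamma>"
    using \<Gamma> open_contains_ball unfolding open_cone_around_def by metis
  define r where "r = s / 2"
  have r: "r > 0" "ball \<xi>0 (2 * r) \<subseteq> \<Gamma>"
    using s by (simp_all add: r_def)
  \<comment> \<open>Vectors of the smaller ball have norm at most \<open>norm \<xi>0 + r\<close>, so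
    a perturbation of relative size \<open>c\<close> has norm at most \<open>r\<close>. The cap
    \<open>1 / 2\<close> serves the convolution estimate.\<close>
  define c where "c = min (1 / 2) (r / (norm \<xi>0 + r))"
  define \<Gamma>' where "\<Gamma>' = (\<Union>t\<in>{0<..}. (\<lambda>x. t *\<^sub>R x) ` ball \<xi>0 r)"
  have "open_cone_around \<xi>0 \<Gamma>'"
    unfolding open_cone_around_def
  proof (intro conjI allI impI ballI)
    show "open \<Gamma>'"
      unfolding \<Gamma>'_def by (intro open_UN ballI open_scaling) auto
    show "\<xi>0 \<in> \<Gamma>'"
      unfolding \<Gamma>'_def using r by (auto intro!: bexI[of _ 1] image_eqI[of _ _ \<xi>0])
    fix t :: real and \<xi> assume t: "t > 0" "\<xi> \<in> \<Gamma>'"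
    then obtain u x where "u > 0" "\<xi> = u *\<^sub>R x" "x \<in> ball \<xi>0 r"
      unfolding \<Gamma>'_def by blast
    then show "t *\<^sub>R \<xi> \<in> \<Gamma>'"
      unfolding \<Gamma>'_def using t by (auto intro!: bexI[of _ "t * u"])
  qed
  moreover have "0 < c"
    using r by (auto simp: c_def intro!: divide_pos_pos add_nonneg_pos)
  moreover have "c \<le> 1 / 2"
    unfolding c_def by (rule min.cobounded1)
  moreover have "\<xi> - \<eta> \<in> \<Gamma>" if \<xi>: "\<xi> \<in> \<Gamma>'" and \<eta>: "norm \<eta> \<le> c * norm \<xi>" for \<xi> \<eta>
  proof -
    obtain t x where t: "t > 0" "\<xi> = t *\<^sub>R x" "x \<in> ball \<xi>0 r"
      using \<xi> unfolding \<Gamma>'_def by blast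
    have xr: "norm (x - \<xi>0) < r"
      using t by (simp add: dist_norm norm_minus_commute)
    then have "norm x \<le> norm \<xi>0 + r"
      using norm_triangle_ineq2[of x \<xi>0] by simp
    then have "c * norm x \<le> r / (norm \<xi>0 + r) * (norm \<xi>0 + r)"
      using r by (intro mult_mono) (auto simp: c_def)
    then have "c * norm x \<le> r"
      using r norm_ge_zero[of \<xi>0] by (simp add: add_nonneg_eq_0_iff split: if_splits)
    moreover have "norm ((1 / t) *\<^sub>R \<eta>) \<le> c * norm x"
      using \<eta> t(1) by (simp add: t(2) field_simps)
    moreover have "dist \<xi>0 (x - (1 / t) *\<^sub>R \<eta>) \<le> norm (x - \<xi>0) + norm ((1 / t) *\<^sub>R \<eta>)"
      using norm_triangle_ineq4[of "x - \<xi>0" "(1 / t) *\<^sub>R \<eta>"]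
      by (simp add: dist_norm norm_minus_commute algebra_simps)
    ultimately have "dist \<xi>0 (x - (1 / t) *\<^sub>R \<eta>) < 2 * r"
      using xr by linarith
    then have "x - (1 / t) *\<^sub>R \<eta> \<in> \<Gamma>"
      using r by auto
    then have "t *\<^sub>R (x - (1 / t) *\<^sub>R \<eta>) \<in> \<Gamma>"
      using \<Gamma> t(1) unfolding open_cone_around_def by blast
    then show ?thesis
      using t by (simp add: scaleR_diff_right)
  qed
  ultimately show thesis by (rule that)
qed

section \<open>Representatives of Colombeau classes and the association error\<close>

lemma colombeau_representative_moderate:
  assumes "F \<in> colombeau S" "f \<in> F"
  shows "f \<in> moderate_nets S"
  using assms by (auto simp: colombeau_def colombeau_rel_def quotient_def)

lemma moderate_nets_smooth_on: "f \<in> moderate_nets S \<Longrightarrow> \<epsilon> \<in> {0<..<1} \<Longrightarrow> smooth_on S (f \<epsilon>)"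
  by (simp add: moderate_nets_def smooth_nets_def)

lemma null_nets_sup_bigo:
  assumes "f \<in> null_nets S" "compact K" "K \<subseteq> S"
  shows "sup_bigo K f b"
proof -
  have "sup_bigo K (\<lambda>\<epsilon>. mderiv 0 (f \<epsilon>)) b"
    using assms unfolding null_nets_def by blast
  then show ?thesis by simp
qed

lemma moderate_nets_sup_bigo:
  assumes "f \<in> moderate_nets S" "compact K" "K \<subseteq> S"
  obtains b where "sup_bigo K f b"
proof -
  have "\<exists>b. sup_bigo K (\<lambda>\<epsilon>. mderiv 0 (f \<epsilon>)) b"
    using assms unfolding moderate_nets_def by blast
  then show thesis using that by auto
qed

lemma sup_bigo_add:
  assumes "sup_bigo K f b" "sup_bigo K g b"
  shows "sup_bigo K (\<lambda>\<epsilon> x. f \<epsilon> x + g \<epsilon> x) b"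
proof -
  obtain C D where "\<forall>\<^sub>F \<epsilon> in at_right 0. \<forall>x\<in>K. cmod (f \<epsilon> x) \<le> C * \<epsilon> powr b"
    "\<forall>\<^sub>F \<epsilon> in at_right 0. \<forall>x\<in>K. cmod (g \<epsilon> x) \<le> D * \<epsilon> powr b"
    using assms unfolding sup_bigo_def by blast
  then have "\<forall>\<^sub>F \<epsilon> in at_right 0. \<forall>x\<in>K. cmod (f \<epsilon> x + g \<epsilon> x) \<le> (C + D) * \<epsilon> powr b"
  proof eventually_elim
    case (elim \<epsilon>)
    show ?case
    proof
      fix x assume "x \<in> K"
      then have "cmod (f \<epsilon> x) \<le> C * \<epsilon> powr b" "cmod (g \<epsilon> x) \<le> D * \<epsilon> powr b"
        using elim by auto
      then show "cmod (f \<epsilon> x + g \<epsilon> x) \<le> (C + D) * \<epsilon> powr b"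
        using norm_triangle_ineq[of "f \<epsilon> x" "g \<epsilon> x"] by (simp add: distrib_right)
    qed
  qed
  then show ?thesis unfolding sup_bigo_def by blast
qed

lemma sup_bigo_uminus: "sup_bigo K (\<lambda>\<epsilon> x. - f \<epsilon> x) b = sup_bigo K f b"
  by (simp add: sup_bigo_def)

text \<open>The known relations emanate from a generator \<open>g0\<close> of the class and from the
  member \<open>h0\<close> that is related to \<open>h\<close> over \<open>V\<close>; the difference
  telescopes through these two. Negligibility permits any exponent \<open>b\<close>.\<close>

lemma restrict_representative_diff:
  assumes F: "F \<in> colombeau S" "f \<in> F" and h: "h \<in> colombeau_restrict V F"
    and K: "compact K" "K \<subseteq> V" and V: "V \<subseteq> S"
  shows "sup_bigo K (\<lambda>\<epsilon> x. f \<epsilon> x - h \<epsilon> x) b"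
proof -
  obtain g0 where g0: "F = colombeau_rel S `` {g0}"
    using F(1) by (auto simp: colombeau_def quotient_def)
  obtain h0 where h0: "h0 \<in> F" "(h0, h) \<in> colombeau_rel V"
    using h by (auto simp: colombeau_restrict_def)
  have "sup_bigo K (\<lambda>\<epsilon> x. g0 \<epsilon> x - f \<epsilon> x) b" "sup_bigo K (\<lambda>\<epsilon> x. g0 \<epsilon> x - h0 \<epsilon> x) b"
    using F(2) h0(1) K V unfolding g0 by (auto simp: colombeau_rel_def intro!: null_nets_sup_bigo[where S=S])
  moreover have "sup_bigo K (\<lambda>\<epsilon> x. h0 \<epsilon> x - h \<epsilon> x) b"
    using h0(2) K by (auto simp: colombeau_rel_def intro!: null_nets_sup_bigo[where S=V])
  ultimately have "sup_bigo K (\<lambda>\<epsilon> x. - (g0 \<epsilon> x - f \<epsilon> x) + (g0 \<epsilon> x - h0 \<epsilon> x) + (h0 \<epsilon> x - h \<epsilon> x)) b"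
    by (intro sup_bigo_add) (simp_all only: sup_bigo_uminus)
  then show ?thesis by simp
qed

lemma eventually_unit_interval: "\<forall>\<^sub>F \<epsilon> in at_right (0::real). \<epsilon> \<in> {0<..<1}"
  by (rule eventually_at_rightI[of _ 1]) auto

text \<open>Association and microanalyticity each come with their own representative. On
  \<open>K\<close> these differ by a negligible net, so the switch preserves the exponent of the
  association. That exponent belongs to \<open>K\<close> and not to \<theta>, which makes the
  subsequent normalisation possible.\<close>

lemma strongly_associated_representative:
  fixes V :: "(real ^ 'd) set"
  assumes F: "F \<in> colombeau S" "f \<in> F" and V: "open V" "V \<subseteq> S"
    and T: "strongly_associated V T (colombeau_restrict V F)"
    and K: "compact K" "K \<subseteq> V"
  obtains b where "b > 0"
    "\<And>\<theta>. \<theta> \<in> test_functions K \<Longrightarrow>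
      \<exists>M. \<forall>\<^sub>F \<epsilon> in at_right 0. cmod (T \<theta> - (LINT x|lborel. \<theta> x * f \<epsilon> x)) \<le> M * \<epsilon> powr b"
proof -
  obtain h where h: "h \<in> colombeau_restrict V F" and ha: "\<And>K. compact K \<Longrightarrow> K \<subseteq> V \<Longrightarrow>
      \<exists>a>0. \<forall>\<theta>\<in>test_functions V. supp \<theta> \<subseteq> K \<longrightarrow>
           (\<lambda>\<epsilon>. T \<theta> - (LINT x|lborel. h \<epsilon> x * \<theta> x)) \<in> O[at_right 0](\<lambda>\<epsilon>. of_real (\<epsilon> powr a))"
    using T unfolding strongly_associated_def by meson
  obtain b where b: "b > 0" and hb: "\<And>\<theta>. \<theta> \<in> test_functions V \<Longrightarrow> supp \<theta> \<subseteq> K \<Longrightarrow>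
           (\<lambda>\<epsilon>. T \<theta> - (LINT x|lborel. h \<epsilon> x * \<theta> x)) \<in> O[at_right 0](\<lambda>\<epsilon>. of_real (\<epsilon> powr b))"
    using ha[OF K] by blast
  have "h \<in> moderate_nets V"
    using h by (auto simp: colombeau_restrict_def colombeau_rel_def)
  then have hsm: "continuous_on V (h \<epsilon>)" if "\<epsilon> \<in> {0<..<1}" for \<epsilon>
    using moderate_nets_smooth_on smooth_on_continuous_on that by blast
  have fsm: "continuous_on V (f \<epsilon>)" if "\<epsilon> \<in> {0<..<1}" for \<epsilon>
    using moderate_nets_smooth_on[OF colombeau_representative_moderate[OF F] that] smooth_on_continuous_on V(2)
      continuous_on_subset by blast
  obtain C where C: "\<forall>\<^sub>F \<epsilon> in at_right 0. \<forall>x\<in>K. cmod (f \<epsilon> x - h \<epsilon> x) \<le> C * \<epsilon> powr b"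
    using restrict_representative_diff[OF F h K V(2), of b] unfolding sup_bigo_def by blast
  show thesis
  proof (rule that[OF b])
    fix \<theta> assume \<theta>: "\<theta> \<in> test_functions K"
    then have \<theta>V: "\<theta> \<in> test_functions V"
      using test_functions_mono[OF K(2)] by blast
    obtain c where c: "\<forall>\<^sub>F \<epsilon> in at_right 0. cmod (T \<theta> - (LINT x|lborel. h \<epsilon> x * \<theta> x)) \<le> c * cmod (of_real (\<epsilon> powr b))"
      using landau_o.bigE[OF hb[OF \<theta>V test_functionsD(3)[OF \<theta>]]] by blast
    obtain B where B: "B > 0" "\<And>x. cmod (\<theta> x) \<le> B"
      using test_functions_bounded[OF \<theta>, of "[]"] by auto
    have "\<forall>\<^sub>F \<epsilon> in at_right 0. cmod (T \<theta> - (LINT x|lborel. \<theta> x * f \<epsilon> x)) \<le> (c + B * C * measure lborel K) * \<epsilon> powr b"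
      using C c eventually_unit_interval
    proof eventually_elim
      case (elim \<epsilon>)
      note i = continuous_test_function_mult(3)[OF \<theta>V V(1)]
      have "(LINT x|lborel. \<theta> x * f \<epsilon> x) = (LINT x|lborel. h \<epsilon> x * \<theta> x) + (LINT x|lborel. \<theta> x * (f \<epsilon> x - h \<epsilon> x))"
        using i[OF fsm[OF elim(3)]] i[OF hsm[OF elim(3)]]
        by (simp add: right_diff_distrib mult.commute[of _ "\<theta> _"])
      moreover have "cmod (LINT x|lborel. \<theta> x * (f \<epsilon> x - h \<epsilon> x)) \<le> (B * (C * \<epsilon> powr b)) * measure lborel K"
      proof (rule integral_bound_compact[OF K(1)])
        show "cmod (\<theta> x * (f \<epsilon> x - h \<epsilon> x)) \<le> B * (C * \<epsilon> powr b)" if "x \<in> K" for x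
          unfolding norm_mult using elim(1) that B by (intro mult_mono) auto
        show "\<theta> x * (f \<epsilon> x - h \<epsilon> x) = 0" if "x \<notin> K" for x
          using that test_functionsD(3)[OF \<theta>] not_in_supp by auto
      qed
      moreover have "cmod (T \<theta> - (LINT x|lborel. h \<epsilon> x * \<theta> x)) \<le> c * \<epsilon> powr b"
        using elim(2) by simp
      ultimately show ?case
        using norm_triangle_ineq4[of "T \<theta> - (LINT x|lborel. h \<epsilon> x * \<theta> x)" "LINT x|lborel. \<theta> x * (f \<epsilon> x - h \<epsilon> x)"]
        by (simp add: algebra_simps)
    qed
    then show "\<exists>M. \<forall>\<^sub>F \<epsilon> in at_right 0. cmod (T \<theta> - (LINT x|lborel. \<theta> x * f \<epsilon> x)) \<le> M * \<epsilon> powr b" by blast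
  qed
qed

text \<open>After division by \<open>\<epsilon> powr b\<close> the error functionals are bounded at
  each test function as \<epsilon> tends to zero, and each is continuous because \<open>T\<close>
  has finite order on \<open>K\<close> and \<open>f \<epsilon>\<close> is bounded there. The
  continuity constants may depend on \<epsilon>; uniformity is what Banach-Steinhaus
  delivers.\<close>

lemma strongly_associated_uniform:
  fixes V :: "(real ^ 'd) set"
  assumes F: "F \<in> colombeau S" "f \<in> F" and V: "open V" "V \<subseteq> S"
    and D: "distribution V T" and T: "strongly_associated V T (colombeau_restrict V F)"
    and K: "compact K" "K \<subseteq> V"
  obtains b C m \<epsilon>1 where "b > 0" "C > 0" "\<epsilon>1 \<in> {0<..<1}"
    "\<And>\<epsilon> \<theta> B. \<epsilon> \<in> {0<..<\<epsilon>1} \<Longrightarrow> \<theta> \<in> test_functions K \<Longrightarrow> bounded_partials m B \<theta> \<Longrightarrow>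
      cmod (T \<theta> - (LINT x|lborel. \<theta> x * f \<epsilon> x)) \<le> C * B * \<epsilon> powr b"
proof -
  obtain b where b: "b > 0" and pt: "\<And>\<theta>. \<theta> \<in> test_functions K \<Longrightarrow>
      \<exists>M. \<forall>\<^sub>F \<epsilon> in at_right 0. cmod (T \<theta> - (LINT x|lborel. \<theta> x * f \<epsilon> x)) \<le> M * \<epsilon> powr b"
  proof (rule strongly_associated_representative[OF F V T K], goal_cases)
    case 1
    from 1(2-) show ?case by (rule 1(1))
  qed
  have fc: "continuous_on V (f \<epsilon>)" if "\<epsilon> \<in> {0<..<1}" for \<epsilon>
    using moderate_nets_smooth_on[OF colombeau_representative_moderate[OF F] that] smooth_on_continuous_on V(2)
      continuous_on_subset by blast
  have KV: "\<theta> \<in> test_functions V" if "\<theta> \<in> test_functions K" for \<theta>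
    using that test_functions_mono[OF K(2)] by blast
  have i: "integrable lborel (\<lambda>x. \<theta> x * f \<epsilon> x)" if "\<epsilon> \<in> {0<..<1}" "\<theta> \<in> test_functions K" for \<epsilon> \<theta>
    using continuous_test_function_mult(3)[OF KV[OF that(2)] V(1) fc[OF that(1)]] .
  define L where "L = (\<lambda>\<epsilon> \<theta>. (T \<theta> - (LINT x|lborel. \<theta> x * f \<epsilon> x)) / of_real (\<epsilon> powr b))"
  have Tadd: "T (\<lambda>x. \<theta> x + \<psi> x) = T \<theta> + T \<psi>" if "\<theta> \<in> test_functions K" "\<psi> \<in> test_functions K" for \<theta> \<psi>
    using D KV that unfolding distribution_def by blast
  have Tcm: "T (\<lambda>x. c * \<theta> x) = c * T \<theta>" if "\<theta> \<in> test_functions K" for \<theta> c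
    using D KV that unfolding distribution_def by blast
  obtain C m \<epsilon>1 where C: "C > 0" "\<epsilon>1 \<in> {0<..<1}"
    "\<And>\<epsilon> \<theta> B. \<epsilon> \<in> {0<..<\<epsilon>1} \<Longrightarrow> \<theta> \<in> test_functions K \<Longrightarrow> bounded_partials m B \<theta> \<Longrightarrow> cmod (L \<epsilon> \<theta>) \<le> C * B"
  proof (rule banach_steinhaus_test_functions[OF K(1), of L])
    fix \<epsilon> :: real assume \<epsilon>: "\<epsilon> \<in> {0<..<1}"
    show "L \<epsilon> (\<lambda>x. \<theta> x + \<psi> x) = L \<epsilon> \<theta> + L \<epsilon> \<psi>"
      if "\<theta> \<in> test_functions K" "\<psi> \<in> test_functions K" for \<theta> \<psi>
      using Tadd[OF that] i[OF \<epsilon> that(1)] i[OF \<epsilon> that(2)]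
      by (simp add: L_def distrib_right add_divide_distrib[symmetric])
    show "L \<epsilon> (\<lambda>x. c * \<theta> x) = c * L \<epsilon> \<theta>" if "\<theta> \<in> test_functions K" for \<theta> c
      using Tcm[OF that, of c] by (simp add: L_def mult.assoc right_diff_distrib)
    show "\<exists>A m. \<forall>\<theta> B. \<theta> \<in> test_functions K \<longrightarrow> bounded_partials m B \<theta> \<longrightarrow> cmod (L \<epsilon> \<theta>) \<le> A * B"
    proof -
      obtain A m where A: "\<And>\<theta> B. \<theta> \<in> test_functions K \<Longrightarrow> bounded_partials m B \<theta> \<Longrightarrow> cmod (T \<theta>) \<le> A * B"
        using distribution_continuous[OF D K] by metis
      have "compact (f \<epsilon> ` K)"
        using compact_continuous_image[OF continuous_on_subset[OF fc[OF \<epsilon>] K(2)] K(1)] .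
      then obtain N where N: "\<And>x. x \<in> K \<Longrightarrow> cmod (f \<epsilon> x) \<le> N"
        using compact_imp_bounded bounded_iff by (metis imageI)
      have "cmod (L \<epsilon> \<theta>) \<le> (A + N * measure lborel K) / \<epsilon> powr b * B"
        if \<theta>: "\<theta> \<in> test_functions K" and B: "bounded_partials m B \<theta>" for \<theta> B
      proof -
        have "cmod (LINT x|lborel. \<theta> x * f \<epsilon> x) \<le> (B * N) * measure lborel K"
        proof (rule integral_bound_compact[OF K(1)])
          have "cmod (\<theta> x) \<le> B" for x
            using B unfolding bounded_partials_def by (metis le0 list.size(3) partials_simps(1))
          then show "cmod (\<theta> x * f \<epsilon> x) \<le> B * N" if "x \<in> K" for x
            unfolding norm_mult using N[OF that] bounded_partials_nonneg[OF B] by (intro mult_mono) auto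
          show "\<theta> x * f \<epsilon> x = 0" if "x \<notin> K" for x
            using that test_functionsD(3)[OF \<theta>] not_in_supp by auto
        qed
        then have "cmod (T \<theta> - (LINT x|lborel. \<theta> x * f \<epsilon> x)) \<le> (A + N * measure lborel K) * B"
          using A[OF \<theta> B] norm_triangle_ineq4[of "T \<theta>" "LINT x|lborel. \<theta> x * f \<epsilon> x"] by (simp add: algebra_simps)
        then have "cmod (T \<theta> - (LINT x|lborel. \<theta> x * f \<epsilon> x)) / \<epsilon> powr b \<le> (A + N * measure lborel K) * B / \<epsilon> powr b"
          by (intro divide_right_mono) auto
        then show ?thesis
          by (simp add: L_def norm_divide)
      qed
      then show ?thesis by blast
    qed
  next
    fix \<theta> assume \<theta>: "\<theta> \<in> test_functions K"
    obtain M where M: "\<forall>\<^sub>F \<epsilon> in at_right 0. cmod (T \<theta> - (LINT x|lborel. \<theta> x * f \<epsilon> x)) \<le> M * \<epsilon> powr b"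
      using pt[OF \<theta>] by blast
    have "\<forall>\<^sub>F \<epsilon> in at_right 0. cmod (L \<epsilon> \<theta>) \<le> M"
      using M eventually_unit_interval
    proof eventually_elim
      case (elim \<epsilon>)
      then show ?case
        by (simp add: L_def norm_divide pos_divide_le_eq)
    qed
    then show "\<exists>M. \<forall>\<^sub>F \<epsilon> in at_right 0. cmod (L \<epsilon> \<theta>) \<le> M" by blast
  next
    fix C m \<epsilon>1
    assume "C > 0" "\<epsilon>1 \<in> {0<..<1}" "\<And>\<epsilon> \<theta> B. \<epsilon> \<in> {0<..<\<epsilon>1} \<Longrightarrow> \<theta> \<in> test_functions K \<Longrightarrow>
      bounded_partials m B \<theta> \<Longrightarrow> cmod (L \<epsilon> \<theta>) \<le> C * B"
    then show ?thesis by (rule that)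
  qed
  show thesis
  proof (rule that[OF b C(1,2)])
    fix \<epsilon> \<theta> B assume *: "\<epsilon> \<in> {0<..<\<epsilon>1}" "\<theta> \<in> test_functions K" "bounded_partials m B \<theta>"
    from C(3)[OF this] show "cmod (T \<theta> - (LINT x|lborel. \<theta> x * f \<epsilon> x)) \<le> C * B * \<epsilon> powr b"
      using *(1) by (simp add: L_def norm_divide pos_divide_le_eq)
  qed
qed

section \<open>Uniform estimates for modulated and localised cut-offs\<close>

lemma bounded_partials_mono: "bounded_partials m B \<theta> \<Longrightarrow> k \<le> m \<Longrightarrow> bounded_partials k B \<theta>"
  by (auto simp: bounded_partials_def)

lemma fourier_modulation: "fourier (\<lambda>x. \<theta> x * exp (- (\<i> * of_real (x \<bullet> \<xi>)))) \<eta> = fourier \<theta> (\<eta> + \<xi>)"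
proof -
  have "exp (- (\<i> * of_real (x \<bullet> \<eta>))) * (\<theta> x * exp (- (\<i> * of_real (x \<bullet> \<xi>)))) =
      exp (- (\<i> * of_real (x \<bullet> (\<eta> + \<xi>)))) * \<theta> x" for x
    by (simp add: inner_add_right distrib_left exp_add[symmetric] mult.left_commute[of _ "\<theta> x"] mult.commute[of _ "\<theta> x"])
  then show ?thesis by (simp only: fourier_def)
qed

text \<open>The exponential only translates the transform to the centre \<open>- \<xi>\<close>, so
  \<open>sup_partials_bound\<close> applies with the decay of the transform of
  \<open>\<kappa> n\<close> itself. The order of decay used does not involve \<open>n\<close>, hence
  neither does \<open>A\<close>.\<close>

lemma admissible_cutoff_modulated:
  fixes x0 :: "real ^ 'd"
  assumes \<kappa>: "admissible_cutoff S x0 W U \<kappa>"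
  obtains A where "A \<ge> 0"
    "\<And>n \<xi>. n \<ge> 1 \<Longrightarrow> bounded_partials m (A * (1 + norm \<xi>) ^ m) (\<lambda>x. \<kappa> n x * exp (- (\<i> * of_real (x \<bullet> \<xi>))))"
proof -
  obtain A where A: "A \<ge> 1" "\<And>n \<eta>. n \<ge> 1 \<Longrightarrow> (1 + norm \<eta>) ^ (m + 2 * CARD('d)) * cmod (fourier (\<kappa> n) \<eta>) \<le> A"
    using admissible_cutoff_fourier_decay[OF \<kappa>, of "m + 2 * CARD('d)"] by metis
  let ?D = "LINT \<eta>|lborel. 1 / (1 + norm (\<eta> :: real ^ 'd)) ^ (2 * CARD('d))"
  show thesis
  proof (rule that)
    show "0 \<le> A * ?D"
      using A by (intro mult_nonneg_nonneg integral_nonneg_AE) auto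
    fix n \<xi> assume n: "(n::nat) \<ge> 1"
    let ?\<theta> = "\<lambda>x. \<kappa> n x * exp (- (\<i> * of_real (x \<bullet> \<xi>)))"
    have \<theta>: "?\<theta> \<in> test_functions U"
      by (rule test_functions_mult[OF admissible_cutoff_test_functions(1)[OF \<kappa> n] smooth_on_exponential])
    show "bounded_partials m (A * ?D * (1 + norm \<xi>) ^ m) ?\<theta>"
      unfolding bounded_partials_def
    proof (intro allI impI)
      fix "is" :: "'d list" and x assume "length is \<le> m"
      then have "cmod (partials is ?\<theta> x) \<le> A * (1 + norm (- \<xi>)) ^ m * ?D"
        by (intro sup_partials_bound[OF \<theta>]) (use A(2)[OF n] in \<open>auto simp: fourier_modulation\<close>)
      then show "cmod (partials is ?\<theta> x) \<le> A * ?D * (1 + norm \<xi>) ^ m"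
        by (simp add: mult_ac)
    qed
  qed
qed

text \<open>A crude bound at all frequencies, in particular outside the cone, where microanalyticity
  says nothing. It is uniform in \<open>n\<close> because the cut-offs are uniformly
  bounded.\<close>

lemma moderate_nets_fourier_bound:
  fixes x0 :: "real ^ 'd"
  assumes f: "f \<in> moderate_nets S" and \<kappa>: "admissible_cutoff S x0 W U \<kappa>"
  obtains P p \<epsilon>1 where "P \<ge> 0" "\<epsilon>1 \<in> {0<..<1}"
    "\<And>n \<epsilon> \<zeta>. n \<ge> 1 \<Longrightarrow> \<epsilon> \<in> {0<..<\<epsilon>1} \<Longrightarrow> cmod (fourier (\<lambda>x. \<kappa> n x * f \<epsilon> x) \<zeta>) \<le> P * \<epsilon> powr p"
proof -
  let ?K = "closure U"
  have K: "compact ?K" "?K \<subseteq> S"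
    using \<kappa> by (auto simp: admissible_cutoff_def compactly_inside_def)
  obtain p where "sup_bigo ?K f p"
    using moderate_nets_sup_bigo[OF f K] by blast
  then obtain M where "\<forall>\<^sub>F \<epsilon> in at_right 0. \<forall>x\<in>?K. cmod (f \<epsilon> x) \<le> M * \<epsilon> powr p"
    unfolding sup_bigo_def by blast
  then obtain e where e: "e > 0" "\<And>\<epsilon> x. 0 < \<epsilon> \<Longrightarrow> \<epsilon> < e \<Longrightarrow> x \<in> ?K \<Longrightarrow> cmod (f \<epsilon> x) \<le> M * \<epsilon> powr p"
    unfolding eventually_at_right_field by blast
  obtain C where C: "C \<ge> 1" "\<And>n x. n \<ge> 1 \<Longrightarrow> cmod (\<kappa> n x) \<le> C"
    using admissible_cutoff_bound[OF \<kappa>] by metis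
  show thesis
  proof (rule that[of "C * \<bar>M\<bar> * measure lborel ?K" "min e (1/2)" p])
    show "0 \<le> C * \<bar>M\<bar> * measure lborel ?K" using C by simp
    show "min e (1/2) \<in> {0<..<1}" using e by auto
    fix n :: nat and \<epsilon> \<zeta> assume n: "n \<ge> 1" and \<epsilon>: "\<epsilon> \<in> {0<..<min e (1/2)}"
    have "cmod (fourier (\<lambda>x. \<kappa> n x * f \<epsilon> x) \<zeta>) \<le> (C * (\<bar>M\<bar> * \<epsilon> powr p)) * measure lborel ?K"
    proof (rule fourier_bound[OF K(1)])
      show "cmod (\<kappa> n x * f \<epsilon> x) \<le> C * (\<bar>M\<bar> * \<epsilon> powr p)" if "x \<in> ?K" for x
      proof -
        have "cmod (f \<epsilon> x) \<le> \<bar>M\<bar> * \<epsilon> powr p"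
          using e(2)[of \<epsilon> x] \<epsilon> that by (auto intro: order_trans mult_right_mono)
        then show ?thesis
          unfolding norm_mult using C n by (intro mult_mono) auto
      qed
      show "\<kappa> n x * f \<epsilon> x = 0" if "x \<notin> ?K" for x
        using that test_functionsD(3)[OF admissible_cutoff_test_functions(2)[OF \<kappa> n]] not_in_supp by auto
    qed
    then show "cmod (fourier (\<lambda>x. \<kappa> n x * f \<epsilon> x) \<zeta>) \<le> C * \<bar>M\<bar> * measure lborel ?K * \<epsilon> powr p"
      by (simp add: mult_ac)
  qed
qed

text \<open>The convolution mixes the decay inside the cone with moderate growth elsewhere. Both fit
  under a possibly larger negative power of \<epsilon>, so the cone and the constants change while
  the order \<open>n\<close> of decay survives.\<close>

lemma g_microanalytic_localise:
  fixes x0 :: "real ^ 'd"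
  assumes S: "open S" and f: "f \<in> moderate_nets S" and \<kappa>: "admissible_cutoff S x0 W U \<kappa>"
    and \<rho>: "admissible_cutoff W x0 W' U' \<rho>"
    and \<Gamma>: "open_cone_around \<xi>0 \<Gamma>" and pos: "a > 0" "C > 0" "\<epsilon>0 \<in> {0<..<1}"
    and micro: "\<And>n \<xi> \<epsilon>. n \<ge> 1 \<Longrightarrow> \<xi> \<in> \<Gamma> \<Longrightarrow> \<epsilon> \<in> {0<..<\<epsilon>0} \<Longrightarrow>
      cmod (fourier (\<lambda>x. \<kappa> n x * f \<epsilon> x) \<xi>) \<le> C * \<epsilon> powr (- a) * (C * real n / (1 + norm \<xi>)) ^ n"
  obtains \<Gamma>' a' C' \<epsilon>1 where "open_cone_around \<xi>0 \<Gamma>'" "a' > 0" "C' > 0" "\<epsilon>1 \<in> {0<..<1}"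
    "\<And>n \<xi> \<epsilon>. n \<ge> 1 \<Longrightarrow> \<xi> \<in> \<Gamma>' \<Longrightarrow> \<epsilon> \<in> {0<..<\<epsilon>1} \<Longrightarrow>
      cmod (fourier (\<lambda>x. \<rho> n x * f \<epsilon> x) \<xi>) \<le> C' * \<epsilon> powr (- a') * (C' * real n / (1 + norm \<xi>)) ^ n"
proof -
  let ?D = "LINT \<eta>|lborel. 1 / (1 + norm (\<eta> :: real ^ 'd)) ^ (2 * CARD('d))"
  have D: "?D \<ge> 0" by (intro integral_nonneg_AE) auto
  obtain \<Gamma>' c where \<Gamma>': "open_cone_around \<xi>0 \<Gamma>'" and c: "0 < c" "c \<le> 1 / 2"
    and cone: "\<And>\<xi> \<eta>. \<xi> \<in> \<Gamma>' \<Longrightarrow> norm \<eta> \<le> c * norm \<xi> \<Longrightarrow> \<xi> - \<eta> \<in> \<Gamma>"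
    using open_cone_around_shrink[OF \<Gamma>] by metis
  obtain P p \<epsilon>2 where P: "P \<ge> 0" "\<epsilon>2 \<in> {0<..<1}"
    "\<And>n \<epsilon> \<zeta>. n \<ge> 1 \<Longrightarrow> \<epsilon> \<in> {0<..<\<epsilon>2} \<Longrightarrow> cmod (fourier (\<lambda>x. \<kappa> n x * f \<epsilon> x) \<zeta>) \<le> P * \<epsilon> powr p"
    using moderate_nets_fourier_bound[OF f \<kappa>] by metis
  obtain A where A: "A \<ge> 1"
    "\<And>n \<eta>. n \<ge> 1 \<Longrightarrow> (1 + norm \<eta>) ^ (2 * CARD('d)) * cmod (fourier (\<rho> n) \<eta>) \<le> A"
    "\<And>n \<eta>. n \<ge> 1 \<Longrightarrow> (1 + norm \<eta>) ^ (n + 2 * CARD('d)) * cmod (fourier (\<rho> n) \<eta>) \<le> A * (A * real n) ^ n"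
    using admissible_cutoff_fourier_decay[OF \<rho>] by metis
  define E where "E = max (2 * C) (A / c)"
  \<comment> \<open>For \<epsilon> below \<open>1\<close> this exponent dominates both
    \<open>\<epsilon> powr p\<close> from moderateness and \<open>\<epsilon> powr (- a)\<close> from
    microanalyticity.\<close>
  define a' where "a' = max a (- p)"
  define C' where "C' = max E (?D * A * (P + C))"
  have E: "E > 0" "2 * C \<le> E" "A / c \<le> E"
    using pos by (auto simp: E_def)
  show thesis
  proof (rule that[of \<Gamma>' a' C' "min \<epsilon>0 \<epsilon>2", OF \<Gamma>'])
    show "a' > 0" "C' > 0" "min \<epsilon>0 \<epsilon>2 \<in> {0<..<1}"
      using pos P E by (auto simp: a'_def C'_def)
    fix n :: nat and \<xi> \<epsilon> assume n: "n \<ge> 1" and \<xi>: "\<xi> \<in> \<Gamma>'" and \<epsilon>: "\<epsilon> \<in> {0<..<min \<epsilon>0 \<epsilon>2}"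
    have \<epsilon>1: "\<epsilon> \<in> {0<..<1}" using \<epsilon> P(2) by auto
    have U: "closure U' \<subseteq> W" "closure U \<subseteq> S" "\<And>x. x \<in> W \<Longrightarrow> \<kappa> n x = 1"
      using \<kappa> \<rho> n by (auto simp: admissible_cutoff_def compactly_inside_def)
    have \<kappa>S: "\<kappa> n \<in> test_functions S"
      using admissible_cutoff_test_functions(2)[OF \<kappa> n] test_functions_mono[OF U(2)] by blast
    have g: "integrable lborel (\<lambda>x. \<kappa> n x * f \<epsilon> x)"
      by (rule continuous_test_function_mult(3)[OF \<kappa>S S smooth_on_continuous_on[OF moderate_nets_smooth_on[OF f \<epsilon>1]]])
    have "\<rho> n x * f \<epsilon> x = \<rho> n x * (\<kappa> n x * f \<epsilon> x)" for x
      using U not_in_supp[of x "\<rho> n"] test_functionsD(3)[OF admissible_cutoff_test_functions(2)[OF \<rho> n]]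
      by (cases "x \<in> W") auto
    then have "cmod (fourier (\<lambda>x. \<rho> n x * f \<epsilon> x) \<xi>) = cmod (fourier (\<lambda>x. \<rho> n x * (\<kappa> n x * f \<epsilon> x)) \<xi>)"
      by (simp only:)
    also have "\<dots> \<le> ?D * A * (P * \<epsilon> powr p + C * \<epsilon> powr (- a)) * (E * real n / (1 + norm \<xi>)) ^ n"
    proof (rule fourier_mult_cone_bound[OF admissible_cutoff_test_functions(1)[OF \<rho> n] g c cone[OF \<xi>] P(3)[OF n]])
      show "cmod (fourier (\<lambda>x. \<kappa> n x * f \<epsilon> x) \<zeta>) \<le> C * \<epsilon> powr (- a) * (C * real n / (1 + norm \<zeta>)) ^ n"
        if "\<zeta> \<in> \<Gamma>" for \<zeta>
        using micro[OF n that] \<epsilon> by simp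
    qed (use A n \<epsilon> pos E in auto)
    also have "\<dots> \<le> ?D * A * ((P + C) * \<epsilon> powr (- a')) * (C' * real n / (1 + norm \<xi>)) ^ n"
    proof -
      have "\<epsilon> powr p \<le> \<epsilon> powr (- a')" "\<epsilon> powr (- a) \<le> \<epsilon> powr (- a')"
        using \<epsilon>1 by (auto intro!: powr_mono' simp: a'_def)
      then have "P * \<epsilon> powr p + C * \<epsilon> powr (- a) \<le> (P + C) * \<epsilon> powr (- a')"
        unfolding distrib_right using P(1) pos by (intro add_mono mult_left_mono) auto
      moreover have "(E * real n / (1 + norm \<xi>)) ^ n \<le> (C' * real n / (1 + norm \<xi>)) ^ n"
        using E by (intro power_mono divide_right_mono mult_right_mono) (auto simp: C'_def)
      ultimately show ?thesis
        using D A(1) P(1) pos E by (intro mult_mono) auto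
    qed
    also have "\<dots> = (?D * A * (P + C)) * \<epsilon> powr (- a') * (C' * real n / (1 + norm \<xi>)) ^ n"
      by (simp only: mult.assoc)
    also have "\<dots> \<le> C' * \<epsilon> powr (- a') * (C' * real n / (1 + norm \<xi>)) ^ n"
      using \<open>C' > 0\<close> by (intro mult_right_mono) (auto simp: C'_def)
    finally show "cmod (fourier (\<lambda>x. \<rho> n x * f \<epsilon> x) \<xi>) \<le> C' * \<epsilon> powr (- a') * (C' * real n / (1 + norm \<xi>)) ^ n" .
  qed
qed

text \<open>With \<open>t = C k n / R < 1\<close> the choice \<open>\<epsilon> = \<epsilon>2 t\<^sup>\<sigma>\<^sup>n\<close> balances the two terms: \<open>\<sigma>\<close> is large enough
  for \<open>\<epsilon>\<^sup>b\<close> to absorb \<open>R\<^sup>m\<close> and still leave \<open>t\<^sup>n\<close>, and \<open>k\<close> large enough for \<open>t\<^sup>k\<^sup>n\<close> to absorb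
  \<open>\<epsilon>\<^sup>-\<^sup>a\<close>. The factor \<open>n\<^sup>m\<close> is at most \<open>(2\<^sup>m)\<^sup>n\<close>.\<close>

lemma balance_regularisation:
  fixes a b C \<epsilon>1 :: real
  assumes ab: "a > 0" "b > 0" and C: "C \<ge> 1" and \<epsilon>1: "\<epsilon>1 \<in> {0<..<1}"
  obtains k :: nat and E :: real where "k \<ge> 1" "E > 0"
    "\<And>n R x. n \<ge> 1 \<Longrightarrow> R \<ge> 1 \<Longrightarrow> x \<le> C * R ^ m \<Longrightarrow>
      (\<And>\<epsilon>. \<epsilon> \<in> {0<..<\<epsilon>1} \<Longrightarrow> x \<le> C * \<epsilon> powr (- a) * (C * real (k * n) / R) ^ (k * n) + C * R ^ m * \<epsilon> powr b) \<Longrightarrow>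
      x \<le> E * (E * real n / R) ^ n"
proof -
  define \<sigma> where "\<sigma> = (1 + real m) / b"
  define k where "k = nat \<lceil>1 + a * \<sigma>\<rceil>"
  \<comment> \<open>Halving turns the weak bound \<open>\<epsilon> \<le> \<epsilon>2\<close>
    obtained below into strict membership in the range of \<open>est\<close>.\<close>
  define \<epsilon>2 where "\<epsilon>2 = \<epsilon>1 / 2"
  \<comment> \<open>The factor \<open>2 ^ m\<close> pays for
    \<open>real n ^ m \<le> (2 ^ m) ^ n\<close>, and \<open>k\<close> turns \<open>k * n\<close>
    into \<open>n\<close>.\<close>
  define H where "H = C * real k * 2 ^ m"
  define E where "E = max H (C * \<epsilon>2 powr (- a) + C * (C * real k) ^ m)"
  have \<sigma>: "\<sigma> > 0" "b * \<sigma> = 1 + real m"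
    using ab by (auto simp: \<sigma>_def)
  have k: "real k \<ge> 1 + a * \<sigma>"
    unfolding k_def by (rule real_nat_ceiling_ge)
  have "a * \<sigma> > 0" using ab \<sigma> by simp
  with k have k1: "k \<ge> 1"
    by linarith
  have \<epsilon>2: "0 < \<epsilon>2" "\<epsilon>2 < \<epsilon>1" "\<epsilon>2 < 1"
    using \<epsilon>1 by (auto simp: \<epsilon>2_def)
  have H: "H > 0" using C k1 by (simp add: H_def)
  show thesis
  proof (rule that[OF k1])
    show "E > 0" using H by (simp add: E_def)
    fix n :: nat and R x :: real
    assume n: "n \<ge> 1" and R: "R \<ge> 1" and triv: "x \<le> C * R ^ m"
      and est: "\<And>\<epsilon>. \<epsilon> \<in> {0<..<\<epsilon>1} \<Longrightarrow> x \<le> C * \<epsilon> powr (- a) * (C * real (k * n) / R) ^ (k * n) + C * R ^ m * \<epsilon> powr b"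
    define t where "t = C * real (k * n) / R"
    have t: "t > 0" using C k1 n R by (simp add: t_def)
    have Ht: "H * real n / R = 2 ^ m * t"
      by (simp add: H_def t_def)
    have nm: "real n ^ m \<le> (2 ^ m) ^ n"
    proof -
      have "real n ^ m \<le> (2 ^ n) ^ m"
        using less_imp_le[OF of_nat_less_two_power[of n, where 'a=real]] by (intro power_mono) auto
      then show ?thesis by (simp add: power_mult[symmetric] mult.commute)
    qed
    have CR: "C * (C * real (k * n)) ^ m \<le> C * (C * real k) ^ m * (2 ^ m) ^ n"
      using C nm by (simp add: power_mult_distrib mult_left_mono)
    have "x \<le> (C * \<epsilon>2 powr (- a) + C * (C * real k) ^ m) * (H * real n / R) ^ n"
    \<comment> \<open>For \<open>t \<ge> 1\<close>, \<open>R\<close> is at most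
      \<open>C * k * n\<close> and the target is not small, so the polynomial a priori bound on
      \<open>x\<close> suffices.\<close>
    proof (cases "t \<ge> 1")
      case True
      then have "R \<le> C * real (k * n)"
        using R by (simp add: t_def)
      then have "x \<le> C * (C * real (k * n)) ^ m"
        using triv C R by (meson mult_left_mono order_trans power_mono zero_le_one)
      also have "\<dots> \<le> C * (C * real k) ^ m * (2 ^ m) ^ n" by (rule CR)
      also have "\<dots> \<le> C * (C * real k) ^ m * (2 ^ m * t) ^ n"
        using True C by (intro mult_left_mono power_mono) auto
      also have "\<dots> \<le> (C * \<epsilon>2 powr (- a) + C * (C * real k) ^ m) * (2 ^ m * t) ^ n"
        using t C by (intro mult_right_mono) auto
      finally show ?thesis unfolding Ht .
    next
      case False
      then have t1: "t < 1" by simp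
      define \<epsilon> where "\<epsilon> = \<epsilon>2 * t powr (\<sigma> * real n)"
      have "t powr (\<sigma> * real n) \<le> 1"
        using t t1 \<sigma> n powr_mono'[of 0 "\<sigma> * real n" t] by simp
      then have "\<epsilon> \<le> \<epsilon>2"
        using \<epsilon>2 mult_left_mono[of "t powr (\<sigma> * real n)" 1 \<epsilon>2] by (simp add: \<epsilon>_def)
      then have "\<epsilon> < \<epsilon>1" using \<epsilon>2 by linarith
      then have "\<epsilon> \<in> {0<..<\<epsilon>1}"
        using \<epsilon>2 t unfolding greaterThanLessThan_iff by (simp add: \<epsilon>_def)
      note est[OF this]
      moreover have "C * \<epsilon> powr (- a) * t ^ (k * n) \<le> C * \<epsilon>2 powr (- a) * (2 ^ m * t) ^ n"
      proof -
        have "\<epsilon> powr (- a) * t ^ (k * n) = \<epsilon>2 powr (- a) * t powr (real (k * n) - a * \<sigma> * real n)"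
          using \<epsilon>2 t unfolding \<epsilon>_def
          by (simp add: powr_mult powr_powr powr_realpow[symmetric] powr_add[symmetric] mult_ac)
        also have "t powr (real (k * n) - a * \<sigma> * real n) \<le> t powr (real n)"
          using t t1 mult_right_mono[OF k, of "real n"] by (intro powr_mono') (auto simp: distrib_right)
        also have "t powr (real n) = t ^ n"
          using t by (simp add: powr_realpow)
        also have "t ^ n \<le> (2 ^ m * t) ^ n"
          using t mult_right_mono[of 1 "2 ^ m" t] by (intro power_mono) auto
        finally show ?thesis
          using C by (simp add: mult.assoc mult_left_mono)
      qed
      moreover have "C * R ^ m * \<epsilon> powr b \<le> C * (C * real k) ^ m * (2 ^ m * t) ^ n"
      proof -
        have "\<epsilon> powr b = \<epsilon>2 powr b * t powr ((1 + real m) * real n)"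
          using \<epsilon>2 t unfolding \<epsilon>_def \<sigma>(2)[symmetric] by (simp add: powr_mult powr_powr mult_ac)
        also have "\<dots> \<le> 1 * t powr (real (n + m))"
        proof (intro mult_mono)
          show "\<epsilon>2 powr b \<le> 1"
            using \<epsilon>2 ab powr_mono'[of 0 b \<epsilon>2] by simp
          \<comment> \<open>For \<open>n \<ge> 1\<close>, \<open>(1 + m) * n\<close> is at least
            \<open>n + m\<close>: \<open>t ^ n\<close> is the wanted decay, and \<open>t ^ m\<close>
            combines with \<open>R ^ m\<close> because \<open>t * R = C * k * n\<close>.\<close>
          have "real m * 1 \<le> real m * real n"
            using n by (intro mult_left_mono) auto
          then show "t powr ((1 + real m) * real n) \<le> t powr (real (n + m))"
            using t t1 by (intro powr_mono') (auto simp: distrib_right)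
        qed auto
        also have "\<dots> = t ^ n * t ^ m"
          using t by (simp add: powr_realpow power_add del: of_nat_add)
        finally have "C * R ^ m * \<epsilon> powr b \<le> C * R ^ m * (t ^ n * t ^ m)"
          using C R by (intro mult_left_mono) auto
        also have "\<dots> = C * (t * R) ^ m * t ^ n"
          by (simp add: power_mult_distrib)
        also have "t * R = C * real (k * n)"
          using R by (simp add: t_def)
        also have "C * (C * real (k * n)) ^ m * t ^ n \<le> C * (C * real k) ^ m * (2 ^ m) ^ n * t ^ n"
          using CR t by (intro mult_right_mono) auto
        finally show ?thesis
          by (simp add: power_mult_distrib mult.assoc)
      qed
      ultimately show ?thesis
        unfolding Ht t_def[symmetric] by (simp add: distrib_right)
    qed
    also have "\<dots> \<le> E * (E * real n / R) ^ n"
      using H R C \<open>E > 0\<close> unfolding E_def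
      by (intro mult_mono power_mono divide_right_mono mult_right_mono) auto
    finally show "x \<le> E * (E * real n / R) ^ n" .
  qed
qed

theorem theorem6:
  fixes \<omega> V :: "(real ^ 'd) set"
    and f :: "'d net set"
    and T :: "(real ^ 'd \<Rightarrow> complex) \<Rightarrow> complex"
    and x0 \<xi>0 :: "real ^ 'd"
  assumes "open \<omega>" and "f \<in> colombeau \<omega>"
    and "x0 \<in> \<omega>" and "\<xi>0 \<noteq> 0"
    and "g_microanalytic \<omega> f x0 \<xi>0"
    and "open V" and "V \<subseteq> \<omega>" and "x0 \<in> V"
    and "distribution V T"
    and "strongly_associated V T (colombeau_restrict V f)"
  shows "microanalytic V T x0 \<xi>0"
proof -
  obtain W U \<kappa> \<Gamma> g a0 C0 \<epsilon>0 where \<kappa>: "admissible_cutoff \<omega> x0 W U \<kappa>" and \<Gamma>: "open_cone_around \<xi>0 \<Gamma>"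
    and g: "g \<in> f" and pos: "a0 > 0" "C0 > 0" "\<epsilon>0 \<in> {0<..<1}"
    and micro: "\<And>n \<xi> \<epsilon>. n \<ge> 1 \<Longrightarrow> \<xi> \<in> \<Gamma> \<Longrightarrow> \<epsilon> \<in> {0<..<\<epsilon>0} \<Longrightarrow>
      cmod (fourier (\<lambda>x. \<kappa> n x * g \<epsilon> x) \<xi>) \<le> C0 * \<epsilon> powr (- a0) * (C0 * real n / (1 + norm \<xi>)) ^ n"
    using assms(5) unfolding g_microanalytic_def by blast
  have gm: "g \<in> moderate_nets \<omega>"
    by (rule colombeau_representative_moderate[OF assms(2) g])
  have "open (W \<inter> V)" "x0 \<in> W \<inter> V"
    using \<kappa> assms(6,8) by (auto simp: admissible_cutoff_def)
  then obtain W' U' \<rho> where \<rho>: "admissible_cutoff (W \<inter> V) x0 W' U' \<rho>"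
    using admissible_cutoff_shrink[OF \<kappa>] by metis
  have \<rho>W: "admissible_cutoff W x0 W' U' \<rho>" and \<rho>V: "admissible_cutoff V x0 W' U' \<rho>"
    using admissible_cutoff_mono[OF \<rho>] by auto
  let ?K = "closure U'"
  have K: "compact ?K" "?K \<subseteq> V"
    using \<rho>V by (auto simp: admissible_cutoff_def compactly_inside_def)
  obtain \<Gamma>' a C1 \<epsilon>1 where \<Gamma>': "open_cone_around \<xi>0 \<Gamma>'" and C1: "a > 0" "C1 > 0" "\<epsilon>1 \<in> {0<..<1}"
    and loc: "\<And>n \<xi> \<epsilon>. n \<ge> 1 \<Longrightarrow> \<xi> \<in> \<Gamma>' \<Longrightarrow> \<epsilon> \<in> {0<..<\<epsilon>1} \<Longrightarrow>
      cmod (fourier (\<lambda>x. \<rho> n x * g \<epsilon> x) \<xi>) \<le> C1 * \<epsilon> powr (- a) * (C1 * real n / (1 + norm \<xi>)) ^ n"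
  proof (rule g_microanalytic_localise[OF assms(1) gm \<kappa> \<rho>W \<Gamma> pos], goal_cases)
    case 1
    from 1(2-) show ?case by (rule micro)
  next
    case 2
    from 2(2-) show ?case by (rule 2(1))
  qed
  obtain b C2 m2 \<epsilon>2 where b: "b > 0" and C2: "C2 > 0" "\<epsilon>2 \<in> {0<..<1}"
    and assoc: "\<And>\<epsilon> \<theta> B. \<epsilon> \<in> {0<..<\<epsilon>2} \<Longrightarrow> \<theta> \<in> test_functions ?K \<Longrightarrow> bounded_partials m2 B \<theta> \<Longrightarrow>
      cmod (T \<theta> - (LINT x|lborel. \<theta> x * g \<epsilon> x)) \<le> C2 * B * \<epsilon> powr b"
  proof (rule strongly_associated_uniform[OF assms(2) g assms(6,7,9,10) K], goal_cases)
    case 1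
    from 1(2-) show ?case by (rule 1(1))
  qed
  \<comment> \<open>Continuity of \<open>T\<close> alone yields the a priori bound that the
    balancing uses when \<open>1 + norm \<xi>\<close> is at most of order \<open>n\<close>.\<close>
  obtain C3 m3 where C3: "C3 \<ge> 0"
    and cont: "\<And>\<theta> B. \<theta> \<in> test_functions ?K \<Longrightarrow> bounded_partials m3 B \<theta> \<Longrightarrow> cmod (T \<theta>) \<le> C3 * B"
    using distribution_continuous[OF assms(9) K] by metis
  \<comment> \<open>Bounds up to the larger order imply both smaller ones, so one modulated estimate
    serves association and continuity of \<open>T\<close>.\<close>
  define m where "m = max m2 m3"
  obtain A where A: "A \<ge> 0" and bp: "\<And>n \<xi>. n \<ge> 1 \<Longrightarrow>
      bounded_partials m (A * (1 + norm \<xi>) ^ m) (\<lambda>x. \<rho> n x * exp (- (\<i> * of_real (x \<bullet> \<xi>))))"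
  proof (rule admissible_cutoff_modulated[OF \<rho>V, of m], goal_cases)
    case 1
    from 1(2-) show ?case by (rule 1(1))
  qed
  define C where "C = 1 + C1 + C2 * A + C3 * A"
  have C: "C \<ge> 1" "C1 \<le> C" "C2 * A \<le> C" "C3 * A \<le> C"
    using C1 C2 C3 A by (auto simp: C_def)
  define e where "e = min \<epsilon>1 \<epsilon>2"
  have e: "e \<in> {0<..<1}" using C1 C2 by (auto simp: e_def)
  obtain k E where k: "(k::nat) \<ge> 1" and E: "E > 0" and bal: "\<And>n R x. n \<ge> 1 \<Longrightarrow> R \<ge> 1 \<Longrightarrow> x \<le> C * R ^ m \<Longrightarrow>
      (\<And>\<epsilon>. \<epsilon> \<in> {0<..<e} \<Longrightarrow> x \<le> C * \<epsilon> powr (- a) * (C * real (k * n) / R) ^ (k * n) + C * R ^ m * \<epsilon> powr b) \<Longrightarrow>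
      x \<le> E * (E * real n / R) ^ n"
  proof (rule balance_regularisation[OF C1(1) b C(1) e, of m], goal_cases)
    case 1
    from 1(2-) show ?case by (rule 1(1))
  qed
  have main: "cmod (dist_fourier (dist_mult (\<rho> (k * n)) T) \<xi>) \<le> E * (E * real n / (1 + norm \<xi>)) ^ n"
    if n: "n \<ge> 1" and \<xi>: "\<xi> \<in> \<Gamma>'" for n \<xi>
  proof -
    let ?N = "k * n" and ?R = "1 + norm \<xi>"
    let ?\<theta> = "\<lambda>x. \<rho> ?N x * exp (- (\<i> * of_real (x \<bullet> \<xi>)))"
    have N: "?N \<ge> 1" using n k by simp
    have \<theta>: "?\<theta> \<in> test_functions ?K"
      by (rule test_functions_mult[OF admissible_cutoff_test_functions(2)[OF \<rho>V N] smooth_on_exponential])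
    have R: "?R \<ge> 1" by simp
    have bp2: "bounded_partials m2 (A * ?R ^ m) ?\<theta>" and bp3: "bounded_partials m3 (A * ?R ^ m) ?\<theta>"
      using bounded_partials_mono[OF bp[OF N]] by (auto simp: m_def)
    have "cmod (T ?\<theta>) \<le> E * (E * real n / ?R) ^ n"
    proof (rule bal[OF n R])
      have "cmod (T ?\<theta>) \<le> C3 * A * ?R ^ m"
        using cont[OF \<theta> bp3] by (simp add: mult.assoc)
      also have "\<dots> \<le> C * ?R ^ m"
        using C by (intro mult_right_mono) auto
      finally show "cmod (T ?\<theta>) \<le> C * ?R ^ m" .
      fix \<epsilon> assume \<epsilon>: "\<epsilon> \<in> {0<..<e}"
      have "cmod (T ?\<theta> - (LINT x|lborel. ?\<theta> x * g \<epsilon> x)) \<le> C2 * A * ?R ^ m * \<epsilon> powr b"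
        using assoc[OF _ \<theta> bp2, of \<epsilon>] \<epsilon> by (simp add: e_def mult.assoc)
      also have "\<dots> \<le> C * ?R ^ m * \<epsilon> powr b"
        using C by (intro mult_right_mono) auto
      finally have 1: "cmod (T ?\<theta> - (LINT x|lborel. ?\<theta> x * g \<epsilon> x)) \<le> C * ?R ^ m * \<epsilon> powr b" .
      \<comment> \<open>Testing \<open>g \<epsilon>\<close> with the modulated cut-off evaluates the
        transform of the localised net at \<xi>, which decays to order \<open>k * n\<close>.\<close>
      have "(LINT x|lborel. ?\<theta> x * g \<epsilon> x) = fourier (\<lambda>x. \<rho> ?N x * g \<epsilon> x) \<xi>"
        unfolding fourier_def by (simp add: mult_ac)
      then have "cmod (LINT x|lborel. ?\<theta> x * g \<epsilon> x) \<le> C1 * \<epsilon> powr (- a) * (C1 * real ?N / ?R) ^ ?N"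
        using loc[OF N \<xi>, of \<epsilon>] \<epsilon> by (simp add: e_def)
      also have "\<dots> \<le> C * \<epsilon> powr (- a) * (C * real ?N / ?R) ^ ?N"
        using C C1 by (intro mult_mono power_mono divide_right_mono) auto
      finally show "cmod (T ?\<theta>) \<le> C * \<epsilon> powr (- a) * (C * real ?N / ?R) ^ ?N + C * ?R ^ m * \<epsilon> powr b"
        using 1 norm_triangle_ineq2[of "T ?\<theta>" "LINT x|lborel. ?\<theta> x * g \<epsilon> x"] by linarith
    qed
    then show ?thesis by (simp add: dist_fourier_def dist_mult_def)
  qed
  show ?thesis
    unfolding microanalytic_def
    using admissible_cutoff_subsequence[OF \<rho>V k] \<Gamma>' E main by blast
qed

end
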